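(* Let $r$ be a positive integer, let $\alpha_1,\ldots,\alpha_r$ be non-zero algebraic numbers and let $N$ be a totally real algebraic integer. If $\alpha_1+\cdots+\alpha_r=N$ and $\alpha_1^{-1}+\cdots+\alpha_r^{-1}\neq N$, then $$\sum_{i=1}^r\log h(\alpha_i)\ \ge\ \frac12\log\frac{1+\sqrt5}{2},$$ with equality when $r=1$ and $\alpha_1=\frac{1+\sqrt5}{2}$.
   Context: $h$ denotes the absolute Weil height: for $\alpha$ in a number field $K$ of degree $D=[K:\mathbb Q]$, $\log h(\alpha)=\sum_v\log\max\{1,|\alpha|_v\}$, the sum being over all places $v$ of $K$, where $|\cdot|_v=\|\cdot\|_v^{D_v/D}$, $D_v=[K_v:\mathbb Q_p]$ is the local degree at $v\mid p$, and $\|\cdot\|_v$ is the absolute value on $K_v$ extending the usual ($p$-adic or Archimedean) absolute value on $\mathbb Q_p$. This is independent of $K$. *)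

theory Defs
  imports
    "HOL-Algebra.Finite_Extensions"
    "HOL-Algebra.Generated_Fields"
    "HOL-Algebra.QuotRing"
    "HOL-Algebra.Algebraic_Closure_Type"
    "HOL-Analysis.Analysis"
    "HOL-Computational_Algebra.Computational_Algebra"
begin

text \<open>
  Algebraic numbers are complex numbers, and number fields are subfields of \<open>\<complex>\<close> of
  finite degree over \<open>\<rat>\<close>.
\<close>

abbreviation complex_ring :: "complex ring" where
  "complex_ring \<equiv> ring_of_type_algebra"

definition adjoin_rat :: "complex \<Rightarrow> complex set" where
  "adjoin_rat \<alpha> = generate_field complex_ring {\<alpha>}"

text \<open>All conjugates, that is, all roots of the minimal polynomial over \<open>\<rat>\<close>, are real.\<close>

definition totally_real :: "complex \<Rightarrow> bool" where
  "totally_real x \<longleftrightarrow> algebraic x \<and>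
     (\<forall>p :: rat poly. irreducible p \<and> poly (map_poly of_rat p) x = 0 \<longrightarrow>
        (\<forall>z :: complex. poly (map_poly of_rat p) z = 0 \<longrightarrow> z \<in> \<real>))"

definition padic_abs :: "nat \<Rightarrow> rat \<Rightarrow> real" where
  "padic_abs p q = (if q = 0 then 0 else
     real p powi (int (multiplicity (int p) (snd (quotient_of q)))
                - int (multiplicity (int p) (fst (quotient_of q)))))"

definition absolute_value_on :: "complex set \<Rightarrow> (complex \<Rightarrow> real) \<Rightarrow> bool" where
  "absolute_value_on K v \<longleftrightarrow>
     (\<forall>x\<in>K. v x \<ge> 0 \<and> (v x = 0 \<longleftrightarrow> x = 0)) \<and>
     (\<forall>x\<in>K. \<forall>y\<in>K. v (x * y) = v x * v y) \<and>
     (\<forall>x\<in>K. \<forall>y\<in>K. v (x + y) \<le> v x + v y)"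

text \<open>
  A place of \<open>K\<close> is represented by the unique absolute value in its class that extends the usual
  Archimedean or \<open>p\<close>-adic absolute value of \<open>\<rat>\<close>. Extensionality makes the functions
  representing distinct places differ on \<open>K\<close>, so that no place is counted twice.
\<close>

definition places :: "complex set \<Rightarrow> (complex \<Rightarrow> real) set" where
  "places K = {v \<in> extensional K. absolute_value_on K v \<and>
     ((\<forall>q :: rat. v (of_rat q) = \<bar>real_of_rat q\<bar>) \<or>
      (\<exists>p. prime p \<and> (\<forall>q :: rat. v (of_rat q) = padic_abs p q)))}"

text \<open>The completion \<open>K\<^sub>v\<close>: Cauchy sequences in \<open>K\<close> modulo null sequences.\<close>

definition cauchy_seqs :: "complex set \<Rightarrow> (complex \<Rightarrow> real) \<Rightarrow> (nat \<Rightarrow> complex) set" where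
  "cauchy_seqs K v = {s. range s \<subseteq> K \<and>
     (\<forall>e>0. \<exists>M. \<forall>m\<ge>M. \<forall>n\<ge>M. v (s m - s n) < e)}"

definition null_seqs :: "complex set \<Rightarrow> (complex \<Rightarrow> real) \<Rightarrow> (nat \<Rightarrow> complex) set" where
  "null_seqs K v = {s. range s \<subseteq> K \<and> (\<lambda>n. v (s n)) \<longlonglongrightarrow> 0}"

definition cauchy_ring :: "complex set \<Rightarrow> (complex \<Rightarrow> real) \<Rightarrow> (nat \<Rightarrow> complex) ring" where
  "cauchy_ring K v = \<lparr>carrier = cauchy_seqs K v,
     monoid.mult = (\<lambda>s t n. s n * t n), one = (\<lambda>_. 1),
     ring.zero = (\<lambda>_. 0), add = (\<lambda>s t n. s n + t n)\<rparr>"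

definition completion_at :: "complex set \<Rightarrow> (complex \<Rightarrow> real) \<Rightarrow> (nat \<Rightarrow> complex) set ring" where
  "completion_at K v = cauchy_ring K v Quot null_seqs K v"

text \<open>
  The closure of \<open>\<rat>\<close> in \<open>K\<^sub>v\<close>, that is, the copy of \<open>\<rat>\<^sub>p\<close> (or of \<open>\<real>\<close>, for Archimedean \<open>v\<close>)
  inside \<open>K\<^sub>v\<close>: the classes of the Cauchy sequences of rational numbers.
\<close>

definition rat_completion ::
    "complex set \<Rightarrow> (complex \<Rightarrow> real) \<Rightarrow> (nat \<Rightarrow> complex) set set" where
  "rat_completion K v =
     (\<lambda>s. null_seqs K v +>\<^bsub>cauchy_ring K v\<^esub> s) ` cauchy_seqs \<rat> v"

definition local_degree :: "complex set \<Rightarrow> (complex \<Rightarrow> real) \<Rightarrow> nat" where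
  "local_degree K v =
     ring.dim (completion_at K v) (rat_completion K v) (carrier (completion_at K v))"

definition normalized_abs :: "complex set \<Rightarrow> (complex \<Rightarrow> real) \<Rightarrow> complex \<Rightarrow> real" where
  "normalized_abs K v x =
     v x powr (real (local_degree K v) / real (ring.dim complex_ring \<rat> K))"

text \<open>
  The height does not depend on the number field \<open>K\<close> containing the argument, so we may take
  \<open>K = \<rat>(\<alpha>)\<close>. Only finitely many terms of the sum are non-zero.
\<close>

definition weil_height_in :: "complex set \<Rightarrow> complex \<Rightarrow> real" where
  "weil_height_in K \<alpha> = exp (\<Sum>\<^sub>\<infinity>v\<in>places K. ln (max 1 (normalized_abs K v \<alpha>)))"

definition weil_height :: "complex \<Rightarrow> real" where
  "weil_height \<alpha> = weil_height_in (adjoin_rat \<alpha>) \<alpha>"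

end

theory Submission
  imports Defs "Jordan_Normal_Form.Char_Poly"
begin

text \<open>
  Put \<open>a = N - \<Sum>i. 1 / \<alpha> i\<close>, a non-zero algebraic number, and apply the product formula to \<open>a\<close>. At an
  embedding \<open>\<tau>\<close> into \<open>\<complex>\<close>, the number \<open>\<tau> N\<close> is real, so it equals the sum of the complex conjugates of the
  \<open>\<tau> (\<alpha> i)\<close> and \<open>\<bar>\<tau> a\<bar> \<le> \<Sum>i. \<bar>\<bar>\<tau> (\<alpha> i)\<bar> - 1 / \<bar>\<tau> (\<alpha> i)\<bar>\<bar> \<le> 2 sinh U\<close>, where \<open>U = \<Sum>i. \<bar>ln \<bar>\<tau> (\<alpha> i)\<bar>\<bar>\<close>. The
  tangent of the concave function \<open>ln (2 sinh U)\<close> at its zero \<open>U = ln \<phi>\<close>, with \<open>\<phi>\<close> the golden ratio, has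
  slope \<open>sqrt 5\<close>. At a finite place, integrality of \<open>N\<close> gives \<open>ln \<bar>a\<bar> \<le> \<Sum>i. \<bar>ln \<bar>\<alpha> i\<bar>\<bar>\<close>. Summing over all
  places and using that the sum of \<open>\<bar>ln \<bar>\<alpha> i\<bar>\<bar>\<close> over all places is twice the logarithmic height yields
  \<open>0 \<le> sqrt 5 * (2 * (\<Sum>i. log h(\<alpha> i)) - ln \<phi>)\<close>.

  The heights are compared with sums over conjugates: given an absolute value \<open>w\<close> on all algebraic
  numbers, each conjugate \<open>\<beta>\<close> of \<open>\<alpha>\<close> induces a place of \<open>\<rat>(\<alpha>)\<close>, and the local degree of a place is at
  least the number of conjugates that induce it.
\<close>

section \<open>Algebraic integers\<close>


text \<open>The tangent has to be taken at the zero of ln (2 sinh U). A bound ln (2 sinh U) <= s * U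
  - c with s > 0 makes twice the sum of the logarithmic heights at least c / s, the point where the
  line meets the axis. For a tangent of an increasing concave function this point is at most the
  zero, here ln \<open>golden\<close>, and it equals the zero for the tangent there. The slope sqrt
  5 = coth (ln \<open>golden\<close>) is at least 1, so the bound at finite places, of slope 1, can
  be weakened to the same slope. All numbers are written as polynomials in one primitive element
  \<theta>. Sums run over the roots t of its minimal polynomial and over finitely many rational
  places i, with one fixed extension \<open>w_abs i\<close> for each; this stands in for the places
  of a common number field. The inequality uses heights only through lower bounds, hence one
  direction of the comparison between local degrees and numbers of conjugates. The height of the
  golden ratio must also be bounded above, which requires identifying the one place that can
  contribute, and its completion.\<close>

lemma algebraic_int_if_module:
  fixes v :: "'i \<Rightarrow> complex" and c :: "'i \<Rightarrow> 'i \<Rightarrow> int"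
  assumes I: "finite I"
    and eq: "\<And>i. i \<in> I \<Longrightarrow> z * v i = (\<Sum>j\<in>I. of_int (c i j) * v j)"
    and k: "k \<in> I" "v k \<noteq> 0"
  shows "algebraic_int z"
proof -
  define n where "n = card I"
  obtain e where e: "bij_betw e {..<n} I"
    using ex_bij_betw_nat_finite[OF I] by (auto simp: n_def atLeast0LessThan)
  \<comment> \<open>The entries are the coefficients \<open>c\<close>, so \<open>z\<close> is an
    eigenvalue of an integer matrix with eigenvector \<open>u\<close>. The characteristic polynomial
    of such a matrix is monic with integer coefficients.\<close>
  define A where "A = mat n n (\<lambda>(i,j). c (e i) (e j))"
  define B where "B = (map_mat of_int A :: complex mat)"
  define u where "u = vec n (\<lambda>i. v (e i))"
  have A: "A \<in> carrier_mat n n" and B: "B \<in> carrier_mat n n" and u: "u \<in> carrier_vec n"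
    by (auto simp: A_def B_def u_def)
  have "B *\<^sub>v u = z \<cdot>\<^sub>v u"
  proof (rule eq_vecI)
    show "dim_vec (B *\<^sub>v u) = dim_vec (z \<cdot>\<^sub>v u)" by (simp add: A_def B_def u_def)
    fix i assume "i < dim_vec (z \<cdot>\<^sub>v u)"
    hence i: "i < n" by (simp add: u_def)
    hence ei: "e i \<in> I" using e by (auto simp: bij_betw_def)
    have "vec_index (B *\<^sub>v u) i = (\<Sum>j<n. of_int (c (e i) (e j)) * v (e j))"
      using i by (simp add: A_def B_def u_def scalar_prod_def atLeast0LessThan)
    also have "\<dots> = (\<Sum>j\<in>I. of_int (c (e i) j) * v j)"
      by (rule sum.reindex_bij_betw[OF e])
    also have "\<dots> = z * v (e i)" using eq[OF ei] by simp
    finally show "vec_index (B *\<^sub>v u) i = vec_index (z \<cdot>\<^sub>v u) i" using i by (simp add: u_def)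
  qed
  moreover have "u \<noteq> 0\<^sub>v n"
  proof
    assume *: "u = 0\<^sub>v n"
    obtain i where "i < n" "e i = k" using e k(1) by (force simp: bij_betw_def)
    thus False using arg_cong[OF *, of "\<lambda>w. vec_index w i"] k(2) by (simp add: u_def)
  qed
  ultimately have "eigenvector B u z" using u B by (auto simp: eigenvector_def)
  hence "poly (char_poly B) z = 0"
    using eigenvalue_root_char_poly[OF B] by (auto simp: eigenvalue_def)
  moreover have "char_poly B = map_poly of_int (char_poly A)"
    unfolding B_def by (rule of_int_hom.char_poly_hom[OF A])
  ultimately show ?thesis
    using degree_monic_char_poly[OF A] by (auto simp: algebraic_int_altdef_ipoly)
qed

text \<open>Multiplication by \<open>x\<close> acts on the powers below \<open>n\<close> through a
  companion matrix, where \<open>n\<close> is the degree of a monic integer polynomial with root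
  \<open>x\<close>. This is the input for \<open>algebraic_int_if_module\<close>.\<close>

lemma algebraic_int_powers_module:
  fixes x :: complex
  assumes "algebraic_int x"
  obtains n and a :: "nat \<Rightarrow> nat \<Rightarrow> int"
  where "n > 0" "\<And>i. i < n \<Longrightarrow> x * x ^ i = (\<Sum>j<n. of_int (a i j) * x ^ j)"
proof -
  obtain p where p: "poly (map_poly of_int p) x = 0" "lead_coeff p = 1"
    using assms by (auto simp: algebraic_int_altdef_ipoly)
  define n where "n = degree p"
  have "n > 0"
    using p by (intro Nat.gr0I) (auto simp: n_def elim!: degree_eq_zeroE)
  have "0 = (\<Sum>i\<le>n. of_int (coeff p i) * x ^ i)"
    using p(1) by (simp add: poly_altdef n_def)
  also have "\<dots> = (\<Sum>i<n. of_int (coeff p i) * x ^ i) + x ^ n"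
    using p(2) by (simp add: n_def lessThan_Suc_atMost[symmetric])
  finally have xn: "x ^ n = (\<Sum>j<n. of_int (- coeff p j) * x ^ j)"
    by (simp add: eq_neg_iff_add_eq_0 sum_negf add.commute)
  define a where "a = (\<lambda>i j. if Suc i < n then (if j = Suc i then 1 else 0) else - coeff p j)"
  have "x * x ^ i = (\<Sum>j<n. of_int (a i j) * x ^ j)" if "i < n" for i
  proof (cases "Suc i < n")
    case True
    hence "(\<Sum>j<n. of_int (a i j) * x ^ j) = (\<Sum>j<n. if j = Suc i then x ^ j else 0)"
      by (intro sum.cong) (auto simp: a_def)
    thus ?thesis using True by simp
  next
    case False
    hence "n = Suc i" using that by simp
    thus ?thesis using xn False by (simp add: a_def)
  qed
  thus ?thesis using that \<open>n > 0\<close> by blast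
qed

text \<open>The products \<open>x ^ i * y ^ j\<close> span a module stable under \<open>x\<close>
  and \<open>y\<close>; the coefficients are the Kronecker sum and the Kronecker product of two
  companion matrices. The index \<open>(0,0)\<close> carries the value 1, the non-zero entry that an
  eigenvector must have.\<close>

lemma algebraic_int_plus_mult:
  fixes x y :: complex
  assumes "algebraic_int x" "algebraic_int y"
  shows "algebraic_int (x + y)" "algebraic_int (x * y)"
proof -
  obtain n a where n: "n > 0"
    and a: "\<And>i. i < n \<Longrightarrow> x * x ^ i = (\<Sum>j<n. of_int (a i j) * x ^ j)"
    using algebraic_int_powers_module[OF assms(1)] by blast
  obtain m b where m: "m > 0"
    and b: "\<And>i. i < m \<Longrightarrow> y * y ^ i = (\<Sum>j<m. of_int (b i j) * y ^ j)"
    using algebraic_int_powers_module[OF assms(2)] by blast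
  let ?I = "{..<n} \<times> {..<m}" and ?v = "\<lambda>(i,j). x ^ i * y ^ j"
  show "algebraic_int (x + y)"
  proof (rule algebraic_int_if_module[where I = ?I and v = ?v and k = "(0,0)" and
        c = "\<lambda>(i,j) (i',j'). (if j = j' then a i i' else 0) + (if i = i' then b j j' else 0)"])
    fix ij assume "ij \<in> ?I"
    then obtain i j where ij: "ij = (i,j)" "i < n" "j < m" by auto
    have "(\<Sum>kl\<in>?I. of_int (case kl of (i',j') \<Rightarrow> (if j = j' then a i i' else 0)
            + (if i = i' then b j j' else 0)) * (?v kl)) =
          (\<Sum>k<n. \<Sum>l<m. (if j = l then of_int (a i k) * x ^ k * y ^ l else 0)
             + (if i = k then of_int (b j l) * x ^ k * y ^ l else 0))"
      unfolding sum.cartesian_product by (intro sum.cong) (auto simp: algebra_simps)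
    also have "\<dots> = (\<Sum>k<n. of_int (a i k) * x ^ k * y ^ j) + 
         (\<Sum>k<n. if i = k then (\<Sum>l<m. of_int (b j l) * x ^ k * y ^ l) else 0)"
      using ij unfolding sum.distrib 
      by (intro arg_cong2[where f = "(+)"] sum.cong) (auto intro!: sum.cong)
    also have "\<dots> = (\<Sum>k<n. of_int (a i k) * x ^ k) * y ^ j + x ^ i * (\<Sum>l<m. of_int (b j l) * y ^ l)"
      using ij by (simp add: sum_distrib_left sum_distrib_right mult_ac)
    also have "\<dots> = (x + y) * (x ^ i * y ^ j)"
      using a[OF ij(2)] b[OF ij(3)] by (simp flip: mult.assoc) (simp add: algebra_simps)
    finally show "(x + y) * ?v ij = (\<Sum>kl\<in>?I. of_int ((case ij of (i,j) \<Rightarrow> \<lambda>(i',j'). 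
       (if j = j' then a i i' else 0) + (if i = i' then b j j' else 0)) kl) * ?v kl)"
      by (simp add: ij)
  qed (use n m in auto)
  show "algebraic_int (x * y)"
  proof (rule algebraic_int_if_module[where I = ?I and v = ?v and k = "(0,0)" and
        c = "\<lambda>(i,j) (i',j'). a i i' * b j j'"])
    fix ij assume "ij \<in> ?I"
    then obtain i j where ij: "ij = (i,j)" "i < n" "j < m" by auto
    have "(\<Sum>kl\<in>?I. of_int (case kl of (i',j') \<Rightarrow> a i i' * b j j') * (?v kl)) =
          (\<Sum>k<n. of_int (a i k) * x ^ k) * (\<Sum>l<m. of_int (b j l) * y ^ l)"
      unfolding sum_product sum.cartesian_product by (intro sum.cong) auto
    also have "\<dots> = (x * y) * (x ^ i * y ^ j)"
      unfolding a[OF ij(2), symmetric] b[OF ij(3), symmetric] by (simp only: mult_ac)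
    finally show "(x * y) * ?v ij = (\<Sum>kl\<in>?I. of_int ((case ij of (i,j) \<Rightarrow> \<lambda>(i',j'). 
       a i i' * b j j') kl) * ?v kl)"
      by (simp add: ij)
  qed (use n m in auto)
qed

lemma algebraic_int_power:
  fixes x :: complex
  assumes "algebraic_int x"
  shows "algebraic_int (x ^ n)"
  by (induction n) (auto intro: algebraic_int_plus_mult assms)

lemma algebraic_imp_int_multiple:
  fixes x :: complex
  assumes "algebraic x"
  obtains k :: int where "k \<noteq> 0" "algebraic_int (of_int k * x)"
proof -
  obtain p where p: "p \<noteq> 0" "poly (map_poly of_int p) x = 0"
    using algebraicE'[OF assms] by blast
  define n where "n = degree p"
  define k where "k = lead_coeff p"
  have k: "k \<noteq> 0" using p by (simp add: k_def)
  have "n > 0"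
    using p by (intro Nat.gr0I) (auto simp: n_def elim!: degree_eq_zeroE)
  \<comment> \<open>This is k^(n-1) * p(X / k) with k the leading coefficient: the factor clears the
    denominators and leaves a monic polynomial.\<close>
  define q where "q = monom 1 n + (\<Sum>i<n. monom (coeff p i * k ^ (n - 1 - i)) i)"
  have cq: "coeff q i = (if i = n then 1 else if i < n then coeff p i * k ^ (n - 1 - i) else 0)" for i
    by (auto simp: q_def coeff_sum coeff_monom)
  have dq: "degree q = n"
    by (rule antisym) (auto intro!: degree_le le_degree simp: cq)
  have "poly (map_poly of_int q) (of_int k * x) = (\<Sum>i\<le>n. of_int (coeff q i) * (of_int k * x) ^ i)"
    by (simp add: poly_altdef dq)
  also have "\<dots> = (\<Sum>i\<le>n. of_int (k ^ (n - 1)) * (of_int (coeff p i) * x ^ i))"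
  proof (intro sum.cong refl)
    fix i assume "i \<in> {..n}"
    show "of_int (coeff q i) * (of_int k * x) ^ i = of_int (k ^ (n - 1)) * (of_int (coeff p i) * x ^ i)"
    proof (cases "i = n")
      case True
      have "k ^ n = k ^ (n - 1) * k" using \<open>n > 0\<close> by (simp add: power_eq_if)
      thus ?thesis using True by (simp add: cq power_mult_distrib k_def n_def flip: of_int_power of_int_mult)
    next
      case False
      hence "i < n" using \<open>i \<in> _\<close> by simp
      hence "k ^ (n - 1) = k ^ (n - 1 - i) * k ^ i" by (simp flip: power_add)
      thus ?thesis using \<open>i < n\<close> by (simp add: cq power_mult_distrib)
    qed
  qed
  also have "\<dots> = of_int (k ^ (n - 1)) * poly (map_poly of_int p) x"
    by (simp add: poly_altdef n_def sum_distrib_left)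
  also have "\<dots> = 0" using p by simp
  finally have "algebraic_int (of_int k * x)"
    using dq cq by (auto simp: algebraic_int_altdef_ipoly intro!: exI[of _ q])
  thus ?thesis using that k by blast
qed

lemma algebraic_if_int_multiple:
  fixes x :: complex
  assumes "algebraic_int (of_int k * x)" "k \<noteq> 0"
  shows "algebraic x"
proof -
  obtain p where p: "poly (map_poly of_int p) (of_int k * x) = 0" "lead_coeff p = 1"
    using assms by (auto simp: algebraic_int_altdef_ipoly)
  define q where "q = map_poly (of_int :: int \<Rightarrow> complex) p \<circ>\<^sub>p [:0, of_int k:]"
  have "p \<noteq> 0" using p(2) by auto
  hence q: "q \<noteq> 0" using assms(2) by (auto simp: q_def pcompose_eq_0_iff map_poly_eq_0_iff)
  have "coeff q i \<in> \<int>" for i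
    unfolding q_def
    by (rule coeff_pcompose_semiring_closed) (auto simp: coeff_pCons split: nat.splits)
  moreover have "poly q x = 0" using p(1) by (simp add: q_def poly_pcompose mult.commute)
  ultimately show ?thesis using q by (auto simp: algebraic_def)
qed

lemma algebraic_plus_mult:
  fixes x y :: complex
  assumes "algebraic x" "algebraic y"
  shows "algebraic (x + y)" "algebraic (x * y)"
proof -
  obtain k l where kl: "k \<noteq> 0" "l \<noteq> 0" "algebraic_int (of_int k * x)" "algebraic_int (of_int l * y)"
    using assms by (meson algebraic_imp_int_multiple)
  have "algebraic_int (of_int l * (of_int k * x) + of_int k * (of_int l * y))"
    by (intro algebraic_int_plus_mult kl algebraic_int_of_int)
  also have "of_int l * (of_int k * x) + of_int k * (of_int l * y) = of_int (k * l) * (x + y)"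
    by (simp add: algebra_simps)
  finally show "algebraic (x + y)" using kl by (intro algebraic_if_int_multiple[of "k * l"]) auto
  have "algebraic_int ((of_int k * x) * (of_int l * y))"
    by (intro algebraic_int_plus_mult kl)
  also have "(of_int k * x) * (of_int l * y) = of_int (k * l) * (x * y)"
    by (simp add: algebra_simps)
  finally show "algebraic (x * y)" using kl by (intro algebraic_if_int_multiple[of "k * l"]) auto
qed

lemma algebraic_of_rat [simp]: "algebraic (of_rat q :: complex)"
  by (rule algebraicI'[of "[:- of_rat q, 1:]"]) (auto simp: coeff_pCons split: nat.splits)

lemma algebraic_diff:
  fixes x y :: complex
  shows "algebraic x \<Longrightarrow> algebraic y \<Longrightarrow> algebraic (x - y)"
  using algebraic_plus_mult(1)[of x "- y"] by simp

lemma algebraic_sum: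
  fixes f :: "'a \<Rightarrow> complex"
  shows "(\<And>i. i \<in> A \<Longrightarrow> algebraic (f i)) \<Longrightarrow> algebraic (\<Sum>i\<in>A. f i)"
  by (induction A rule: infinite_finite_induct) (auto intro: algebraic_plus_mult)

lemma algebraic_power:
  fixes x :: complex
  shows "algebraic x \<Longrightarrow> algebraic (x ^ n)"
  using algebraic_of_rat[of 1] by (induction n) (auto intro: algebraic_plus_mult)

section \<open>Extending the \<open>p\<close>-adic absolute value to the algebraic numbers\<close>


text \<open>
  \<open>scaled_valid p x s\<close> says that \<open>x / p\<^sup>s\<close> is integral over the localization of \<open>\<int>\<close> at \<open>p\<close>. The resulting
  \<open>spectral_norm p\<close> is the maximum of all extensions of the \<open>p\<close>-adic absolute value to the algebraic
  numbers; an extension is found as a minimal seminorm below it.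
\<close>

definition scaled_valid :: "nat \<Rightarrow> complex \<Rightarrow> rat \<Rightarrow> bool" where
  "scaled_valid p x s \<longleftrightarrow>
     (\<exists>m::int. \<not> int p dvd m \<and> algebraic_int (of_int m * x / of_real (real p powr of_rat s)))"

definition spectral_norm :: "nat \<Rightarrow> complex \<Rightarrow> real" where
  "spectral_norm p x =
     (if algebraic x then Inf {real p powr - of_rat s | s. scaled_valid p x s} else 0)"

lemma algebraic_int_if_power:
  fixes x :: complex
  assumes "algebraic_int (x ^ n)" "n > 0"
  shows "algebraic_int x"
proof (rule algebraic_int_root[OF assms(1), of "monom 1 n"])
  show "poly (monom 1 n) x = x ^ n" by (simp add: poly_monom)
  show "\<forall>i. coeff (monom 1 n) i \<in> (\<int> :: complex set)" by auto
qed (use assms in \<open>auto simp: degree_monom_eq\<close>)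

context
  fixes p :: nat
  assumes p: "prime p"
begin

lemma p_gt_1: "real p > 1"
  using prime_gt_1_nat[OF p] by simp

text \<open>For s = a / b, the b-th power of this real number is the integer p^a.\<close>

lemma algebraic_int_p_powr:
  assumes "s \<ge> 0"
  shows "algebraic_int (complex_of_real (real p powr of_rat s))"
proof -
  obtain a b where ab: "s = of_int a / of_int b" "b > 0"
    by (metis quotient_of_div quotient_of_denom_pos prod.exhaust)
  with assms have a: "a \<ge> 0" by (simp add: zero_le_divide_iff)
  have "(real p powr of_rat s) ^ nat b = real p powr (of_rat s * real (nat b))"
    using p_gt_1 by (simp add: powr_powr flip: powr_realpow)
  also have "of_rat s * real (nat b) = real (nat a)"
    using ab a by (simp add: of_rat_divide)
  also have "real p powr real (nat a) = real (p ^ nat a)"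
    using p_gt_1 by (simp add: powr_realpow)
  finally have "complex_of_real (real p powr of_rat s) ^ nat b = of_nat (p ^ nat a)"
    by (metis of_real_power of_real_of_nat_eq)
  hence "algebraic_int (complex_of_real (real p powr of_rat s) ^ nat b)"
    by (simp only: algebraic_int_of_nat)
  thus ?thesis by (rule algebraic_int_if_power) (use ab(2) in simp)
qed

lemma scaled_valid_antimono:
  assumes "scaled_valid p x s" "t \<le> s"
  shows "scaled_valid p x t"
proof -
  obtain m where m: "\<not> int p dvd m" "algebraic_int (of_int m * x / of_real (real p powr of_rat s))"
    using assms by (auto simp: scaled_valid_def)
  have "algebraic_int (of_int m * x / of_real (real p powr of_rat s) * of_real (real p powr of_rat (s - t)))"
    using assms by (intro algebraic_int_plus_mult m algebraic_int_p_powr) simp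
  also have "real p powr of_rat (s - t) = real p powr of_rat s / real p powr of_rat t"
    by (simp add: of_rat_diff powr_diff)
  also have "of_int m * x / of_real (real p powr of_rat s) * of_real (real p powr of_rat s / real p powr of_rat t)
     = of_int m * x / of_real (real p powr of_rat t)"
    using p_gt_1 by simp
  finally show ?thesis using m by (auto simp: scaled_valid_def)
qed

lemma scaled_valid_mult:
  assumes "scaled_valid p x s" "scaled_valid p y t"
  shows "scaled_valid p (x * y) (s + t)"
proof -
  obtain m where m: "\<not> int p dvd m" "algebraic_int (of_int m * x / of_real (real p powr of_rat s))"
    using assms by (auto simp: scaled_valid_def)
  obtain k where k: "\<not> int p dvd k" "algebraic_int (of_int k * y / of_real (real p powr of_rat t))"
    using assms by (auto simp: scaled_valid_def)
  have "algebraic_int (of_int m * x / of_real (real p powr of_rat s) * (of_int k * y / of_real (real p powr of_rat t)))"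
    by (intro algebraic_int_plus_mult m k)
  also have "of_int m * x / of_real (real p powr of_rat s) * (of_int k * y / of_real (real p powr of_rat t))
     = of_int (m * k) * (x * y) / of_real (real p powr of_rat (s + t))"
    by (simp add: of_rat_add powr_add)
  finally show ?thesis
    using m k p by (auto simp: scaled_valid_def prime_dvd_mult_iff intro!: exI[of _ "m * k"])
qed

lemma scaled_valid_add:
  assumes "scaled_valid p x s" "scaled_valid p y s"
  shows "scaled_valid p (x + y) s"
proof -
  obtain m where m: "\<not> int p dvd m" "algebraic_int (of_int m * x / of_real (real p powr of_rat s))"
    using assms by (auto simp: scaled_valid_def)
  obtain k where k: "\<not> int p dvd k" "algebraic_int (of_int k * y / of_real (real p powr of_rat s))"
    using assms by (auto simp: scaled_valid_def)
  have "algebraic_int (of_int k * (of_int m * x / of_real (real p powr of_rat s)) +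
          of_int m * (of_int k * y / of_real (real p powr of_rat s)))"
    by (intro algebraic_int_plus_mult m k algebraic_int_of_int)
  also have "of_int k * (of_int m * x / of_real (real p powr of_rat s)) +
          of_int m * (of_int k * y / of_real (real p powr of_rat s))
     = of_int (m * k) * (x + y) / of_real (real p powr of_rat s)"
    using p_gt_1 by (simp add: field_simps)
  finally show ?thesis
    using m k p by (auto simp: scaled_valid_def prime_dvd_mult_iff intro!: exI[of _ "m * k"])
qed

lemma scaled_valid_root:
  assumes "scaled_valid p (x ^ n) s" "n > 0"
  shows "scaled_valid p x (s / of_nat n)"
proof -
  obtain m where m: "\<not> int p dvd m" "algebraic_int (of_int m * x ^ n / of_real (real p powr of_rat s))"
    using assms by (auto simp: scaled_valid_def)
  have "algebraic_int (of_int (m ^ (n - 1)) * (of_int m * x ^ n / of_real (real p powr of_rat s)))"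
    by (intro algebraic_int_plus_mult m algebraic_int_of_int)
  also have "real p powr of_rat s = (real p powr of_rat (s / of_nat n)) ^ n"
    using p_gt_1 assms(2) by (simp add: powr_powr of_rat_divide flip: powr_realpow)
  also have "of_int (m ^ (n - 1)) * (of_int m * x ^ n / of_real ((real p powr of_rat (s / of_nat n)) ^ n))
      = (of_int m * x / of_real (real p powr of_rat (s / of_nat n))) ^ n"
    using assms(2) by (cases n) (auto simp: field_simps power_mult_distrib)
  finally have "algebraic_int (of_int m * x / of_real (real p powr of_rat (s / of_nat n)))"
    by (rule algebraic_int_if_power) fact
  thus ?thesis using m by (auto simp: scaled_valid_def)
qed

text \<open>For s = a / b > 0, the number m^b / p^a would be a rational algebraic integer, hence an
  integer, and \<open>p\<close> would divide \<open>m\<close>. This gives the lower bound for the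
  spectral norm of 1.\<close>

lemma scaled_valid_one_imp: "scaled_valid p 1 s \<Longrightarrow> s \<le> 0"
proof (rule ccontr)
  assume *: "scaled_valid p 1 s" "\<not> s \<le> 0"
  obtain m where m: "\<not> int p dvd m" "algebraic_int (of_int m / complex_of_real (real p powr of_rat s))"
    using * by (auto simp: scaled_valid_def)
  obtain a b where ab: "s = of_int a / of_int b" "b > 0"
    by (metis quotient_of_div quotient_of_denom_pos prod.exhaust)
  with * have a: "a > 0" by (simp add: zero_less_divide_iff not_le)
  have "(real p powr of_rat s) ^ nat b = real p powr (of_rat s * real (nat b))"
    using p_gt_1 by (simp add: powr_powr flip: powr_realpow)
  also have "of_rat s * real (nat b) = real (nat a)"
    using ab a by (simp add: of_rat_divide)
  also have "real p powr real (nat a) = real (p ^ nat a)"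
    using p_gt_1 by (simp add: powr_realpow)
  finally have eq: "complex_of_real (real p powr of_rat s) ^ nat b = of_nat (p ^ nat a)"
    by (metis of_real_power of_real_of_nat_eq)
  have "algebraic_int ((of_int m / complex_of_real (real p powr of_rat s)) ^ nat b)"
    by (intro algebraic_int_power m)
  also have "(of_int m / complex_of_real (real p powr of_rat s)) ^ nat b = of_int (m ^ nat b) / of_int (int p ^ nat a)"
    by (simp only: power_divide eq) simp
  finally have "of_int (m ^ nat b) / of_int (int p ^ nat a) \<in> (\<int> :: complex set)"
    by (rule rational_algebraic_int_is_int) (intro Rats_divide Rats_of_int)
  then obtain c where "of_int (m ^ nat b) / of_int (int p ^ nat a) = (of_int c :: complex)"
    by (elim Ints_cases)
  hence "(of_int (m ^ nat b) :: complex) = of_int (c * int p ^ nat a)"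
    using p_gt_1 by (simp add: field_simps)
  hence "m ^ nat b = c * int p ^ nat a" by (simp only: of_int_eq_iff)
  hence "int p dvd m ^ nat b" using a by (simp add: dvd_power)
  thus False using m p by (simp add: prime_dvd_power)
qed

lemma scaled_valid_exists:
  assumes "algebraic x"
  shows "\<exists>s. scaled_valid p x s"
proof -
  obtain k where k: "k \<noteq> 0" "algebraic_int (of_int k * x)"
    using algebraic_imp_int_multiple[OF assms] by blast
  have "\<not> is_unit (int p)" using p_gt_1 by (simp add: zdvd1_eq)
  then obtain e m where m: "k = int p ^ e * m" "\<not> int p dvd m"
    using multiplicity_decompose'[OF k(1)] by blast
  have "of_int m * x / of_real (real p powr of_rat (- of_nat e)) = of_int k * x"
    using p_gt_1 by (simp add: m(1) of_rat_minus powr_minus powr_realpow field_simps)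
  hence "scaled_valid p x (- of_nat e)" unfolding scaled_valid_def using m k by auto
  thus ?thesis by blast
qed

lemma spectral_norm_le: "scaled_valid p x s \<Longrightarrow> algebraic x \<Longrightarrow> spectral_norm p x \<le> real p powr - of_rat s"
  by (auto simp: spectral_norm_def intro!: cInf_lower bdd_belowI[of _ 0])

lemma spectral_norm_lessD:
  assumes "algebraic x" "spectral_norm p x < t"
  obtains s where "scaled_valid p x s" "real p powr - of_rat s < t"
proof -
  let ?A = "{real p powr - of_rat s | s. scaled_valid p x s}"
  have "?A \<noteq> {}" using scaled_valid_exists[OF assms(1)] by blast
  moreover have "Inf ?A < t" using assms by (simp add: spectral_norm_def)
  ultimately have "\<exists>a\<in>?A. a < t" by (rule cInf_lessD)
  thus ?thesis using that by auto
qed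

lemma spectral_norm_ge:
  assumes "algebraic x" "\<And>s. scaled_valid p x s \<Longrightarrow> t \<le> real p powr - of_rat s"
  shows "t \<le> spectral_norm p x"
  using assms spectral_norm_lessD by (metis not_le)

lemma spectral_norm_nonneg: "spectral_norm p x \<ge> 0"
proof (cases "algebraic x")
  case True
  thus ?thesis by (rule spectral_norm_ge) simp
qed (simp add: spectral_norm_def)

lemma spectral_norm_mult_le:
  assumes "algebraic x" "algebraic y"
  shows "spectral_norm p (x * y) \<le> spectral_norm p x * spectral_norm p y"
proof (rule ccontr)
  assume "\<not> ?thesis"
  hence *: "spectral_norm p x * spectral_norm p y < spectral_norm p (x * y)" by simp
  have "((\<lambda>e. (spectral_norm p x + e) * (spectral_norm p y + e)) \<longlongrightarrow>
           (spectral_norm p x + 0) * (spectral_norm p y + 0)) (at_right 0)"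
    by (intro tendsto_intros)
  hence "\<forall>\<^sub>F e in at_right 0. (spectral_norm p x + e) * (spectral_norm p y + e) < spectral_norm p (x * y)"
    using * by (auto dest: order_tendstoD(2))
  moreover have "\<forall>\<^sub>F e in at_right 0. e > (0::real)" by (simp add: eventually_at_right_less)
  ultimately have "\<forall>\<^sub>F e in at_right 0. e > (0::real) \<and> (spectral_norm p x + e) * (spectral_norm p y + e) < spectral_norm p (x * y)"
    by eventually_elim auto
  then obtain e where e: "e > 0" "(spectral_norm p x + e) * (spectral_norm p y + e) < spectral_norm p (x * y)"
    using eventually_happens[of _ "at_right (0::real)"] by (auto simp: trivial_limit_at_right_real)
  obtain s where s: "scaled_valid p x s" "real p powr - of_rat s < spectral_norm p x + e"
    using spectral_norm_lessD[OF assms(1), of "spectral_norm p x + e"] e by auto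
  obtain t where t: "scaled_valid p y t" "real p powr - of_rat t < spectral_norm p y + e"
    using spectral_norm_lessD[OF assms(2), of "spectral_norm p y + e"] e by auto
  have "spectral_norm p (x * y) \<le> real p powr - of_rat (s + t)"
    by (intro spectral_norm_le scaled_valid_mult s t algebraic_plus_mult assms)
  also have "\<dots> = real p powr - of_rat s * real p powr - of_rat t"
    by (simp add: of_rat_add powr_add[symmetric])
  also have "\<dots> \<le> (spectral_norm p x + e) * (spectral_norm p y + e)"
    using s t e spectral_norm_nonneg by (intro mult_mono) (auto intro: add_nonneg_nonneg less_imp_le)
  finally show False using e by simp
qed

lemma spectral_norm_add_le:
  assumes "algebraic x" "algebraic y"
  shows "spectral_norm p (x + y) \<le> max (spectral_norm p x) (spectral_norm p y)"
proof (rule ccontr)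
  assume "\<not> ?thesis"
  hence *: "spectral_norm p x < spectral_norm p (x + y)" "spectral_norm p y < spectral_norm p (x + y)"
    by auto
  obtain s where s: "scaled_valid p x s" "real p powr - of_rat s < spectral_norm p (x + y)"
    using spectral_norm_lessD[OF assms(1) *(1)] by auto
  obtain t where t: "scaled_valid p y t" "real p powr - of_rat t < spectral_norm p (x + y)"
    using spectral_norm_lessD[OF assms(2) *(2)] by auto
  have "scaled_valid p (x + y) (min s t)"
    by (intro scaled_valid_add scaled_valid_antimono[OF s(1)] scaled_valid_antimono[OF t(1)]) auto
  hence "spectral_norm p (x + y) \<le> real p powr - of_rat (min s t)"
    by (intro spectral_norm_le algebraic_plus_mult assms)
  thus False using s t by (auto simp: min_def split: if_splits)
qed

lemma spectral_norm_one: "spectral_norm p 1 = 1"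
proof (rule antisym)
  have "scaled_valid p 1 0"
    using prime_gt_1_nat[OF p] by (auto simp: scaled_valid_def zdvd1_eq intro!: exI[of _ 1])
  thus "spectral_norm p 1 \<le> 1"
    using spectral_norm_le[of 1 0] p_gt_1 algebraic_of_rat[of 1] by simp
  show "spectral_norm p 1 \<ge> 1"
  proof (rule spectral_norm_ge)
    fix s assume "scaled_valid p 1 s"
    hence "- real_of_rat s \<ge> 0" by (auto dest: scaled_valid_one_imp)
    thus "real p powr - of_rat s \<ge> 1" using p_gt_1 by (intro ge_one_powr_ge_zero) auto
  qed (use algebraic_of_rat[of 1] in simp)
qed

lemma spectral_norm_power:
  assumes "algebraic x"
  shows "spectral_norm p (x ^ n) = spectral_norm p x ^ n"
proof (cases "n = 0")
  case True
  thus ?thesis by (simp add: spectral_norm_one)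
next
  case False
  show ?thesis
  proof (rule antisym)
    show "spectral_norm p (x ^ n) \<le> spectral_norm p x ^ n"
    proof (induction n)
      case (Suc n)
      have "spectral_norm p (x ^ Suc n) \<le> spectral_norm p x * spectral_norm p (x ^ n)"
        using spectral_norm_mult_le[OF assms algebraic_power[OF assms]] by simp
      also have "\<dots> \<le> spectral_norm p x * spectral_norm p x ^ n"
        by (intro mult_left_mono Suc spectral_norm_nonneg)
      finally show ?case by simp
    qed (simp add: spectral_norm_one)
    show "spectral_norm p x ^ n \<le> spectral_norm p (x ^ n)"
    proof (rule spectral_norm_ge)
      fix s assume s: "scaled_valid p (x ^ n) s"
      have "spectral_norm p x \<le> real p powr - of_rat (s / of_nat n)"
        using scaled_valid_root[OF s] False by (intro spectral_norm_le assms) auto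
      hence "spectral_norm p x ^ n \<le> (real p powr - of_rat (s / of_nat n)) ^ n"
        by (intro power_mono spectral_norm_nonneg)
      also have "\<dots> = real p powr - of_rat s"
        using p_gt_1 False by (simp add: powr_powr of_rat_divide flip: powr_realpow)
      finally show "spectral_norm p x ^ n \<le> real p powr - of_rat s" .
    qed (intro algebraic_power assms)
  qed
qed

text \<open>Power-multiplicativity is among the conditions because it gives
  \<open>N (f ^ n) / N f ^ n = 1\<close>, so that the limit construction below keeps the value 1 at
  1. With the value 0 fixed at transcendental numbers, comparing two members as functions compares
  them on algebraic numbers.\<close>

definition padic_seminorms :: "(complex \<Rightarrow> real) set" where
  "padic_seminorms = {N. (\<forall>x. \<not> algebraic x \<longrightarrow> N x = 0) \<and> (\<forall>x. 0 \<le> N x \<and> N x \<le> spectral_norm p x) \<and> N 1 = 1 \<and>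
     (\<forall>x y. algebraic x \<longrightarrow> algebraic y \<longrightarrow> N (x * y) \<le> N x * N y \<and> N (x + y) \<le> max (N x) (N y)) \<and>
     (\<forall>x n. algebraic x \<longrightarrow> N (x ^ n) = N x ^ n)}"

lemma spectral_norm_in: "spectral_norm p \<in> padic_seminorms"
  unfolding padic_seminorms_def
proof (intro CollectI conjI allI impI)
  show "spectral_norm p x = 0" if "\<not> algebraic x" for x
    using that by (simp add: spectral_norm_def)
qed (assumption | rule spectral_norm_power spectral_norm_one spectral_norm_mult_le
      spectral_norm_add_le spectral_norm_nonneg order_refl)+

lemma padic_seminormsD:
  assumes "N \<in> padic_seminorms"
  shows "\<not> algebraic x \<Longrightarrow> N x = 0" and "0 \<le> N x" and "N x \<le> spectral_norm p x" and "N 1 = 1"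
    and "algebraic x \<Longrightarrow> algebraic y \<Longrightarrow> N (x * y) \<le> N x * N y"
    and "algebraic x \<Longrightarrow> algebraic y \<Longrightarrow> N (x + y) \<le> max (N x) (N y)"
    and "algebraic x \<Longrightarrow> N (x ^ n) = N x ^ n"
  using assms unfolding padic_seminorms_def by blast+

lemma padic_seminorms_chain:
  assumes C: "C \<subseteq> padic_seminorms" "C \<noteq> {}"
    and chain: "\<And>N N'. N \<in> C \<Longrightarrow> N' \<in> C \<Longrightarrow> N \<le> N' \<or> N' \<le> N"
  shows "(\<lambda>x. INF N\<in>C. N x) \<in> padic_seminorms"
proof -
  define I where "I = (\<lambda>x. INF N\<in>C. N x)"
  have CD: "N \<in> padic_seminorms" if "N \<in> C" for N using C(1) that by (rule subsetD)
  note D = padic_seminormsD[OF CD]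
  have bdd: "bdd_below ((\<lambda>N. N x) ` C)" for x
    by (rule bdd_belowI[of _ 0]) (auto intro: D(2))
  have le: "I x \<le> N x" if "N \<in> C" for N x
    unfolding I_def using bdd that by (rule cINF_lower)
  have ge: "t \<le> I x" if "\<And>N. N \<in> C \<Longrightarrow> t \<le> N x" for t x
    unfolding I_def using that C by (intro cINF_greatest) auto
  have less: "\<exists>N\<in>C. N x < t" if "I x < t" for x t
    using ge[of t x] that by (meson not_le)
  \<comment> \<open>Here the chain condition enters: of two members that are near the infimum at one
    point each, the smaller one is near it at both points.\<close>
  have less2: "\<exists>N\<in>C. N x < t \<and> N y < u" if xt: "I x < t" and yu: "I y < u" for x t y u
  proof -
    obtain N N' where "N \<in> C" "N x < t" "N' \<in> C" "N' y < u"
      using less[OF xt] less[OF yu] by blast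
    thus ?thesis using chain[of N N'] by (meson le_funD le_less_trans)
  qed
  have nonneg: "I x \<ge> 0" for x
    by (rule ge) (rule D(2))
  obtain N0 where N0: "N0 \<in> C" using C by auto
  have "I x = 0" if "\<not> algebraic x" for x
    using le[OF N0, of x] nonneg[of x] D(1)[OF N0 that] by simp
  moreover have "I x \<le> spectral_norm p x" for x
    using le[OF N0, of x] D(3)[OF N0, of x] by simp
  moreover have "I 1 = 1"
    using le[OF N0, of 1] D(4)[OF N0] ge[of 1 1] D(4) by (metis antisym order_refl)
  moreover have "I (x * y) \<le> I x * I y" if xy: "algebraic x" "algebraic y" for x y
  proof -
    have *: "I (x * y) \<le> (I x + e) * (I y + e)" if "e > 0" for e
    proof -
      have *: "I x < I x + e" "I y < I y + e" using \<open>e > 0\<close> by auto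
      obtain N where N: "N \<in> C" "N x < I x + e" "N y < I y + e"
        using less2[OF *] by blast
      have "I (x * y) \<le> N (x * y)" by (rule le) fact
      also have "\<dots> \<le> N x * N y" by (rule D(5)[OF N(1) xy])
      also have "\<dots> \<le> (I x + e) * (I y + e)"
        using N nonneg[of x] \<open>e > 0\<close> D(2)[OF N(1)] by (intro mult_mono) auto
      finally show ?thesis .
    qed
    have "((\<lambda>e. (I x + e) * (I y + e)) \<longlongrightarrow> (I x + 0) * (I y + 0)) (at_right 0)"
      by (intro tendsto_intros)
    moreover have "\<forall>\<^sub>F e in at_right 0. I (x * y) \<le> (I x + e) * (I y + e)"
      using eventually_at_right_less[of "0::real"] by eventually_elim (rule *)
    ultimately show ?thesis
      using tendsto_lowerbound[of "\<lambda>e. (I x + e) * (I y + e)"] by simp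
  qed
  moreover have "I (x + y) \<le> max (I x) (I y)" if xy: "algebraic x" "algebraic y" for x y
  proof (rule ccontr)
    assume "\<not> ?thesis"
    hence *: "I x < I (x + y)" "I y < I (x + y)" by auto
    obtain N where N: "N \<in> C" "N x < I (x + y)" "N y < I (x + y)"
      using less2[OF *] by blast
    have "N (x + y) \<le> max (N x) (N y)" by (rule D(6)[OF N(1) xy])
    also have "\<dots> < I (x + y)" using N by simp
    finally show False using le[OF N(1), of "x + y"] by simp
  qed
  moreover have "I (x ^ n) = I x ^ n" if x: "algebraic x" for x n
  proof (rule antisym)
    have pw: "N (x ^ n) = N x ^ n" if "N \<in> C" for N
      by (rule D(7)[OF that x])
    show "I x ^ n \<le> I (x ^ n)"
      by (rule ge) (auto simp: pw intro!: power_mono le nonneg)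
    have *: "I (x ^ n) \<le> (I x + e) ^ n" if "e > 0" for e
    proof -
      have *: "I x < I x + e" using \<open>e > 0\<close> by auto
      obtain N where N: "N \<in> C" "N x < I x + e"
        using less[OF *] by blast
      have "I (x ^ n) \<le> N x ^ n" using le[OF N(1), of "x ^ n"] pw[OF N(1)] by simp
      also have "\<dots> \<le> (I x + e) ^ n"
        using N D(2)[OF N(1)] by (intro power_mono) auto
      finally show ?thesis .
    qed
    have "((\<lambda>e. (I x + e) ^ n) \<longlongrightarrow> (I x + 0) ^ n) (at_right 0)"
      by (intro tendsto_intros)
    moreover have "\<forall>\<^sub>F e in at_right 0. I (x ^ n) \<le> (I x + e) ^ n"
      using eventually_at_right_less[of "0::real"] by eventually_elim (rule *)
    ultimately show "I (x ^ n) \<le> I x ^ n"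
      using tendsto_lowerbound[of "\<lambda>e. (I x + e) ^ n"] by simp
  qed
  ultimately show ?thesis using nonneg unfolding I_def[symmetric] padic_seminorms_def by (intro CollectI conjI allI impI)
qed

lemma padic_seminorms_minimal:
  obtains N where "N \<in> padic_seminorms" "\<And>N'. N' \<in> padic_seminorms \<Longrightarrow> N' \<le> N \<Longrightarrow> N' = N"
proof -
  \<comment> \<open>The order is reversed: chains are bounded by their pointwise infimum, and a
    maximal element is a minimal seminorm.\<close>
  let ?R = "relation_of (\<lambda>N N'. N' \<le> N) padic_seminorms"
  have "\<exists>m\<in>padic_seminorms. \<forall>a\<in>padic_seminorms. a \<le> m \<longrightarrow> a = m"
  proof (rule predicate_Zorn)
    show "partial_order_on padic_seminorms ?R"
      by (rule partial_order_on_relation_ofI) auto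
    fix C assume C: "C \<in> Chains ?R"
    hence C': "C \<subseteq> padic_seminorms" by (rule Chains_relation_of)
    show "\<exists>u\<in>padic_seminorms. \<forall>a\<in>C. u \<le> a"
    proof (cases "C = {}")
      case True
      thus ?thesis using spectral_norm_in by auto
    next
      case False
      have "bdd_below ((\<lambda>N. N x) ` C)" for x
        using C' by (intro bdd_belowI[of _ 0]) (auto intro: padic_seminormsD(2))
      hence "(\<lambda>x. INF N\<in>C. N x) \<le> a" if "a \<in> C" for a
        using that by (auto simp: le_fun_def intro!: cINF_lower)
      moreover have "(\<lambda>x. INF N\<in>C. N x) \<in> padic_seminorms"
        using C by (intro padic_seminorms_chain C' False) (auto simp: Chains_def relation_of_def)
      ultimately show ?thesis by blast
    qed
  qed
  thus ?thesis using that by blast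
qed

text \<open>
  Replacing \<open>N x\<close> by the limit of \<open>N (x f\<^sup>n) / N f\<^sup>n\<close> makes \<open>N\<close> smaller and multiplicative in \<open>f\<close>, so a
  minimal seminorm is multiplicative.
\<close>

lemma padic_seminorms_smaller:
  assumes N: "N \<in> padic_seminorms" and f: "algebraic f" "f \<noteq> 0"
  obtains N' where "N' \<in> padic_seminorms" "N' \<le> N" "\<And>x. algebraic x \<Longrightarrow> N' x * N f \<le> N (x * f)"
    "N f > 0"
proof -
  note alg = algebraic_plus_mult algebraic_power
  note N1 = padic_seminormsD(1)[OF N] and N2 = padic_seminormsD(2,3)[OF N]
    and N3 = padic_seminormsD(4)[OF N] and N4 = padic_seminormsD(5,6)[OF N]
    and N5 = padic_seminormsD(7)[OF N]
  \<comment> \<open>Since \<open>f\<close> is invertible, \<open>N f\<close> cannot vanish and its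
    powers may be divided by.\<close>
  have "N 1 \<le> N f * N (inverse f)" using N4(1)[OF f(1) algebraic_inverse[OF f(1)]] f by simp
  hence Nf: "N f > 0" using N3 N2(1)[of f] by (cases "N f = 0") auto
  define a where "a = (\<lambda>x n. N (x * f ^ n) / N f ^ n)"
  have anon: "a x n \<ge> 0" for x n using N2 Nf by (simp add: a_def)
  have dec: "decseq (a x)" if x: "algebraic x" for x
  proof (rule decseq_SucI)
    fix n
    have "N (x * f ^ Suc n) \<le> N (x * f ^ n) * N f"
      using N4(1)[of "x * f ^ n" f] x f by (simp add: alg mult_ac)
    thus "a x (Suc n) \<le> a x n" using Nf by (simp add: a_def field_simps)
  qed
  define N' where "N' = (\<lambda>x. if algebraic x then lim (a x) else 0)"
  have lim: "a x \<longlonglongrightarrow> N' x" if x: "algebraic x" for x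
    using decseq_convergent[OF dec[OF x], of 0] anon x
    by (metis N'_def limI)
  have le_a: "N' x \<le> a x n" if x: "algebraic x" for x n
    using decseq_ge[OF dec[OF x] lim[OF x]] .
  have N'0: "N' x \<ge> 0" for x
  proof (cases "algebraic x")
    case True
    show ?thesis by (rule LIMSEQ_le_const[OF lim[OF True]]) (use anon in auto)
  qed (simp add: N'_def)
  have N'N: "N' x \<le> N x" for x
  proof (cases "algebraic x")
    case True
    show ?thesis using le_a[OF True, of 0] by (simp add: a_def)
  qed (simp add: N'_def N1)
  \<comment> \<open>A product needs a power of \<open>f\<close> for each factor: x y f^(2n) splits
    as (x f^n) (y f^n), and x^k f^(kn) is the k-th power of x f^n. Hence limits are compared along
    multiples of n.\<close>
  have sub: "(\<lambda>n. a x (k * n)) \<longlonglongrightarrow> N' x" if "algebraic x" "k > 0" for x k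
    using LIMSEQ_subseq_LIMSEQ[OF lim[OF that(1)], of "\<lambda>n. k * n"] that(2)
    by (auto simp: strict_mono_def o_def)
  have mult: "N' (x * y) \<le> N' x * N' y" if xy: "algebraic x" "algebraic y" for x y
  proof (rule LIMSEQ_le[OF sub[of _ 2] tendsto_mult[OF lim[OF xy(1)] lim[OF xy(2)]]])
    show "\<exists>N. \<forall>n\<ge>N. a (x * y) (2 * n) \<le> a x n * a y n"
    proof (intro exI allI impI)
      fix n
      have "N (x * y * f ^ (2 * n)) = N ((x * f ^ n) * (y * f ^ n))"
        unfolding mult_2 power_add by (simp only: mult_ac)
      also have "\<dots> \<le> N (x * f ^ n) * N (y * f ^ n)"
        using xy f by (intro N4 alg)
      finally show "a (x * y) (2 * n) \<le> a x n * a y n"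
        using Nf by (simp add: a_def mult_2 power_add divide_right_mono)
    qed
  qed (use xy in \<open>auto intro: alg\<close>)
  have add: "N' (x + y) \<le> max (N' x) (N' y)" if xy: "algebraic x" "algebraic y" for x y
  proof (rule LIMSEQ_le[OF lim tendsto_max[OF lim[OF xy(1)] lim[OF xy(2)]]])
    show "\<exists>N. \<forall>n\<ge>N. a (x + y) n \<le> max (a x n) (a y n)"
    proof (intro exI allI impI)
      fix n
      have "N ((x + y) * f ^ n) \<le> max (N (x * f ^ n)) (N (y * f ^ n))"
        using xy f by (subst distrib_right) (intro N4 alg)
      thus "a (x + y) n \<le> max (a x n) (a y n)"
        using Nf by (auto simp: a_def le_max_iff_disj divide_right_mono)
    qed
  qed (use xy in \<open>auto intro: alg\<close>)
  have pow: "N' (x ^ k) = N' x ^ k" if x: "algebraic x" and k: "k > 0" for x k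
  proof (rule LIMSEQ_unique[OF sub[of _ k]])
    have "a (x ^ k) (k * n) = a x n ^ k" for n
    proof -
      have "x ^ k * f ^ (k * n) = (x * f ^ n) ^ k"
        by (simp add: power_mult_distrib power_mult[symmetric] mult.commute)
      hence "N (x ^ k * f ^ (k * n)) = N (x * f ^ n) ^ k"
        using x f by (simp add: N5 alg)
      thus ?thesis by (simp add: a_def power_divide power_mult[symmetric] mult.commute)
    qed
    thus "(\<lambda>n. a (x ^ k) (k * n)) \<longlonglongrightarrow> N' x ^ k"
      using tendsto_power[OF lim[OF x], of k] by simp
  qed (use x k in \<open>auto intro: alg\<close>)
  have "a 1 = (\<lambda>_. 1)"
    using Nf by (simp add: fun_eq_iff a_def N5 f)
  hence one: "N' 1 = 1"
    using lim[of 1] by (simp add: LIMSEQ_const_iff)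
  have "N' \<in> padic_seminorms"
    unfolding padic_seminorms_def
  proof (intro CollectI conjI allI impI)
    fix x :: complex and n :: nat assume x: "algebraic x"
    show "N' (x ^ n) = N' x ^ n"
      using pow[OF x, of n] one by (cases "n = 0") auto
  qed (use N'0 order_trans[OF N'N N2(2)] one mult add in \<open>auto simp: N'_def[THEN fun_cong]\<close>)
  moreover have "N' x * N f \<le> N (x * f)" if x: "algebraic x" for x
    using le_a[OF x, of 1] Nf by (simp add: a_def field_simps)
  ultimately show ?thesis using that[of N'] N'N Nf by (auto simp: le_fun_def)
qed

text \<open>By minimality, the modification of \<open>N\<close> for \<open>f\<close> is
  \<open>N\<close> itself, so \<open>N x * N f \<le> N (x * f)\<close> and \<open>N\<close> is
  multiplicative. Its values on \<rat> are then forced, because the spectral norm bounds both a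
  number and its inverse.\<close>

lemma padic_extension:
  obtains w where "absolute_value_on {x. algebraic x} w" "\<And>q. w (of_rat q) = padic_abs p q"
    "\<And>x y. algebraic x \<Longrightarrow> algebraic y \<Longrightarrow> w (x + y) \<le> max (w x) (w y)"
    "\<And>x. algebraic_int x \<Longrightarrow> w x \<le> 1"
proof -
  obtain N where N: "N \<in> padic_seminorms" "\<And>N'. N' \<in> padic_seminorms \<Longrightarrow> N' \<le> N \<Longrightarrow> N' = N"
    using padic_seminorms_minimal by blast
  note D = padic_seminormsD[OF N(1)]
  have int_le: "N x \<le> 1" if "algebraic_int x" for x
  proof -
    have "scaled_valid p x 0"
      using prime_gt_1_nat[OF p] that by (auto simp: scaled_valid_def zdvd1_eq intro!: exI[of _ 1])
    thus ?thesis using spectral_norm_le[of x 0] D(3)[of x] p_gt_1 that by force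
  qed
  have N0: "N 0 = 0"
  proof -
    \<comment> \<open>\<open>N 0\<close> is its own square; the value 1 is excluded because 0 / p is
      integral, so that \<open>N 0\<close> is at most 1 / p.\<close>
    have "N 0 = N (0 ^ 2)" by simp
    also have "\<dots> = N 0 ^ 2" by (rule D(7)) simp
    finally have "N 0 = 0 \<or> N 0 = 1" by (simp add: power2_eq_square)
    moreover have "scaled_valid p 0 1"
      using prime_gt_1_nat[OF p] by (auto simp: scaled_valid_def zdvd1_eq intro!: exI[of _ 1])
    hence "N 0 \<le> 1 / p" using spectral_norm_le[of 0 1] D(3)[of 0] order_trans by (fastforce simp: powr_minus_divide)
    moreover have "1 / real p < 1" using p_gt_1 by simp
    ultimately show ?thesis by auto
  qed
  have pos: "N x > 0" if "algebraic x" "x \<noteq> 0" for x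
    using padic_seminorms_smaller[OF N(1) that] by blast
  have mult: "N (x * f) = N x * N f" if xf: "algebraic x" "algebraic f" for x f
  proof (cases "f = 0")
    case False
    obtain N' where N': "N' \<in> padic_seminorms" "N' \<le> N" "\<And>x. algebraic x \<Longrightarrow> N' x * N f \<le> N (x * f)"
      using padic_seminorms_smaller[OF N(1) xf(2) False] by blast
    hence "N' = N" by (intro N(2))
    with N'(3)[OF xf(1)] D(5)[OF xf] show ?thesis by simp
  qed (simp add: N0)
  have N_unit: "N (of_int m) = 1" if "\<not> int p dvd m" for m
  proof (rule antisym)
    show "N (of_int m) \<le> 1" by (rule int_le) simp
    have m: "m \<noteq> 0" using that by auto
    have alg: "algebraic (1 / of_int m :: complex)" using algebraic_of_rat[of "1 / of_int m"] by (simp add: of_rat_divide)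
    have "scaled_valid p (1 / of_int m) 0"
      using that m p_gt_1 by (auto simp: scaled_valid_def intro!: exI[of _ m])
    hence "N (1 / of_int m) \<le> 1"
      using spectral_norm_le[of "1 / of_int m" 0, OF _ alg] D(3)[of "1 / of_int m"] p_gt_1 by simp
    moreover have "N (1 / of_int m) * N (of_int m) = 1"
      using mult[OF alg, of "of_int m"] m D(4) algebraic_of_rat[of "of_int m"] by simp
    ultimately show "1 \<le> N (of_int m)" 
      using D(2)[of "of_int m"] mult_right_mono[of "N (1 / of_int m)" 1 "N (of_int m)"] by simp
  qed
  have N_p: "N (of_nat p) = 1 / p"
  proof (rule antisym)
    have nd: "\<not> int p dvd 1" using p_gt_1 by (simp add: zdvd1_eq)
    have alg: "algebraic (of_nat p :: complex)" "algebraic (1 / of_nat p :: complex)"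
      using algebraic_of_rat[of "of_nat p"] algebraic_of_rat[of "1 / of_nat p"] by (simp_all add: of_rat_divide)
    have "scaled_valid p (of_nat p) 1"
      using nd p_gt_1 by (auto simp: scaled_valid_def intro!: exI[of _ 1])
    thus "N (of_nat p) \<le> 1 / p"
      using spectral_norm_le[of "of_nat p" 1] D(3)[of "of_nat p"] alg order_trans by (fastforce simp: powr_minus_divide)
    have "scaled_valid p (1 / of_nat p) (- 1)"
      using nd p_gt_1 by (auto simp: scaled_valid_def powr_minus of_rat_minus intro!: exI[of _ 1])
    hence le: "N (1 / of_nat p) \<le> p"
      using spectral_norm_le[of "1 / of_nat p" "- 1"] D(3)[of "1 / of_nat p"] alg p_gt_1 by (simp add: of_rat_minus)
    have "1 = N (1 / of_nat p) * N (of_nat p)"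
      using mult[OF alg(2,1)] D(4) p_gt_1 by simp
    also have "\<dots> \<le> p * N (of_nat p)" using le D(2) by (intro mult_right_mono)
    finally show "1 / p \<le> N (of_nat p)" using p_gt_1 by (simp add: field_simps)
  qed
  have N_int: "N (of_int a) = real p powi (- int (multiplicity (int p) a))" if a0: "a \<noteq> 0" for a
  proof -
    have "\<not> is_unit (int p)" using p_gt_1 by (simp add: zdvd1_eq)
    then obtain m where m: "a = int p ^ multiplicity (int p) a * m" "\<not> int p dvd m"
      using multiplicity_decompose'[OF a0] by blast
    define e where "e = multiplicity (int p) a"
    have "N (of_int a) = N (of_nat p ^ e * of_int m)"
      using arg_cong[OF m(1), of "of_int :: int \<Rightarrow> complex"] by (simp add: e_def)
    also have "\<dots> = N (of_nat p ^ e) * N (of_int m)"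
      using algebraic_of_rat[of "of_nat p"] algebraic_of_rat[of "of_int m"]
      by (intro mult algebraic_power) simp_all
    also have "\<dots> = (1 / p) ^ e"
      using algebraic_of_rat[of "of_nat p"] N_unit[OF m(2)] by (simp add: D(7) N_p)
    also have "\<dots> = real p powi (- int e)" by (simp add: power_int_minus power_divide field_simps)
    finally show ?thesis by (simp add: e_def)
  qed
  have N_rat: "N (of_rat q) = padic_abs p q" for q
  proof (cases "q = 0")
    case False
    obtain a b where ab: "quotient_of q = (a, b)" by fastforce
    hence b: "b > 0" and q: "q = of_int a / of_int b" using quotient_of_denom_pos quotient_of_div by auto
    have a: "a \<noteq> 0" using q False by auto
    have "N (of_rat q) * N (of_int b) = N (of_rat q * of_int b)"
      using algebraic_of_rat[of q] algebraic_of_rat[of "of_int b"] by (intro mult[symmetric]) simp_all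
    also have "of_rat q * of_int b = (of_int a :: complex)"
      using b by (simp add: q of_rat_divide)
    finally have "N (of_rat q) * (real p powi - int (multiplicity (int p) b)) = real p powi - int (multiplicity (int p) a)"
      using a b by (simp add: N_int)
    hence "N (of_rat q) = real p powi - int (multiplicity (int p) a) * real p powi int (multiplicity (int p) b)"
      using p_gt_1 by (simp add: power_int_minus field_simps)
    also have "\<dots> = padic_abs p q"
      using False p_gt_1 by (simp add: padic_abs_def ab power_int_diff power_int_minus field_simps)
    finally show ?thesis .
  qed (simp add: padic_abs_def N0)
  show ?thesis
  proof (rule that[of N])
    have "max (N x) (N y) \<le> N x + N y" for x y using D(2)[of x] D(2)[of y] by simp
    thus "absolute_value_on {x. algebraic x} N"
      using D(2) pos N0 mult order_trans[OF D(6)] unfolding absolute_value_on_def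
      by (auto simp: less_le)
  qed (use N_rat D(6) int_le in auto)
qed

end

section \<open>Completions and local degrees\<close>


text \<open>Instantiated both with the fields \<rat>(\<alpha>) and with the field of all algebraic
  numbers.\<close>

locale valued_field =
  fixes K :: "complex set" and v :: "complex \<Rightarrow> real"
  assumes Rats_subset: "\<rat> \<subseteq> K"
    and add_closed: "x \<in> K \<Longrightarrow> y \<in> K \<Longrightarrow> x + y \<in> K"
    and mult_closed: "x \<in> K \<Longrightarrow> y \<in> K \<Longrightarrow> x * y \<in> K"
    and inverse_closed: "x \<in> K \<Longrightarrow> inverse x \<in> K"
    and absolute_value: "absolute_value_on K v"
begin

lemma of_rat_closed: "of_rat q \<in> K"
  using Rats_subset by (auto simp: Rats_def)

lemma zero_one_closed: "0 \<in> K" "1 \<in> K"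
  using of_rat_closed[of 0] of_rat_closed[of 1] by auto

lemma uminus_closed: "x \<in> K \<Longrightarrow> - x \<in> K"
  using mult_closed[OF of_rat_closed[of "-1"]] by (simp add: of_rat_minus)

lemma diff_closed: "x \<in> K \<Longrightarrow> y \<in> K \<Longrightarrow> x - y \<in> K"
  using add_closed[OF _ uminus_closed] by simp

lemma sum_closed: "(\<And>i. i \<in> A \<Longrightarrow> f i \<in> K) \<Longrightarrow> (\<Sum>i\<in>A. f i) \<in> K"
  by (induction A rule: infinite_finite_induct) (auto intro: add_closed zero_one_closed)

lemma power_closed: "x \<in> K \<Longrightarrow> x ^ n \<in> K"
  by (induction n) (auto intro: mult_closed zero_one_closed)

lemmas closed = of_rat_closed zero_one_closed uminus_closed diff_closed sum_closed power_closed
  add_closed mult_closed inverse_closed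

lemma v_nonneg: "x \<in> K \<Longrightarrow> 0 \<le> v x"
  and v_eq_0: "x \<in> K \<Longrightarrow> v x = 0 \<longleftrightarrow> x = 0"
  and v_mult: "x \<in> K \<Longrightarrow> y \<in> K \<Longrightarrow> v (x * y) = v x * v y"
  and v_add: "x \<in> K \<Longrightarrow> y \<in> K \<Longrightarrow> v (x + y) \<le> v x + v y"
  using absolute_value unfolding absolute_value_on_def by blast+

lemma v_0: "v 0 = 0"
  using v_eq_0[of 0] closed by simp

lemma v_1: "v 1 = 1"
proof -
  have "v 1 * v 1 = v 1" using v_mult[of 1 1] closed by simp
  thus ?thesis using v_eq_0[of 1] closed by simp
qed

lemma v_minus: "x \<in> K \<Longrightarrow> v (- x) = v x"
proof -
  assume x: "x \<in> K"
  have "v (- 1) ^ 2 = 1"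
    using v_mult[of "-1" "-1"] v_1 closed(4)[of 1] closed by (simp add: power2_eq_square)
  hence "v (- 1) = 1"
    using v_nonneg[of "- 1"] closed(4)[of 1] closed by (simp add: power2_eq_1_iff)
  thus ?thesis using v_mult[of "- 1" x] closed(4)[of 1] closed x by simp
qed

lemma v_diff: "x \<in> K \<Longrightarrow> y \<in> K \<Longrightarrow> v (x - y) \<le> v x + v y"
  using v_add[of x "- y"] v_minus[of y] closed by simp

lemma v_diff_ge: "x \<in> K \<Longrightarrow> y \<in> K \<Longrightarrow> \<bar>v x - v y\<bar> \<le> v (x - y)"
  using v_add[of "x - y" y] v_add[of "y - x" x] v_minus[of "x - y"] closed by auto

lemma v_power: "x \<in> K \<Longrightarrow> v (x ^ n) = v x ^ n"
  by (induction n) (auto simp: v_1 v_mult closed)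

lemma v_inverse: "x \<in> K \<Longrightarrow> v (inverse x) = inverse (v x)"
proof (cases "x = 0")
  case False
  assume x: "x \<in> K"
  have "v x * v (inverse x) = 1" using v_mult[of x "inverse x"] x False closed v_1 by simp
  thus ?thesis by (metis inverse_unique)
qed (simp add: v_0)

lemma v_sum: "(\<And>i. i \<in> A \<Longrightarrow> f i \<in> K) \<Longrightarrow> v (\<Sum>i\<in>A. f i) \<le> (\<Sum>i\<in>A. v (f i))"
proof (induction A rule: infinite_finite_induct)
  case (insert i A)
  have "v (\<Sum>i\<in>insert i A. f i) \<le> v (f i) + v (\<Sum>i\<in>A. f i)"
    using insert by (simp add: v_add closed)
  also have "\<dots> \<le> v (f i) + (\<Sum>i\<in>A. v (f i))" using insert by simp
  finally show ?case using insert by simp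
qed (auto simp: v_0)

lemma cauchy_seqsD:
  "s \<in> cauchy_seqs K v \<Longrightarrow> s n \<in> K"
  "s \<in> cauchy_seqs K v \<Longrightarrow> e > 0 \<Longrightarrow> \<exists>M. \<forall>m\<ge>M. \<forall>n\<ge>M. v (s m - s n) < e"
  by (auto simp: cauchy_seqs_def)

lemma cauchy_seqsI:
  "(\<And>n. s n \<in> K) \<Longrightarrow> (\<And>e. e > 0 \<Longrightarrow> \<exists>M. \<forall>m\<ge>M. \<forall>n\<ge>M. v (s m - s n) < e) \<Longrightarrow> s \<in> cauchy_seqs K v"
  by (auto simp: cauchy_seqs_def)

lemma null_seqsD:
  "s \<in> null_seqs K v \<Longrightarrow> s n \<in> K"
  "s \<in> null_seqs K v \<Longrightarrow> (\<lambda>n. v (s n)) \<longlonglongrightarrow> 0"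
  by (auto simp: null_seqs_def)

lemma null_seqsI:
  "(\<And>n. s n \<in> K) \<Longrightarrow> (\<lambda>n. v (s n)) \<longlonglongrightarrow> 0 \<Longrightarrow> s \<in> null_seqs K v"
  by (auto simp: null_seqs_def)

lemma cauchy_bounded:
  assumes "s \<in> cauchy_seqs K v"
  obtains B where "B > 0" "\<And>n. v (s n) \<le> B"
proof -
  obtain M where M: "\<forall>m\<ge>M. \<forall>n\<ge>M. v (s m - s n) < 1"
    using cauchy_seqsD(2)[OF assms, of 1] by auto
  note sK = cauchy_seqsD(1)[OF assms]
  define B where "B = 1 + (\<Sum>i\<le>M. v (s i))"
  have nn: "0 \<le> (\<Sum>i\<in>A. v (s i))" for A by (intro sum_nonneg v_nonneg sK)
  have "v (s n) \<le> B" for n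
  proof (cases "n \<le> M")
    case True
    have "v (s n) \<le> (\<Sum>i\<le>M. v (s i))"
      using True by (intro member_le_sum) (auto intro: v_nonneg sK)
    thus ?thesis by (simp add: B_def)
  next
    case False
    have "v (s n) \<le> v (s n - s M) + v (s M)"
      using v_add[of "s n - s M" "s M"] closed sK by simp
    also have "v (s n - s M) < 1" using M False by auto
    also have "v (s M) \<le> (\<Sum>i\<le>M. v (s i))"
      by (intro member_le_sum) (auto intro: v_nonneg sK)
    finally show ?thesis by (simp add: B_def)
  qed
  moreover have "B > 0" using nn by (simp add: B_def add_pos_nonneg)
  ultimately show ?thesis using that by blast
qed

lemma cauchy_add:
  assumes s: "s \<in> cauchy_seqs K v" and t: "t \<in> cauchy_seqs K v"
  shows "(\<lambda>n. s n + t n) \<in> cauchy_seqs K v"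
proof (rule cauchy_seqsI)
  note sK = cauchy_seqsD(1)[OF s] and tK = cauchy_seqsD(1)[OF t]
  show "s n + t n \<in> K" for n using sK tK closed by simp
  fix e :: real assume e: "e > 0"
  obtain M where M: "\<forall>m\<ge>M. \<forall>n\<ge>M. v (s m - s n) < e / 2"
    using cauchy_seqsD(2)[OF s, of "e / 2"] e by auto
  obtain N where N: "\<forall>m\<ge>N. \<forall>n\<ge>N. v (t m - t n) < e / 2"
    using cauchy_seqsD(2)[OF t, of "e / 2"] e by auto
  show "\<exists>M. \<forall>m\<ge>M. \<forall>n\<ge>M. v (s m + t m - (s n + t n)) < e"
  proof (intro exI[of _ "max M N"] allI impI)
    fix m n assume mn: "m \<ge> max M N" "n \<ge> max M N"
    have "v (s m + t m - (s n + t n)) \<le> v (s m - s n) + v (t m - t n)"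
      using v_add[of "s m - s n" "t m - t n"] sK tK closed by (simp add: algebra_simps)
    also have "\<dots> < e / 2 + e / 2" using M N mn by (intro add_strict_mono) auto
    finally show "v (s m + t m - (s n + t n)) < e" by simp
  qed
qed

lemma cauchy_mult:
  assumes s: "s \<in> cauchy_seqs K v" and t: "t \<in> cauchy_seqs K v"
  shows "(\<lambda>n. s n * t n) \<in> cauchy_seqs K v"
proof (rule cauchy_seqsI)
  note sK = cauchy_seqsD(1)[OF s] and tK = cauchy_seqsD(1)[OF t]
  show "s n * t n \<in> K" for n using sK tK closed by simp
  obtain B where B: "B > 0" "\<And>n. v (s n) \<le> B" using cauchy_bounded[OF s] by blast
  obtain C where C: "C > 0" "\<And>n. v (t n) \<le> C" using cauchy_bounded[OF t] by blast
  fix e :: real assume e: "e > 0"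
  obtain M where M: "\<forall>m\<ge>M. \<forall>n\<ge>M. v (s m - s n) < e / (2 * C)"
    using cauchy_seqsD(2)[OF s, of "e / (2 * C)"] e C by auto
  obtain N where N: "\<forall>m\<ge>N. \<forall>n\<ge>N. v (t m - t n) < e / (2 * B)"
    using cauchy_seqsD(2)[OF t, of "e / (2 * B)"] e B by auto
  show "\<exists>M. \<forall>m\<ge>M. \<forall>n\<ge>M. v (s m * t m - s n * t n) < e"
  proof (intro exI[of _ "max M N"] allI impI)
    fix m n assume mn: "m \<ge> max M N" "n \<ge> max M N"
    have "v (s m * t m - s n * t n) \<le> v ((s m - s n) * t m) + v (s n * (t m - t n))"
      using v_add[of "(s m - s n) * t m" "s n * (t m - t n)"] sK tK closed by (simp add: algebra_simps)
    also have "\<dots> = v (s m - s n) * v (t m) + v (s n) * v (t m - t n)"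
      using sK tK closed by (simp add: v_mult)
    also have "\<dots> \<le> v (s m - s n) * C + B * v (t m - t n)"
      using sK tK closed B C by (intro add_mono mult_mono) (auto intro: v_nonneg less_imp_le)
    also have "\<dots> < e / (2 * C) * C + B * (e / (2 * B))"
      using M N mn B C by (intro add_strict_mono mult_strict_left_mono mult_strict_right_mono) auto
    also have "\<dots> = e" using B C by (simp add: field_simps)
    finally show "v (s m * t m - s n * t n) < e" by simp
  qed
qed

lemma cauchy_const: "x \<in> K \<Longrightarrow> (\<lambda>_. x) \<in> cauchy_seqs K v"
  by (rule cauchy_seqsI) (auto simp: v_0)

lemma cauchy_uminus: "s \<in> cauchy_seqs K v \<Longrightarrow> (\<lambda>n. - s n) \<in> cauchy_seqs K v"
  using cauchy_mult[OF cauchy_const[of "-1"], of s] closed(4)[of 1] closed by simp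

lemma cauchy_diff:
  assumes "s \<in> cauchy_seqs K v" "t \<in> cauchy_seqs K v"
  shows "(\<lambda>n. s n - t n) \<in> cauchy_seqs K v"
  using cauchy_add[OF assms(1) cauchy_uminus[OF assms(2)]] by simp

lemma null_imp_cauchy:
  assumes s: "s \<in> null_seqs K v"
  shows "s \<in> cauchy_seqs K v"
proof (rule cauchy_seqsI)
  note sK = null_seqsD(1)[OF s]
  show "s n \<in> K" for n by (rule sK)
  fix e :: real assume e: "e > 0"
  have "\<forall>\<^sub>F n in sequentially. v (s n) < e / 2"
    using order_tendstoD(2)[OF null_seqsD(2)[OF s], of "e / 2"] e by simp
  then obtain M where M: "\<And>n. n \<ge> M \<Longrightarrow> v (s n) < e / 2"
    by (auto simp: eventually_sequentially)
  show "\<exists>M. \<forall>m\<ge>M. \<forall>n\<ge>M. v (s m - s n) < e"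
  proof (intro exI[of _ M] allI impI)
    fix m n assume "m \<ge> M" "n \<ge> M"
    thus "v (s m - s n) < e" using v_diff[OF sK sK, of m n] M[of m] M[of n] by simp
  qed
qed

lemma null_add:
  assumes s: "s \<in> null_seqs K v" and t: "t \<in> null_seqs K v"
  shows "(\<lambda>n. s n + t n) \<in> null_seqs K v"
proof (rule null_seqsI)
  note sK = null_seqsD(1)[OF s] and tK = null_seqsD(1)[OF t]
  show "s n + t n \<in> K" for n using sK tK closed by simp
  have "(\<lambda>n. v (s n) + v (t n)) \<longlonglongrightarrow> 0"
    using tendsto_add[OF null_seqsD(2)[OF s] null_seqsD(2)[OF t]] by simp
  thus "(\<lambda>n. v (s n + t n)) \<longlonglongrightarrow> 0"
    by (rule tendsto_sandwich[OF _ _ tendsto_const, rotated 2])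
       (auto intro!: always_eventually v_nonneg v_add closed sK tK)
qed

lemma null_mult:
  assumes s: "s \<in> cauchy_seqs K v" and t: "t \<in> null_seqs K v"
  shows "(\<lambda>n. s n * t n) \<in> null_seqs K v"
proof (rule null_seqsI)
  note sK = cauchy_seqsD(1)[OF s] and tK = null_seqsD(1)[OF t]
  obtain B where B: "B > 0" "\<And>n. v (s n) \<le> B" using cauchy_bounded[OF s] by blast
  show "s n * t n \<in> K" for n using sK tK closed by simp
  have "(\<lambda>n. B * v (t n)) \<longlonglongrightarrow> 0"
    using tendsto_mult[OF tendsto_const null_seqsD(2)[OF t], of B] by simp
  thus "(\<lambda>n. v (s n * t n)) \<longlonglongrightarrow> 0"
    by (rule tendsto_sandwich[OF _ _ tendsto_const, rotated 2])
       (auto intro!: always_eventually mult_nonneg_nonneg v_nonneg closed sK tK mult_right_mono B simp: v_mult sK tK)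
qed

abbreviation "R \<equiv> cauchy_ring K v"
abbreviation "Q \<equiv> completion_at K v"
abbreviation "cls s \<equiv> null_seqs K v +>\<^bsub>R\<^esub> s"

lemma R_simps:
  "carrier R = cauchy_seqs K v" "\<one>\<^bsub>R\<^esub> = (\<lambda>_. 1)" "\<zero>\<^bsub>R\<^esub> = (\<lambda>_. 0)"
  "x \<otimes>\<^bsub>R\<^esub> y = (\<lambda>n. x n * y n)" "x \<oplus>\<^bsub>R\<^esub> y = (\<lambda>n. x n + y n)"
  by (simp_all add: cauchy_ring_def)

lemma R_cring: "cring R"
proof (rule cringI)
  show "abelian_group R"
  proof (rule abelian_groupI)
    fix x assume "x \<in> carrier R"
    thus "\<exists>y\<in>carrier R. y \<oplus>\<^bsub>R\<^esub> x = \<zero>\<^bsub>R\<^esub>"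
      by (auto simp: R_simps intro!: bexI[of _ "\<lambda>n. - x n"] cauchy_uminus)
  qed (auto simp: R_simps algebra_simps intro!: cauchy_add cauchy_const closed)
  show "comm_monoid R"
    by (rule comm_monoidI) (auto simp: R_simps algebra_simps intro!: cauchy_mult cauchy_const closed)
qed (auto simp: R_simps algebra_simps)

lemma R_minus: "s \<in> cauchy_seqs K v \<Longrightarrow> \<ominus>\<^bsub>R\<^esub> s = (\<lambda>n. - s n)"
proof -
  interpret cring R by (rule R_cring)
  assume s: "s \<in> cauchy_seqs K v"
  show ?thesis
    by (rule minus_equality) (use s in \<open>auto simp: R_simps intro: cauchy_uminus\<close>)
qed

lemma null_ideal: "ideal (null_seqs K v) R"
proof (rule idealI)
  interpret cring R by (rule R_cring)
  show "ring R" by unfold_locales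
  have z: "(\<lambda>_. 0) \<in> null_seqs K v" by (rule null_seqsI) (auto simp: v_0 closed)
  show "subgroup (null_seqs K v) (add_monoid R)"
  proof (rule add.subgroupI)
    show "null_seqs K v \<subseteq> carrier R" by (auto simp: R_simps null_imp_cauchy)
    show "null_seqs K v \<noteq> {}" using z by auto
  next
    fix a assume a: "a \<in> null_seqs K v"
    have "(\<lambda>n. - 1 * a n) \<in> null_seqs K v"
      by (intro null_mult cauchy_const a closed)
    thus "\<ominus>\<^bsub>R\<^esub> a \<in> null_seqs K v" using a by (simp add: R_minus null_imp_cauchy)
  next
    fix a b assume "a \<in> null_seqs K v" "b \<in> null_seqs K v"
    thus "a \<oplus>\<^bsub>R\<^esub> b \<in> null_seqs K v" by (simp add: R_simps null_add)
  qed
  fix a x assume "a \<in> null_seqs K v" "x \<in> carrier R"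
  thus "x \<otimes>\<^bsub>R\<^esub> a \<in> null_seqs K v" "a \<otimes>\<^bsub>R\<^esub> x \<in> null_seqs K v"
    using null_mult[of x a] by (simp_all add: R_simps mult.commute)
qed

lemma Q_cring: "cring Q"
  unfolding completion_at_def by (rule ideal.quotient_is_cring[OF null_ideal R_cring])

lemma cls_hom: "ring_hom_ring R Q (\<lambda>s. cls s)"
  unfolding completion_at_def by (rule ideal.rcos_ring_hom_ring[OF null_ideal])

lemma carrier_Q: "carrier Q = (\<lambda>s. cls s) ` cauchy_seqs K v"
  by (auto simp: completion_at_def FactRing_def A_RCOSETS_def' R_simps)

lemma cls_eq_iff:
  assumes "s \<in> cauchy_seqs K v" "t \<in> cauchy_seqs K v"
  shows "cls s = cls t \<longleftrightarrow> (\<lambda>n. v (s n - t n)) \<longlonglongrightarrow> 0"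
proof -
  interpret cring R by (rule R_cring)
  have "cls s = cls t \<longleftrightarrow> s \<ominus>\<^bsub>R\<^esub> t \<in> null_seqs K v"
    using quotient_eq_iff_same_a_r_cos[OF null_ideal] assms by (simp add: R_simps)
  also have "s \<ominus>\<^bsub>R\<^esub> t = (\<lambda>n. s n - t n)"
    using assms by (simp add: a_minus_def R_minus R_simps)
  finally show ?thesis using cauchy_seqsD(1)[OF cauchy_diff[OF assms]]
    by (auto intro: null_seqsI dest: null_seqsD(2))
qed

lemma cls_add:
  "s \<in> cauchy_seqs K v \<Longrightarrow> t \<in> cauchy_seqs K v \<Longrightarrow> cls s \<oplus>\<^bsub>Q\<^esub> cls t = cls (\<lambda>n. s n + t n)"
  and cls_mult:
  "s \<in> cauchy_seqs K v \<Longrightarrow> t \<in> cauchy_seqs K v \<Longrightarrow> cls s \<otimes>\<^bsub>Q\<^esub> cls t = cls (\<lambda>n. s n * t n)"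
  and cls_zero: "\<zero>\<^bsub>Q\<^esub> = cls (\<lambda>_. 0)"
  and cls_one: "\<one>\<^bsub>Q\<^esub> = cls (\<lambda>_. 1)"
proof -
  interpret ring_hom_ring R Q "\<lambda>s. cls s" by (rule cls_hom)
  show "s \<in> cauchy_seqs K v \<Longrightarrow> t \<in> cauchy_seqs K v \<Longrightarrow> cls s \<oplus>\<^bsub>Q\<^esub> cls t = cls (\<lambda>n. s n + t n)"
    using hom_add[of s t] by (simp add: R_simps)
  show "s \<in> cauchy_seqs K v \<Longrightarrow> t \<in> cauchy_seqs K v \<Longrightarrow> cls s \<otimes>\<^bsub>Q\<^esub> cls t = cls (\<lambda>n. s n * t n)"
    using hom_mult[of s t] by (simp add: R_simps)
  show "\<zero>\<^bsub>Q\<^esub> = cls (\<lambda>_. 0)" using hom_zero by (simp add: R_simps)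
  show "\<one>\<^bsub>Q\<^esub> = cls (\<lambda>_. 1)" using hom_one by (simp add: R_simps)
qed

lemma rat_cauchy_eq: "cauchy_seqs \<rat> v = {s \<in> cauchy_seqs K v. range s \<subseteq> \<rat>}"
  using Rats_subset by (auto simp: cauchy_seqs_def)

text \<open>A Cauchy sequence that is not null is eventually bounded away from 0, which controls the
  differences of the inverses. Finitely many earlier terms may be 0, with inverse 0, so the product
  is 1 only in the limit.\<close>

lemma cauchy_inverse:
  assumes s: "s \<in> cauchy_seqs K v" and nonnull: "\<not> (\<lambda>n. v (s n)) \<longlonglongrightarrow> 0"
  shows "(\<lambda>n. inverse (s n)) \<in> cauchy_seqs K v"
    and "(\<lambda>n. v (inverse (s n) * s n - 1)) \<longlonglongrightarrow> 0"
proof -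
  note sK = cauchy_seqsD(1)[OF s]
  obtain d where d: "d > 0" "\<And>M. \<exists>n\<ge>M. v (s n) \<ge> d"
  proof -
    have "\<exists>d>0. \<forall>M. \<exists>n\<ge>M. v (s n) \<ge> d"
    proof (rule ccontr)
      assume *: "\<not> ?thesis"
      have "(\<lambda>n. v (s n)) \<longlonglongrightarrow> 0"
      proof (rule LIMSEQ_I)
        fix r :: real assume "r > 0"
        hence "\<exists>M. \<forall>n\<ge>M. v (s n) < r" using * by (meson not_le)
        then obtain M where "\<forall>n\<ge>M. v (s n) < r" by blast
        thus "\<exists>M. \<forall>n\<ge>M. norm (v (s n) - 0) < r" using v_nonneg[OF sK] by auto
      qed
      thus False using nonnull by simp
    qed
    thus ?thesis using that by blast
  qed
  obtain M where M: "\<forall>m\<ge>M. \<forall>n\<ge>M. v (s m - s n) < d / 2"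
    using cauchy_seqsD(2)[OF s, of "d / 2"] d by auto
  have big: "v (s n) \<ge> d / 2" if "n \<ge> M" for n
  proof -
    obtain m where m: "m \<ge> M" "v (s m) \<ge> d" using d(2) by blast
    have "\<bar>v (s m) - v (s n)\<bar> \<le> v (s m - s n)" by (rule v_diff_ge[OF sK sK])
    also have "\<dots> < d / 2" using M m that by auto
    finally show ?thesis using m by linarith
  qed
  have nz: "s n \<noteq> 0" if "n \<ge> M" for n using big[OF that] d v_0 by auto
  show "(\<lambda>n. inverse (s n)) \<in> cauchy_seqs K v"
  proof (rule cauchy_seqsI)
    show "inverse (s n) \<in> K" for n by (intro closed sK)
    fix e :: real assume e: "e > 0"
    obtain N where N: "\<forall>m\<ge>N. \<forall>n\<ge>N. v (s m - s n) < e * (d / 2) ^ 2"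
      using cauchy_seqsD(2)[OF s, of "e * (d / 2) ^ 2"] d e by auto
    show "\<exists>M. \<forall>m\<ge>M. \<forall>n\<ge>M. v (inverse (s m) - inverse (s n)) < e"
    proof (intro exI[of _ "max M N"] allI impI)
      fix m n assume "m \<ge> max M N" "n \<ge> max M N"
      hence mn: "m \<ge> M" "m \<ge> N" "n \<ge> M" "n \<ge> N" by auto
      have "s n - s m = (inverse (s m) - inverse (s n)) * (s m * s n)"
        using nz mn by (simp add: field_simps)
      hence "v (s n - s m) = v (inverse (s m) - inverse (s n)) * (v (s m) * v (s n))"
        using closed sK by (simp add: v_mult)
      moreover have "v (inverse (s m) - inverse (s n)) * (d / 2) ^ 2 \<le> 
             v (inverse (s m) - inverse (s n)) * (v (s m) * v (s n))"
        unfolding power2_eq_square using big mn d closed sK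
        by (intro mult_left_mono mult_mono) (auto intro!: v_nonneg)
      ultimately have "v (inverse (s m) - inverse (s n)) * (d / 2) ^ 2 \<le> v (s n - s m)" by simp
      also have "\<dots> < e * (d / 2) ^ 2" using N mn by auto
      finally show "v (inverse (s m) - inverse (s n)) < e"
        using d by (simp only: mult_less_cancel_right_pos zero_less_power half_gt_zero)
    qed
  qed
  have "v (inverse (s n) * s n - 1) = 0" if "n \<ge> M" for n using nz[OF that] v_0 by simp
  thus "(\<lambda>n. v (inverse (s n) * s n - 1)) \<longlonglongrightarrow> 0"
    by (intro tendsto_eventually) (auto simp: eventually_sequentially)
qed

text \<open>Dimensions are taken over a subfield. Inverting a representing sequence termwise keeps
  it rational, so the inverse stays in the closure of \<rat>.\<close>

lemma rat_completion_subfield: "subfield (rat_completion K v) Q"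
proof -
  interpret R: cring R by (rule R_cring)
  interpret Q: cring Q by (rule Q_cring)
  interpret h: ring_hom_ring R Q "\<lambda>s. cls s" by (rule cls_hom)
  have "subring (cauchy_seqs \<rat> v) R"
  proof (rule R.subringI)
    show "\<ominus>\<^bsub>R\<^esub> h \<in> cauchy_seqs \<rat> v" if "h \<in> cauchy_seqs \<rat> v" for h
      using that by (auto simp: rat_cauchy_eq R_minus cauchy_uminus)
  qed (auto simp: rat_cauchy_eq R_simps cauchy_const closed cauchy_add cauchy_mult image_subset_iff)
  hence "subring ((\<lambda>s. cls s) ` cauchy_seqs \<rat> v) Q" by (rule h.img_is_subring)
  hence sr: "subring (rat_completion K v) Q" by (simp add: rat_completion_def)
  show ?thesis
  proof (rule Q.subfieldI)
    show "subcring (rat_completion K v) Q" by (rule Q.subcringI'[OF sr])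
    show "Units (Q\<lparr>carrier := rat_completion K v\<rparr>) = rat_completion K v - {\<zero>\<^bsub>Q\<^esub>}"
    proof (intro equalityI subsetI)
      fix x assume x: "x \<in> Units (Q\<lparr>carrier := rat_completion K v\<rparr>)"
      have "\<one>\<^bsub>Q\<^esub> \<noteq> \<zero>\<^bsub>Q\<^esub>"
        unfolding cls_one cls_zero
        by (subst cls_eq_iff) (auto simp: cauchy_const closed v_1 LIMSEQ_const_iff)
      thus "x \<in> rat_completion K v - {\<zero>\<^bsub>Q\<^esub>}"
        using x subringE(1)[OF sr] by (auto simp: Units_def)
    next
      fix x assume x: "x \<in> rat_completion K v - {\<zero>\<^bsub>Q\<^esub>}"
      then obtain s where s: "s \<in> cauchy_seqs K v" "range s \<subseteq> \<rat>" "x = cls s"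
        by (auto simp: rat_completion_def rat_cauchy_eq)
      have "\<not> (\<lambda>n. v (s n)) \<longlonglongrightarrow> 0"
        using x s cls_eq_iff[OF s(1) cauchy_const[of 0]] closed by (auto simp: cls_zero)
      note inv = cauchy_inverse[OF s(1) this]
      define y where "y = cls (\<lambda>n. inverse (s n))"
      have "y \<in> rat_completion K v"
        using s inv(1) by (auto simp: y_def rat_completion_def rat_cauchy_eq image_subset_iff)
      moreover have yx: "y \<otimes>\<^bsub>Q\<^esub> x = \<one>\<^bsub>Q\<^esub>"
        unfolding s y_def cls_mult[OF inv(1) s(1)] cls_one
        using inv s closed by (subst cls_eq_iff) (auto intro!: cauchy_mult cauchy_const)
      moreover have "x \<otimes>\<^bsub>Q\<^esub> y = \<one>\<^bsub>Q\<^esub>"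
        using yx s inv(1) by (subst Q.m_comm) (auto simp: carrier_Q y_def)
      ultimately show "x \<in> Units (Q\<lparr>carrier := rat_completion K v\<rparr>)"
        using x by (auto simp: Units_def)
    qed
  qed
qed

end

section \<open>Bases of the completion and the local degree\<close>

context valued_field
begin

text \<open>
  A basis of the completion over the closure of \<open>\<rat>\<close> that consists of elements of \<open>K\<close>. Both linear
  independence and spanning are expressed inside \<open>K\<close>, the former by a bound on the coefficients.
\<close>

definition local_basis :: "(nat \<Rightarrow> complex) \<Rightarrow> nat \<Rightarrow> bool" where
  "local_basis b m \<longleftrightarrow> (\<forall>i<m. b i \<in> K) \<and>
     (\<exists>C. \<forall>c :: nat \<Rightarrow> rat. \<forall>i<m. v (of_rat (c i)) \<le> C * v (\<Sum>j<m. of_rat (c j) * b j)) \<and>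
     (\<forall>x\<in>K. \<forall>e>0. \<exists>c :: nat \<Rightarrow> rat. v (x - (\<Sum>j<m. of_rat (c j) * b j)) < e)"

lemma combine_cls:
  assumes "length ss = length bs" "set ss \<subseteq> cauchy_seqs K v" "set bs \<subseteq> K"
  shows "ring.combine Q (map (\<lambda>s. cls s) ss) (map (\<lambda>b. cls (\<lambda>_. b)) bs) =
           cls (\<lambda>n. \<Sum>j<length bs. (ss ! j) n * bs ! j) \<and>
         (\<lambda>n. \<Sum>j<length bs. (ss ! j) n * bs ! j) \<in> cauchy_seqs K v"
  using assms
proof (induction ss bs rule: list_induct2)
  case Nil
  interpret Q: cring Q by (rule Q_cring)
  show ?case by (simp add: cls_zero cauchy_const closed)
next
  case (Cons s ss b bs)
  interpret Q: cring Q by (rule Q_cring)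
  have *: "(\<lambda>n. s n * b) \<in> cauchy_seqs K v"
    using Cons.prems by (intro cauchy_mult[OF _ cauchy_const]) auto
  have eq: "(\<Sum>j<length (b # bs). ((s # ss) ! j) n * (b # bs) ! j) =
         s n * b + (\<Sum>j<length bs. (ss ! j) n * bs ! j)" for n
    by (simp only: length_Cons sum.lessThan_Suc_shift nth_Cons_0 nth_Cons_Suc)
  show ?case
    unfolding eq using Cons * by (auto simp: cls_mult cls_add cauchy_const cauchy_add)
qed

text \<open>The classes of the constant sequences \<open>b i\<close> form a basis of the completion.
  The bound with the constant C passes to limits: a null combination has null coefficients, and the
  coefficients of rational combinations approximating a Cauchy sequence are themselves Cauchy, so
  they define scalars.\<close>

lemma local_degree_eq:
  assumes "local_basis b m"
  shows "local_degree K v = m"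
proof -
  interpret Q: cring Q by (rule Q_cring)
  let ?F = "rat_completion K v"
  have b: "\<And>i. i < m \<Longrightarrow> b i \<in> K" using assms by (simp add: local_basis_def)
  obtain C where C: "\<And>(c :: nat \<Rightarrow> rat) i. i < m \<Longrightarrow> v (of_rat (c i)) \<le> C * v (\<Sum>j<m. of_rat (c j) * b j)"
    using assms unfolding local_basis_def by blast
  have dense: "\<exists>c :: nat \<Rightarrow> rat. v (x - (\<Sum>j<m. of_rat (c j) * b j)) < e" if "x \<in> K" "e > 0" for x e
    using assms that unfolding local_basis_def by blast
  have F: "subfield ?F Q" by (rule rat_completion_subfield)
  define bs where "bs = map b [0..<m]"
  have bs: "length bs = m" "set bs \<subseteq> K" "\<And>j. j < m \<Longrightarrow> bs ! j = b j" using b by (auto simp: bs_def)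
  define Us where "Us = map (\<lambda>b. cls (\<lambda>_. b)) bs"
  have Us: "set Us \<subseteq> carrier Q" "length Us = m"
    using bs by (auto simp: Us_def carrier_Q intro!: imageI cauchy_const)
  have comb: "ring.combine Q (map (\<lambda>s. cls s) ss) Us = cls (\<lambda>n. \<Sum>j<m. (ss ! j) n * b j)"
      "(\<lambda>n. \<Sum>j<m. (ss ! j) n * b j) \<in> cauchy_seqs K v"
    if "length ss = m" "set ss \<subseteq> cauchy_seqs K v" for ss
    using combine_cls[of ss bs] that bs by (simp_all add: Us_def)
  have "Q.independent ?F Us"
  proof (cases "m = 0")
    case True
    thus ?thesis using Us by simp
  next
    case False
    show ?thesis
    proof (rule ccontr)
      assume "\<not> Q.independent ?F Us"
      then obtain Ks where Ks: "length Ks = length Us" "ring.combine Q Ks Us = \<zero>\<^bsub>Q\<^esub>" "set Ks \<subseteq> ?F" "set Ks \<noteq> {\<zero>\<^bsub>Q\<^esub>}"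
        using Q.dependent_imp_non_trivial_combine[OF F Us(1)] by blast
      have "\<forall>k\<in>set Ks. \<exists>s. s \<in> cauchy_seqs \<rat> v \<and> k = cls s"
        using Ks(3) by (auto simp: rat_completion_def)
      then obtain f where f: "\<And>k. k \<in> set Ks \<Longrightarrow> f k \<in> cauchy_seqs \<rat> v \<and> k = cls (f k)"
        by metis
      define ss where "ss = map f Ks"
      have ss: "length ss = m" "set ss \<subseteq> cauchy_seqs \<rat> v" using Ks Us f by (auto simp: ss_def)
      hence ss': "set ss \<subseteq> cauchy_seqs K v" by (auto simp: rat_cauchy_eq)
      have Ks_eq: "Ks = map (\<lambda>s. cls s) ss"
        using f by (auto simp: ss_def intro!: map_idI[symmetric])
      have "cls (\<lambda>n. \<Sum>j<m. (ss ! j) n * b j) = cls (\<lambda>_. 0)"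
        using comb(1)[OF ss(1) ss'] Ks(2) Ks_eq by (simp add: cls_zero)
      hence lim: "(\<lambda>n. v (\<Sum>j<m. (ss ! j) n * b j)) \<longlonglongrightarrow> 0"
        using comb(2)[OF ss(1) ss'] by (subst (asm) cls_eq_iff) (auto simp: cauchy_const closed)
      have "k = \<zero>\<^bsub>Q\<^esub>" if kk: "k \<in> set Ks" for k
      proof -
        obtain i where i: "i < m" "k = Ks ! i" using kk Ks(1) Us(2) unfolding in_set_conv_nth by auto
        have mem: "ss ! j \<in> cauchy_seqs K v" "range (ss ! j) \<subseteq> \<rat>" if "j < m" for j
        proof -
          have "ss ! j \<in> cauchy_seqs \<rat> v" using ss that nth_mem[of j ss] by blast
          thus "ss ! j \<in> cauchy_seqs K v" "range (ss ! j) \<subseteq> \<rat>"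
            unfolding rat_cauchy_eq by blast+
        qed
        define c where "c = (\<lambda>j n. SOME q. (ss ! j) n = of_rat q)"
        have c: "(ss ! j) n = of_rat (c j n)" if j: "j < m" for j n
        proof -
          have "(ss ! j) n \<in> \<rat>" using mem(2)[OF j] by blast
          then obtain q where "(ss ! j) n = of_rat q" by (elim Rats_cases)
          thus ?thesis unfolding c_def by (rule someI)
        qed
        have le: "v ((ss ! i) n) \<le> C * v (\<Sum>j<m. (ss ! j) n * b j)" for n
          using C[OF i(1), of "\<lambda>j. c j n"] i c by simp
        have "(\<lambda>n. C * v (\<Sum>j<m. (ss ! j) n * b j)) \<longlonglongrightarrow> 0"
          using tendsto_mult[OF tendsto_const lim, of C] by simp
        hence "(\<lambda>n. v ((ss ! i) n)) \<longlonglongrightarrow> 0"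
          by (rule tendsto_sandwich[OF _ _ tendsto_const, rotated 2])
             (auto intro!: always_eventually le v_nonneg cauchy_seqsD(1)[OF mem(1)] i)
        hence "cls (ss ! i) = cls (\<lambda>_. 0)"
          using mem(1)[OF i(1)] by (subst cls_eq_iff) (auto simp: cauchy_const closed)
        thus ?thesis using i ss Ks_eq by (simp add: cls_zero)
      qed
      hence "set Ks \<subseteq> {\<zero>\<^bsub>Q\<^esub>}" by (intro subsetI) simp
      moreover have "set Ks \<noteq> {}" using False Ks(1) Us(2) by auto
      ultimately show False using Ks(4) subset_singletonD by metis
    qed
  qed
  moreover have "Q.Span ?F Us = carrier Q"
  proof (intro equalityI subsetI)
    fix x assume "x \<in> Q.Span ?F Us"
    thus "x \<in> carrier Q" using Q.Span_in_carrier[of ?F Us] Us subringE(1)[OF subfieldE(1)[OF F]] by blast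
  next
    fix x assume "x \<in> carrier Q"
    then obtain s where s: "s \<in> cauchy_seqs K v" "x = cls s" by (auto simp: carrier_Q)
    note sK = cauchy_seqsD(1)[OF s(1)]
    have "\<forall>n. \<exists>c :: nat \<Rightarrow> rat. v (s n - (\<Sum>j<m. of_rat (c j) * b j)) < 1 / Suc n"
      by (intro allI dense sK) simp
    then obtain c :: "nat \<Rightarrow> nat \<Rightarrow> rat" where c: "\<And>n. v (s n - (\<Sum>j<m. of_rat (c n j) * b j)) < 1 / Suc n"
      by metis
    define t where "t = (\<lambda>n. \<Sum>j<m. of_rat (c n j) * b j)"
    have tK: "t n \<in> K" for n unfolding t_def by (intro closed b) auto
    have lim0: "(\<lambda>n. v (t n - s n)) \<longlonglongrightarrow> 0"
    proof (rule tendsto_sandwich[OF _ _ tendsto_const])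
      show "(\<lambda>n. 1 / real (Suc n)) \<longlonglongrightarrow> 0" by (rule LIMSEQ_Suc[OF lim_1_over_n])
      have "v (t n - s n) \<le> 1 / Suc n" for n
        using c[of n] v_minus[of "t n - s n"] closed tK sK by (simp add: t_def)
      thus "\<forall>\<^sub>F n in sequentially. v (t n - s n) \<le> 1 / real (Suc n)" by (intro always_eventually) auto
    qed (auto intro!: always_eventually v_nonneg closed tK sK)
    have "(\<lambda>n. t n - s n) \<in> null_seqs K v"
      by (rule null_seqsI[OF _ lim0]) (intro closed tK sK)
    from cauchy_add[OF null_imp_cauchy[OF this] s(1)] have t: "t \<in> cauchy_seqs K v" by simp
    have cc: "(\<lambda>n. of_rat (c n i)) \<in> cauchy_seqs K v" if i: "i < m" for i
    proof (rule cauchy_seqsI)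
      fix e :: real assume e: "e > 0"
      obtain M where M: "\<forall>k\<ge>M. \<forall>n\<ge>M. v (t k - t n) < e / (\<bar>C\<bar> + 1)"
        using cauchy_seqsD(2)[OF t, of "e / (\<bar>C\<bar> + 1)"] e by auto
      show "\<exists>M. \<forall>k\<ge>M. \<forall>n\<ge>M. v (of_rat (c k i) - of_rat (c n i)) < e"
      proof (intro exI[of _ M] allI impI)
        fix k n assume kn: "k \<ge> M" "n \<ge> M"
        have "v (of_rat (c k i) - of_rat (c n i)) \<le> C * v (\<Sum>j<m. of_rat (c k j - c n j) * b j)"
          using C[OF i, of "\<lambda>j. c k j - c n j"] by (simp add: of_rat_diff)
        also have "(\<Sum>j<m. of_rat (c k j - c n j) * b j) = t k - t n"
          by (simp add: t_def of_rat_diff algebra_simps sum_subtractf)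
        also have "C * v (t k - t n) \<le> (\<bar>C\<bar> + 1) * v (t k - t n)"
          using closed tK by (intro mult_right_mono v_nonneg) auto
        also have "\<dots> < (\<bar>C\<bar> + 1) * (e / (\<bar>C\<bar> + 1))"
          using M kn by (intro mult_strict_left_mono) auto
        also have "\<dots> = e" by simp
        finally show "v (of_rat (c k i) - of_rat (c n i)) < e" .
      qed
    qed (rule closed)
    define ss where "ss = map (\<lambda>i n. of_rat (c n i) :: complex) [0..<m]"
    have ss: "length ss = m" "set ss \<subseteq> cauchy_seqs K v" "\<And>j. j < m \<Longrightarrow> ss ! j = (\<lambda>n. of_rat (c n j))"
      using cc by (auto simp: ss_def)
    have "ring.combine Q (map (\<lambda>s. cls s) ss) Us = cls t"
      unfolding comb(1)[OF ss(1,2)] t_def by (simp add: ss(3))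
    also have "\<dots> = x" unfolding s using lim0 t s by (subst cls_eq_iff) auto
    finally have x: "ring.combine Q (map (\<lambda>s. cls s) ss) Us = x" .
    have "set (map (\<lambda>s. cls s) ss) \<subseteq> ?F"
      using cc by (auto simp: ss_def rat_completion_def rat_cauchy_eq intro!: imageI)
    thus "x \<in> Q.Span ?F Us"
      unfolding Q.Span_mem_iff_length_version[OF F Us(1)]
      using x ss(1) Us(2) by (intro exI[of _ "map (\<lambda>s. cls s) ss"]) auto
  qed
  ultimately have "Q.dimension m ?F (carrier Q)"
    using Q.dimension_independent[of ?F Us] Us by simp
  from Q.dimI[OF F this] show ?thesis by (simp add: local_degree_def over_def)
qed

text \<open>A greedy choice from the spanning family: \<open>e k\<close> is adjoined only if it has
  positive distance from the combinations available so far. That distance preserves the coefficient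
  bound; otherwise \<open>e k\<close> is already approximated.\<close>

lemma local_basis_exists:
  assumes e: "\<And>i. i < d \<Longrightarrow> e i \<in> K"
    and span: "\<And>x. x \<in> K \<Longrightarrow> \<exists>c :: nat \<Rightarrow> rat. x = (\<Sum>i<d. of_rat (c i) * e i)"
  obtains b m where "local_basis b m"
proof -
  define near where "near = (\<lambda>b m x. \<forall>\<epsilon>>0. \<exists>c :: nat \<Rightarrow> rat. v (x - (\<Sum>j<m::nat. of_rat (c j) * b j)) < \<epsilon>)"
  have "\<exists>b m. (\<forall>i<m. b i \<in> K) \<and>
     (\<exists>C. \<forall>c :: nat \<Rightarrow> rat. \<forall>i<m. v (of_rat (c i)) \<le> C * v (\<Sum>j<m. of_rat (c j) * b j)) \<and>
     (\<forall>i<k. near b m (e i))" if "k \<le> d" for k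
    using that
  proof (induction k)
    case 0
    show ?case by (intro exI[of _ e] exI[of _ 0]) auto
  next
    case (Suc k)
    then obtain b m C where b: "\<And>i. i < m \<Longrightarrow> b i \<in> K"
      and C: "\<And>(c :: nat \<Rightarrow> rat) i. i < m \<Longrightarrow> v (of_rat (c i)) \<le> C * v (\<Sum>j<m. of_rat (c j) * b j)"
      and near: "\<And>i. i < k \<Longrightarrow> near b m (e i)"
      by auto
    have SK: "(\<Sum>j<m. of_rat (c j) * b j) \<in> K" for c by (intro closed b) auto
    have ek: "e k \<in> K" using e Suc by simp
    show ?case
    proof (cases "near b m (e k)")
      case True
      hence "\<forall>i<Suc k. near b m (e i)" using near by (auto simp: less_Suc_eq)
      thus ?thesis using b C by blast
    next
      case False
      then obtain \<epsilon> where \<epsilon>: "\<epsilon> > 0" "\<And>c :: nat \<Rightarrow> rat. v (e k - (\<Sum>j<m. of_rat (c j) * b j)) \<ge> \<epsilon>"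
        by (auto simp: near_def not_less)
      define b' where "b' = b(m := e k)"
      have sum': "(\<Sum>j<Suc m. of_rat (c j) * b' j) = (\<Sum>j<m. of_rat (c j) * b j) + of_rat (c m) * e k"
        for c :: "nat \<Rightarrow> rat" by (auto simp: b'_def intro!: sum.cong)
      \<comment> \<open>\<open>\<epsilon>\<close>, a lower bound for the distance of
        \<open>e k\<close> from the previous span, bounds the new coefficient by
        \<open>v S / \<epsilon>\<close>. The rest \<open>T\<close> of the combination then satisfies
        \<open>v T \<le> (1 + v (e k) / \<epsilon>) * v S\<close>, and the old constant
        \<open>C\<close> applies to it.\<close>
      define D where "D = 1 / \<epsilon> + \<bar>C\<bar> * (1 + v (e k) / \<epsilon>)"
      have D: "v (of_rat (c i)) \<le> D * v (\<Sum>j<Suc m. of_rat (c j) * b' j)" if i: "i < Suc m" for c :: "nat \<Rightarrow> rat" and i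
      proof -
        define S where "S = (\<Sum>j<Suc m. of_rat (c j) * b' j)"
        define T where "T = (\<Sum>j<m. of_rat (c j) * b j)"
        have S: "S = T + of_rat (c m) * e k" unfolding S_def T_def by (rule sum')
        have TK: "T \<in> K" unfolding T_def by (rule SK)
        have K: "S \<in> K" unfolding S by (intro closed TK ek)
        have vS: "v S \<ge> 0" by (rule v_nonneg[OF K])
        have vek: "v (e k) \<ge> 0" by (rule v_nonneg[OF ek])
        have 1: "v (of_rat (c m)) \<le> v S / \<epsilon>"
        proof (cases "c m = 0")
          case False
          have "v S = v (of_rat (c m) * (e k - (\<Sum>j<m. of_rat (- c j / c m) * b j)))"
            using False by (simp add: S T_def of_rat_divide of_rat_minus sum_distrib_left algebra_simps sum_negf)
          also have "\<dots> = v (of_rat (c m)) * v (e k - (\<Sum>j<m. of_rat (- c j / c m) * b j))"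
            by (intro v_mult closed ek b) auto
          also have "\<dots> \<ge> v (of_rat (c m)) * \<epsilon>"
            by (intro mult_left_mono \<epsilon>(2) v_nonneg closed)
          finally show ?thesis using \<epsilon>(1) by (simp add: field_simps)
        qed (use vS \<epsilon> v_0 in simp)
        show ?thesis
        proof (cases "i = m")
          case True
          have "v S / \<epsilon> \<le> D * v S" using vS vek \<epsilon> by (simp add: D_def algebra_simps)
          thus ?thesis using 1 True unfolding S_def by simp
        next
          case False
          hence "i < m" using i by simp
          have "v (of_rat (c i)) \<le> C * v T" unfolding T_def by (rule C) fact
          also have "\<dots> \<le> \<bar>C\<bar> * v T" by (intro mult_right_mono v_nonneg TK) auto
          also have "v T \<le> v S + v (of_rat (c m) * e k)"
            using v_diff[OF K, of "of_rat (c m) * e k"] S closed ek by simp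
          also have "v (of_rat (c m) * e k) = v (of_rat (c m)) * v (e k)"
            by (intro v_mult closed ek)
          also have "\<dots> \<le> v S / \<epsilon> * v (e k)" by (intro mult_right_mono 1 v_nonneg ek)
          also have "\<bar>C\<bar> * (v S + v S / \<epsilon> * v (e k)) = \<bar>C\<bar> * (1 + v (e k) / \<epsilon>) * v S"
            by (simp add: algebra_simps)
          also have "\<dots> \<le> D * v S" unfolding D_def using \<epsilon> vS by (intro mult_right_mono) auto
          finally show ?thesis unfolding S_def by (simp add: mult_left_mono)
        qed
      qed
      have near': "near b' (Suc m) x" if "near b m x" for x
        unfolding near_def
      proof (intro allI impI)
        fix \<delta> :: real assume "\<delta> > 0"
        then obtain c :: "nat \<Rightarrow> rat" where c: "v (x - (\<Sum>j<m. of_rat (c j) * b j)) < \<delta>"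
          using \<open>near b m x\<close> unfolding near_def by blast
        have "(\<Sum>j<Suc m. of_rat ((c(m := 0)) j) * b' j) = (\<Sum>j<m. of_rat (c j) * b j)"
          unfolding sum' by simp
        thus "\<exists>c. v (x - (\<Sum>j<Suc m. of_rat (c j) * b' j)) < \<delta>" using c by metis
      qed
      have "near b' (Suc m) (e k)"
        unfolding near_def
      proof (intro allI impI)
        fix \<delta> :: real assume "\<delta> > 0"
        have "(\<Sum>j<Suc m. of_rat ((\<lambda>j. if j = m then 1 else 0) j) * b' j) = e k"
          unfolding sum' by simp
        thus "\<exists>c. v (e k - (\<Sum>j<Suc m. of_rat (c j) * b' j)) < \<delta>"
          using \<open>\<delta> > 0\<close> v_0 by (intro exI[of _ "\<lambda>j. if j = m then 1 else 0"]) simp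
      qed
      hence "\<forall>i<Suc k. near b' (Suc m) (e i)" using near near' by (auto simp: less_Suc_eq)
      moreover have "\<forall>i<Suc m. b' i \<in> K" using b ek by (auto simp: b'_def less_Suc_eq)
      ultimately show ?thesis using D by blast
    qed
  qed
  from this[of d] obtain b m where b: "\<forall>i<m. b i \<in> K"
    "\<exists>C. \<forall>c :: nat \<Rightarrow> rat. \<forall>i<m. v (of_rat (c i)) \<le> C * v (\<Sum>j<m. of_rat (c j) * b j)"
    and near: "\<And>i. i < d \<Longrightarrow> near b m (e i)" by blast
  have near_sum: "near b m (\<Sum>i<k. of_rat (c i) * e i)" if "k \<le> d" for k and c :: "nat \<Rightarrow> rat"
    using that
  proof (induction k)
    case 0
    show ?case unfolding near_def
      by (intro allI impI exI[of _ "\<lambda>_. 0"]) (simp add: v_0)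
  next
    case (Suc k)
    show ?case unfolding near_def
    proof (intro allI impI)
      fix \<delta> :: real assume \<delta>: "\<delta> > 0"
      define B where "B = v (of_rat (c k)) + 1"
      have B: "B > 0" "v (of_rat (c k)) \<le> B" using v_nonneg[OF of_rat_closed[of "c k"]] by (auto simp: B_def)
      obtain f :: "nat \<Rightarrow> rat" where f: "v ((\<Sum>i<k. of_rat (c i) * e i) - (\<Sum>j<m. of_rat (f j) * b j)) < \<delta> / 2"
        using Suc \<delta> unfolding near_def by (metis half_gt_zero Suc_leD)
      obtain g :: "nat \<Rightarrow> rat" where g: "v (e k - (\<Sum>j<m. of_rat (g j) * b j)) < \<delta> / (2 * B)"
        using near[of k] Suc.prems \<delta> B unfolding near_def by (metis Suc_le_lessD divide_pos_pos mult_pos_pos zero_less_numeral)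
      have mem: "e k - (\<Sum>j<m. of_rat (g j) * b j) \<in> K" "(\<Sum>i<k. of_rat (c i) * e i) - (\<Sum>j<m. of_rat (f j) * b j) \<in> K"
        using b Suc.prems by (auto intro!: closed e)
      have "v ((\<Sum>i<Suc k. of_rat (c i) * e i) - (\<Sum>j<m. of_rat (f j + c k * g j) * b j)) =
         v (((\<Sum>i<k. of_rat (c i) * e i) - (\<Sum>j<m. of_rat (f j) * b j)) + of_rat (c k) * (e k - (\<Sum>j<m. of_rat (g j) * b j)))"
        by (simp add: of_rat_add of_rat_mult algebra_simps sum.distrib sum_distrib_left)
      also have "\<dots> \<le> v ((\<Sum>i<k. of_rat (c i) * e i) - (\<Sum>j<m. of_rat (f j) * b j)) + v (of_rat (c k)) * v (e k - (\<Sum>j<m. of_rat (g j) * b j))"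
        using mem by (subst v_mult[symmetric]) (auto intro!: v_add closed)
      also have "v (of_rat (c k)) * v (e k - (\<Sum>j<m. of_rat (g j) * b j)) \<le> B * (\<delta> / (2 * B))"
        using B g mem by (intro mult_mono) (auto intro: v_nonneg)
      also have "v ((\<Sum>i<k. of_rat (c i) * e i) - (\<Sum>j<m. of_rat (f j) * b j)) + B * (\<delta> / (2 * B)) < \<delta> / 2 + B * (\<delta> / (2 * B))"
        using f by simp
      also have "\<dots> = \<delta>" using B by simp
      finally show "\<exists>c'. v ((\<Sum>i<Suc k. of_rat (c i) * e i) - (\<Sum>j<m. of_rat (c' j) * b j)) < \<delta>"
        by (intro exI[of _ "\<lambda>j. f j + c k * g j"]) simp
    qed
  qed
  have "near b m x" if "x \<in> K" for x
    using span[OF that] near_sum[of d] by auto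
  hence "local_basis b m" using b by (simp add: local_basis_def near_def)
  thus ?thesis using that by blast
qed

end

text \<open>Gaussian elimination: a pivot \<open>j0\<close> eliminates one equation together with
  one unknown. The field of coefficients \<open>F\<close> is a parameter, as a solution is wanted
  once in algebraic and once in rational numbers.\<close>

lemma exists_kernel_vector:
  fixes a :: "'j \<Rightarrow> nat \<Rightarrow> 'a :: field"
  assumes F: "0 \<in> F" "1 \<in> F" "\<And>x y. x \<in> F \<Longrightarrow> y \<in> F \<Longrightarrow> x - y \<in> F"
      "\<And>x y. x \<in> F \<Longrightarrow> y \<in> F \<Longrightarrow> x * y \<in> F" "\<And>x. x \<in> F \<Longrightarrow> inverse x \<in> F"
    and J: "finite J" "card J > m" and a: "\<And>j i. j \<in> J \<Longrightarrow> i < m \<Longrightarrow> a j i \<in> F"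
  obtains \<mu> where "\<And>j. \<mu> j \<in> F" "\<exists>j\<in>J. \<mu> j \<noteq> 0" "\<And>i. i < m \<Longrightarrow> (\<Sum>j\<in>J. \<mu> j * a j i) = 0"
proof -
  have F_sum: "(\<Sum>j\<in>A. f j) \<in> F" if "\<And>j. j \<in> A \<Longrightarrow> f j \<in> F" for A :: "'j set" and f
    using that
  proof (induction A rule: infinite_finite_induct)
    case (insert x A)
    have "f x - (0 - (\<Sum>j\<in>A. f j)) \<in> F" using insert by (intro F) auto
    thus ?case using insert by simp
  qed (auto simp: F)
  have "\<exists>\<mu>. (\<forall>j. \<mu> j \<in> F) \<and> (\<exists>j\<in>J. \<mu> j \<noteq> 0) \<and> (\<forall>i<m. (\<Sum>j\<in>J. \<mu> j * a j i) = 0)"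
    using J a
  proof (induction m arbitrary: J a)
    case 0
    then obtain j where "j \<in> J" by (metis card_gt_0_iff ex_in_conv)
    thus ?case using F by (intro exI[of _ "\<lambda>_. 1"]) auto
  next
    case (Suc m)
    show ?case
    proof (cases "\<forall>j\<in>J. a j m = 0")
      case True
      obtain \<mu> where "\<forall>j. \<mu> j \<in> F" "\<exists>j\<in>J. \<mu> j \<noteq> 0" "\<forall>i<m. (\<Sum>j\<in>J. \<mu> j * a j i) = 0"
        using Suc.IH[of J a] Suc.prems by auto
      thus ?thesis using True by (intro exI[of _ \<mu>]) (auto simp: less_Suc_eq)
    next
      case False
      then obtain j0 where j0: "j0 \<in> J" "a j0 m \<noteq> 0" by auto
      define q where "q = (\<lambda>j. a j m * inverse (a j0 m))"
      have qF: "q j \<in> F" if "j \<in> J" for j using Suc.prems that j0 by (auto simp: q_def intro!: F)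
      define J' where "J' = J - {j0}"
      obtain \<mu> where \<mu>: "\<forall>j. \<mu> j \<in> F" "\<exists>j\<in>J'. \<mu> j \<noteq> 0" "\<forall>i<m. (\<Sum>j\<in>J'. \<mu> j * (a j i - q j * a j0 i)) = 0"
      proof -
        have "finite J'" "m < card J'" using Suc.prems j0 by (auto simp: J'_def card_Diff_singleton)
        moreover have "a j i - q j * a j0 i \<in> F" if "j \<in> J'" "i < m" for j i
          using Suc.prems j0 that qF by (auto simp: J'_def intro!: F)
        ultimately show ?thesis using Suc.IH[of J' "\<lambda>j i. a j i - q j * a j0 i"] that by blast
      qed
      define \<nu> where "\<nu> = \<mu>(j0 := 0 - (\<Sum>j\<in>J'. \<mu> j * q j))"
      have "(\<Sum>j\<in>J. \<nu> j * a j i) = (\<Sum>j\<in>J'. \<mu> j * (a j i - q j * a j0 i))" for i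
      proof -
        have "(\<Sum>j\<in>J. \<nu> j * a j i) = \<nu> j0 * a j0 i + (\<Sum>j\<in>J'. \<nu> j * a j i)"
          unfolding J'_def using j0 Suc.prems by (subst sum.remove) auto
        also have "(\<Sum>j\<in>J'. \<nu> j * a j i) = (\<Sum>j\<in>J'. \<mu> j * a j i)"
          by (intro sum.cong) (auto simp: \<nu>_def J'_def)
        finally show ?thesis
          by (simp add: \<nu>_def algebra_simps sum_subtractf sum_distrib_right sum_distrib_left)
      qed
      moreover have "(\<Sum>j\<in>J'. \<mu> j * (a j i - q j * a j0 i)) = 0" if "i < Suc m" for i
      proof (cases "i = m")
        case True
        thus ?thesis using j0 by (intro sum.neutral) (auto simp: q_def)
      qed (use \<mu> that in auto)
      moreover have "\<nu> j \<in> F" for j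
      proof -
        have "0 - (\<Sum>j\<in>J'. \<mu> j * q j) \<in> F"
          using \<mu>(1) qF by (intro F F_sum) (auto simp: J'_def)
        thus ?thesis using \<mu>(1) by (simp add: \<nu>_def)
      qed
      moreover have "\<exists>j\<in>J. \<nu> j \<noteq> 0" using \<mu>(2) by (auto simp: \<nu>_def J'_def)
      ultimately show ?thesis by (intro exI[of _ \<nu>]) auto
    qed
  qed
  thus ?thesis using that by blast
qed

lemma valued_field_algebraic:
  "absolute_value_on {x. algebraic x} w \<Longrightarrow> valued_field {x. algebraic x} w"
  by unfold_locales (auto simp: Rats_def intro: algebraic_plus_mult)

text \<open>
  If there were more than \<open>m\<close> embeddings, some linear combination of them would vanish on the local
  basis, hence by density on \<open>K\<close>, although distinct embeddings are linearly independent.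
\<close>

lemma (in valued_field) card_embeddings_le:
  assumes basis: "local_basis b m" and J: "finite J"
    and w: "absolute_value_on {x. algebraic x} w"
    and \<sigma>_alg: "\<And>j x. j \<in> J \<Longrightarrow> x \<in> K \<Longrightarrow> algebraic (\<sigma> j x)"
    and \<sigma>_add: "\<And>j x y. j \<in> J \<Longrightarrow> x \<in> K \<Longrightarrow> y \<in> K \<Longrightarrow> \<sigma> j (x + y) = \<sigma> j x + \<sigma> j y"
    and \<sigma>_mult: "\<And>j x y. j \<in> J \<Longrightarrow> x \<in> K \<Longrightarrow> y \<in> K \<Longrightarrow> \<sigma> j (x * y) = \<sigma> j x * \<sigma> j y"
    and \<sigma>_rat: "\<And>j q. j \<in> J \<Longrightarrow> \<sigma> j (of_rat q) = of_rat q"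
    and iso: "\<And>j x. j \<in> J \<Longrightarrow> x \<in> K \<Longrightarrow> w (\<sigma> j x) = v x"
    and \<alpha>: "\<alpha> \<in> K" "inj_on (\<lambda>j. \<sigma> j \<alpha>) J"
  shows "card J \<le> m"
proof (rule ccontr)
  assume "\<not> card J \<le> m"
  hence card: "card J > m" by simp
  interpret W: valued_field "{x. algebraic x}" w by (rule valued_field_algebraic[OF w])
  have b: "\<And>i. i < m \<Longrightarrow> b i \<in> K"
    and dense: "\<And>x e. x \<in> K \<Longrightarrow> e > 0 \<Longrightarrow> \<exists>c :: nat \<Rightarrow> rat. v (x - (\<Sum>j<m. of_rat (c j) * b j)) < e"
    using basis by (auto simp: local_basis_def)
  \<comment> \<open>The coefficients are algebraic because \<open>w\<close>, an absolute value on
    algebraic numbers, must measure them in the density argument.\<close>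
  obtain \<mu> where \<mu>: "\<And>j. algebraic (\<mu> j)" "\<exists>j\<in>J. \<mu> j \<noteq> 0" "\<And>i. i < m \<Longrightarrow> (\<Sum>j\<in>J. \<mu> j * \<sigma> j (b i)) = 0"
    using exists_kernel_vector[of "{x :: complex. algebraic x}" J m "\<lambda>j i. \<sigma> j (b i)"] J card \<sigma>_alg b
      algebraic_of_rat[of 1]
    by (auto intro: algebraic_diff algebraic_plus_mult)
  have \<sigma>_sum: "\<sigma> j (\<Sum>i\<in>A. of_rat (c i) * f i) = (\<Sum>i\<in>A. of_rat (c i) * \<sigma> j (f i))"
    if "j \<in> J" "\<And>i. i \<in> A \<Longrightarrow> f i \<in> K" for j and A :: "nat set" and c f
    using that(2)
  proof (induction A rule: infinite_finite_induct)
    case (insert i A)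
    have "\<sigma> j (of_rat (c i) * f i + (\<Sum>i\<in>A. of_rat (c i) * f i)) = of_rat (c i) * \<sigma> j (f i) + \<sigma> j (\<Sum>i\<in>A. of_rat (c i) * f i)"
      using insert that(1) by (subst \<sigma>_add) (auto simp: \<sigma>_mult \<sigma>_rat closed intro!: closed)
    thus ?case using insert by simp
  qed (use \<sigma>_rat[OF that(1), of 0] in auto)
  have vanish: "(\<Sum>j\<in>J. \<mu> j * \<sigma> j x) = 0" if x: "x \<in> K" for x
  proof -
    define S where "S = (\<Sum>j\<in>J. \<mu> j * \<sigma> j x)"
    have S_alg: "algebraic S" unfolding S_def by (intro algebraic_sum algebraic_plus_mult \<mu> \<sigma>_alg x)
    define M where "M = (\<Sum>j\<in>J. w (\<mu> j)) + 1"
    have M: "M > 0" unfolding M_def using \<mu>(1) by (intro add_nonneg_pos sum_nonneg) (auto intro: W.v_nonneg)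
    have "w S \<le> e" if e: "e > 0" for e
    proof -
      obtain c :: "nat \<Rightarrow> rat" where c: "v (x - (\<Sum>i<m. of_rat (c i) * b i)) < e / M"
        using dense[OF x, of "e / M"] e M by auto
      define y where "y = (\<Sum>i<m. of_rat (c i) * b i)"
      have yK: "y \<in> K" unfolding y_def by (intro closed b) auto
      have "(\<Sum>j\<in>J. \<mu> j * \<sigma> j y) = (\<Sum>j\<in>J. \<Sum>i<m. of_rat (c i) * (\<mu> j * \<sigma> j (b i)))"
        unfolding y_def by (intro sum.cong refl, subst \<sigma>_sum) (auto simp: b sum_distrib_left mult_ac)
      also have "\<dots> = (\<Sum>i<m. of_rat (c i) * (\<Sum>j\<in>J. \<mu> j * \<sigma> j (b i)))"
        by (subst sum.swap) (simp add: sum_distrib_left)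
      also have "\<dots> = 0" using \<mu>(3) by simp
      finally have "S = (\<Sum>j\<in>J. \<mu> j * \<sigma> j x) - (\<Sum>j\<in>J. \<mu> j * \<sigma> j y)" by (simp add: S_def)
      also have "\<dots> = (\<Sum>j\<in>J. \<mu> j * \<sigma> j (x - y))"
      proof -
        have "\<sigma> j x = \<sigma> j (x - y) + \<sigma> j y" if "j \<in> J" for j
          using \<sigma>_add[OF that, of "x - y" y] x yK closed by simp
        thus ?thesis unfolding sum_subtractf[symmetric]
          by (intro sum.cong refl) (simp add: algebra_simps)
      qed
      finally have "w S \<le> (\<Sum>j\<in>J. w (\<mu> j * \<sigma> j (x - y)))"
        using \<mu>(1) \<sigma>_alg x yK closed by (auto intro!: W.v_sum algebraic_plus_mult)
      also have "\<dots> = (\<Sum>j\<in>J. w (\<mu> j) * v (x - y))"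
        using \<mu>(1) \<sigma>_alg x yK closed by (intro sum.cong refl) (simp add: W.v_mult iso)
      also have "\<dots> = (M - 1) * v (x - y)" by (simp add: M_def sum_distrib_right)
      also have "\<dots> \<le> M * v (x - y)" by (intro mult_right_mono v_nonneg closed x yK) auto
      also have "\<dots> \<le> M * (e / M)" using c M unfolding y_def[symmetric] by (intro mult_left_mono) auto
      also have "\<dots> = e" using M by simp
      finally show ?thesis .
    qed
    hence "w S \<le> 0" by (meson dense_ge)
    thus ?thesis using W.v_nonneg[of S] W.v_eq_0[of S] S_alg by (simp add: S_def)
  qed
  define \<beta> where "\<beta> = (\<lambda>j. \<sigma> j \<alpha>)"
  have \<sigma>_pow: "\<sigma> j (\<alpha> ^ i) = \<beta> j ^ i" if "j \<in> J" for i j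
    using that \<sigma>_rat[OF that, of 1] by (induction i) (auto simp: \<beta>_def \<sigma>_mult \<alpha> closed)
  have poly0: "(\<Sum>j\<in>J. \<mu> j * poly p (\<beta> j)) = 0" for p
  proof -
    have "(\<Sum>j\<in>J. \<mu> j * poly p (\<beta> j)) = (\<Sum>j\<in>J. \<Sum>i\<le>degree p. coeff p i * (\<mu> j * \<sigma> j (\<alpha> ^ i)))"
      by (intro sum.cong refl) (simp add: poly_altdef sum_distrib_left \<sigma>_pow mult_ac)
    also have "\<dots> = (\<Sum>i\<le>degree p. coeff p i * (\<Sum>j\<in>J. \<mu> j * \<sigma> j (\<alpha> ^ i)))"
      by (subst sum.swap) (simp add: sum_distrib_left)
    also have "\<dots> = 0" using vanish[OF power_closed[OF \<alpha>(1)]] by simp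
    finally show ?thesis .
  qed
  obtain j0 where j0: "j0 \<in> J" "\<mu> j0 \<noteq> 0" using \<mu> by blast
  \<comment> \<open>Evaluated at powers of \<open>\<alpha>\<close>, the relation holds for every
    polynomial in the distinct values \<open>\<beta> j\<close>. This one vanishes at all of them
    except \<open>\<beta> j0\<close> and so isolates \<open>\<mu> j0\<close>.\<close>
  define p where "p = (\<Prod>j\<in>J-{j0}. [:- \<beta> j, 1:])"
  have "poly p (\<beta> j) = 0" if "j \<in> J - {j0}" for j
    using that J by (auto simp: p_def poly_prod)
  hence "(\<Sum>j\<in>J. \<mu> j * poly p (\<beta> j)) = \<mu> j0 * poly p (\<beta> j0)"
    using j0 J by (subst sum.remove[of _ j0]) auto
  moreover have "poly p (\<beta> j0) \<noteq> 0"
    using J j0 \<alpha>(2) by (auto simp: p_def poly_prod \<beta>_def inj_on_def)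
  ultimately show False using poly0[of p] j0 by simp
qed

section \<open>Weak approximation\<close>


context valued_field
begin

text \<open>Every power of \<open>x\<close> is an integer combination of the first \<open>n\<close>
  powers, so all \<open>v x ^ k\<close> share one bound. Only the triangle inequality is at hand,
  since an ultrametric inequality is not part of the definition of a place.\<close>

lemma v_le_one_if_algebraic_int:
  assumes int: "\<And>n :: int. v (of_int n) \<le> 1" and x: "x \<in> K" "algebraic_int x"
  shows "v x \<le> 1"
proof (rule ccontr)
  assume "\<not> v x \<le> 1"
  hence gt: "v x > 1" by simp
  obtain n a where n: "n > 0" and a: "\<And>i. i < n \<Longrightarrow> x * x ^ i = (\<Sum>j<n. of_int (a i j) * x ^ j)"
    using algebraic_int_powers_module[OF x(2)] by blast
  have "\<exists>c :: nat \<Rightarrow> int. x ^ k = (\<Sum>j<n. of_int (c j) * x ^ j)" for k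
  proof (induction k)
    case 0
    have "(\<Sum>j<n. of_int (if j = 0 then 1 else 0) * x ^ j) = (\<Sum>j<n. if j = 0 then 1 else 0)"
      by (intro sum.cong) auto
    thus ?case using n by (intro exI[of _ "\<lambda>j. if j = 0 then 1 else 0"]) simp
  next
    case (Suc k)
    then obtain c :: "nat \<Rightarrow> int" where c: "x ^ k = (\<Sum>j<n. of_int (c j) * x ^ j)" by blast
    have "x ^ Suc k = (\<Sum>i<n. of_int (c i) * (x * x ^ i))"
      by (simp add: c sum_distrib_left mult_ac)
    also have "\<dots> = (\<Sum>i<n. \<Sum>j<n. of_int (c i) * (of_int (a i j) * x ^ j))"
      by (intro sum.cong refl) (simp add: a sum_distrib_left del: power_Suc)
    also have "\<dots> = (\<Sum>j<n. of_int (\<Sum>i<n. c i * a i j) * x ^ j)"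
      by (subst sum.swap) (simp add: sum_distrib_left sum_distrib_right mult_ac)
    finally show ?case by (intro exI[of _ "\<lambda>j. \<Sum>i<n. c i * a i j"])
  qed
  hence "\<exists>c. \<forall>k. x ^ k = (\<Sum>j<n. of_int (c k j :: int) * x ^ j)" by (intro choice allI)
  then obtain c where c: "\<And>k. x ^ k = (\<Sum>j<n. of_int (c k j) * x ^ j)" by blast
  have intK: "of_int i \<in> K" for i using of_rat_closed[of "of_int i"] by simp
  have bound: "v x ^ k \<le> (\<Sum>j<n. v (x ^ j))" for k
  proof -
    have "v x ^ k = v (\<Sum>j<n. of_int (c k j) * x ^ j)" using c[of k] x by (simp add: v_power[symmetric])
    also have "\<dots> \<le> (\<Sum>j<n. v (of_int (c k j) * x ^ j))" by (intro v_sum closed x intK)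
    also have "\<dots> = (\<Sum>j<n. v (of_int (c k j)) * v (x ^ j))" by (simp add: v_mult closed x intK)
    also have "\<dots> \<le> (\<Sum>j<n. 1 * v (x ^ j))"
      by (intro sum_mono mult_right_mono int v_nonneg closed x)
    finally show ?thesis by simp
  qed
  obtain k where "(\<Sum>j<n. v (x ^ j)) < v x ^ k" using real_arch_pow[OF gt] by blast
  with bound[of k] show False by simp
qed

lemma v_power_int: "x \<in> K \<Longrightarrow> v (x powi n) = v x powi n" "x \<in> K \<Longrightarrow> x powi n \<in> K"
  by (auto simp: power_int_def v_power v_inverse closed)

end

text \<open>
  Since \<open>v\<close> and \<open>w\<close> agree on \<open>\<rat>\<close>, one can divide a high power of \<open>x\<close> by a power of \<open>\<rho>\<close> whose absolute
  value lies between those of that power of \<open>x\<close>.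
\<close>

lemma separating_element:
  assumes v: "valued_field K v" and w: "valued_field K w"
    and rat: "\<And>q. v (of_rat q) = w (of_rat q)" and \<rho>: "v (of_rat \<rho>) > 1"
    and x: "x \<in> K" "v x \<noteq> w x"
  obtains y where "y \<in> K" "v y > 1" "w y < 1"
proof -
  interpret v: valued_field K v by fact
  interpret w: valued_field K w by fact
  note result = that
  have aux: thesis if x: "x \<in> K" and gt: "v x > w x" for x
  proof -
    have "x \<noteq> 0" using gt v.v_0 w.v_0 by auto
    hence wx: "w x > 0" using w.v_nonneg[OF x] w.v_eq_0[OF x] by linarith
    define r where "r = v (of_rat \<rho>)"
    have r: "r > 1" using \<rho> by (simp add: r_def)
    have "v x / w x > 1" using gt wx by simp
    \<comment> \<open>A gap of more than a factor \<open>r\<close> between \<open>w x ^ k\<close>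
      and \<open>v x ^ k\<close> leaves room for an integral power of \<open>r\<close> in
      between.\<close>
    then obtain k where "r < (v x / w x) ^ k" using real_arch_pow by blast
    hence k: "r * w x ^ k < v x ^ k" using wx by (simp add: power_divide field_simps)
    define m where "m = \<lfloor>log r (w x ^ k)\<rfloor> + 1"
    have "log r (w x ^ k) < m" unfolding m_def by linarith
    hence 1: "w x ^ k < r powr m" using r wx by (simp add: log_less_iff)
    have "m \<le> log r (r * w x ^ k)"
      using r wx by (simp add: log_mult m_def)
    hence "r powr m \<le> r * w x ^ k" using r wx by (subst (asm) le_log_iff) auto
    hence 2: "r powr m < v x ^ k" using k by simp
    have pw: "r powr m = r powi m" using r by (simp add: powr_real_of_int')
    define y where "y = x ^ k * inverse (of_rat \<rho> powi m)"
    have "y \<in> K" unfolding y_def by (intro v.closed x v.v_power_int)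
    moreover have "v y = v x ^ k / (r powi m)"
      unfolding y_def by (simp add: v.v_mult v.v_inverse v.v_power v.v_power_int v.closed x r_def divide_inverse)
    moreover have "w y = w x ^ k / (r powi m)"
      unfolding y_def by (simp add: w.v_mult w.v_inverse w.v_power w.v_power_int w.closed x r_def divide_inverse rat)
    moreover have "r powi m > 0" using r by simp
    ultimately show thesis using result[of y] 1 2 pw by simp
  qed
  show ?thesis
  proof (cases "v x > w x")
    case True
    thus ?thesis by (rule aux[OF x(1)])
  next
    case False
    hence lt: "v x < w x" using x by simp
    hence "x \<noteq> 0" using v.v_0 w.v_0 by auto
    hence "v x > 0" using v.v_nonneg[OF x(1)] v.v_eq_0[OF x(1)] by linarith
    hence "w (inverse x) < v (inverse x)"
      using lt x by (simp add: v.v_inverse w.v_inverse)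
    thus ?thesis by (rule aux[OF v.inverse_closed[OF x(1)]])
  qed
qed

text \<open>The quotient differs from 1 by \<open>- inverse (1 + y ^ n)\<close>, and
  \<open>v (1 + y ^ n)\<close> is at least \<open>v y ^ n - 1\<close>. Together with the case
  \<open>v y < 1\<close> this turns \<open>y\<close> into an approximate indicator of the absolute
  values that exceed 1 at \<open>y\<close>.\<close>

lemma (in valued_field) v_quotient_gt:
  assumes y: "y \<in> K" "v y > 1"
  shows "(\<lambda>n. v (y ^ n * inverse (1 + y ^ n) - 1)) \<longlonglongrightarrow> 0" "1 + y ^ Suc n \<noteq> 0"
proof -
  have ge: "v (1 + y ^ n) \<ge> v y ^ n - 1" for n
    using v_add[of "1 + y ^ n" "- 1"] v_minus[of 1] y closed closed(4)[of 1] by (simp add: v_power v_1)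
  have "v y ^ Suc n > 1" for n using y(2) by (rule one_less_power) simp
  hence pos: "v (1 + y ^ Suc n) > 0" for n using ge[of "Suc n"] by (smt (verit))
  show nz: "1 + y ^ Suc n \<noteq> 0" for n using pos[of n] v_0 by (metis less_irrefl)
  have "filterlim (\<lambda>n. v y ^ Suc n) at_top sequentially"
    using filterlim_compose[OF filterlim_realpow_sequentially_gt1 filterlim_Suc, of "v y"] y(2)
      filterlim_at_infinity_imp_filterlim_at_top[of "\<lambda>n. v y ^ Suc n" sequentially]
    by (auto simp del: power_Suc intro!: always_eventually zero_less_power)
  hence "filterlim (\<lambda>n. -1 + v y ^ Suc n) at_top sequentially"
    by (rule filterlim_tendsto_add_at_top[OF tendsto_const])
  hence lim: "(\<lambda>n. inverse (-1 + v y ^ Suc n)) \<longlonglongrightarrow> 0"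
    by (rule tendsto_inverse_0_at_top)
  have le: "v (y ^ Suc n * inverse (1 + y ^ Suc n) - 1) \<le> inverse (-1 + v y ^ Suc n)" for n
  proof -
    have "y ^ Suc n * inverse (1 + y ^ Suc n) - 1 = - inverse (1 + y ^ Suc n)"
      using nz[of n] by (simp add: field_simps)
    hence "v (y ^ Suc n * inverse (1 + y ^ Suc n) - 1) = inverse (v (1 + y ^ Suc n))"
      using y closed by (simp add: v_minus v_inverse del: power_Suc)
    also have "\<dots> \<le> inverse (-1 + v y ^ Suc n)"
      using ge[of "Suc n"] \<open>\<And>n. v y ^ Suc n > 1\<close>[of n] by (intro le_imp_inverse_le) auto
    finally show ?thesis .
  qed
  have "(\<lambda>n. v (y ^ Suc n * inverse (1 + y ^ Suc n) - 1)) \<longlonglongrightarrow> 0"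
    by (rule tendsto_sandwich[OF _ _ tendsto_const lim])
       (rule always_eventually allI v_nonneg closed y le)+
  thus "(\<lambda>n. v (y ^ n * inverse (1 + y ^ n) - 1)) \<longlonglongrightarrow> 0"
    by (subst (asm) filterlim_sequentially_Suc)
qed

lemma (in valued_field) v_quotient_lt:
  assumes y: "y \<in> K" "v y < 1"
  shows "(\<lambda>n. v (y ^ n * inverse (1 + y ^ n))) \<longlonglongrightarrow> 0"
proof -
  have ge: "v (1 + y ^ n) \<ge> 1 - v y ^ n" for n
    using v_diff[of "1 + y ^ n" "y ^ n"] y closed by (simp add: v_power v_1)
  have lim: "(\<lambda>n. v y ^ n) \<longlonglongrightarrow> 0"
    using y v_nonneg[OF y(1)] by (intro LIMSEQ_realpow_zero)
  have "(\<lambda>n. v y ^ n * inverse (1 - v y ^ n)) \<longlonglongrightarrow> 0 * inverse (1 - 0)"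
    by (intro tendsto_intros lim) auto
  hence lim': "(\<lambda>n. v y ^ n * inverse (1 - v y ^ n)) \<longlonglongrightarrow> 0" by simp
  have "\<forall>\<^sub>F n in sequentially. v y ^ n < 1"
    using order_tendstoD(2)[of "\<lambda>n. v y ^ n" 0 sequentially 1] lim by simp
  hence le: "\<forall>\<^sub>F n in sequentially. v (y ^ n * inverse (1 + y ^ n)) \<le> v y ^ n * inverse (1 - v y ^ n)"
  proof eventually_elim
    case (elim n)
    have "v (y ^ n * inverse (1 + y ^ n)) = v y ^ n * inverse (v (1 + y ^ n))"
      using y closed by (simp add: v_mult v_power v_inverse)
    also have "\<dots> \<le> v y ^ n * inverse (1 - v y ^ n)"
      using ge[of n] elim v_nonneg[OF y(1)] by (intro mult_left_mono le_imp_inverse_le) auto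
    finally show ?case .
  qed
  show ?thesis
    by (rule tendsto_sandwich[OF _ le tendsto_const lim'])
       (rule always_eventually allI v_nonneg closed y)+
qed

text \<open>Induction adding one \<open>w\<close>, with \<open>y\<close> for the old set and
  \<open>z\<close> separating \<open>v\<close> from \<open>w\<close>. The new element is
  \<open>y\<close>, \<open>y ^ n * z\<close> or \<open>y ^ n * inverse (1 + y ^ n) * z\<close>,
  according to \<open>w y\<close> being less than, equal to or greater than 1, with \<open>n\<close>
  large.\<close>

lemma weak_approximation_separate:
  assumes v: "valued_field K v" and fin: "finite S" and S: "\<And>w. w \<in> S \<Longrightarrow> valued_field K w"
    and rat: "\<And>w q. w \<in> S \<Longrightarrow> v (of_rat q) = w (of_rat q)" and \<rho>: "v (of_rat \<rho>) > 1"
    and distinct: "\<And>w. w \<in> S \<Longrightarrow> \<exists>x\<in>K. v x \<noteq> w x"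
  shows "\<exists>y\<in>K. v y > 1 \<and> (\<forall>w\<in>S. w y < 1)"
  using fin S rat distinct
proof (induction S rule: finite_induct)
  case empty
  show ?case using \<rho> valued_field.of_rat_closed[OF v] by auto
next
  case (insert w S)
  interpret v: valued_field K v by fact
  interpret w: valued_field K w by (rule insert.prems) simp
  have "\<exists>y\<in>K. v y > 1 \<and> (\<forall>w\<in>S. w y < 1)" using insert.prems by (intro insert.IH) auto
  then obtain y where y: "y \<in> K" "v y > 1" "\<And>s. s \<in> S \<Longrightarrow> s y < 1" by blast
  have "\<exists>x\<in>K. v x \<noteq> w x" by (rule insert.prems) simp
  then obtain x where x: "x \<in> K" "v x \<noteq> w x" by blast
  have "v (of_rat q) = w (of_rat q)" for q by (rule insert.prems) simp
  then obtain z where z: "z \<in> K" "v z > 1" "w z < 1"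
    using separating_element[OF v w.valued_field_axioms _ \<rho> x] by blast
  consider "w y < 1" | "w y = 1" | "w y > 1" by linarith
  thus ?case
  proof cases
    case 1
    thus ?thesis using y by auto
  next
    case 2
    have "\<forall>\<^sub>F n in sequentially. s (y ^ n * z) < 1" if "s \<in> S" for s
    proof -
      interpret s: valued_field K s by (rule insert.prems) (use that in simp)
      have "(\<lambda>n. s y ^ n * s z) \<longlonglongrightarrow> 0 * s z"
        using y that s.v_nonneg[OF y(1)] by (intro tendsto_intros LIMSEQ_realpow_zero) auto
      from order_tendstoD(2)[OF this, of 1] show ?thesis
        using y z by (simp add: s.v_mult s.v_power s.closed)
    qed
    hence "\<forall>\<^sub>F n in sequentially. \<forall>s\<in>S. s (y ^ n * z) < 1"
      using insert by (intro eventually_ball_finite) auto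
    then obtain n where n: "\<forall>s\<in>S. s (y ^ n * z) < 1"
      by (auto simp: eventually_sequentially)
    have "v (y ^ n * z) > 1"
    proof -
      have "1 * 1 < v y ^ n * v z" using y z by (intro mult_le_less_imp_less one_le_power) auto
      thus ?thesis using y z by (simp add: v.v_mult v.v_power v.closed)
    qed
    moreover have "w (y ^ n * z) < 1" using 2 y z by (simp add: w.v_mult w.v_power w.closed)
    ultimately show ?thesis using n y z v.closed by (intro bexI[of _ "y ^ n * z"]) auto
  next
    case 3
    let ?q = "\<lambda>n. y ^ n * inverse (1 + y ^ n)"
    have q: "?q n \<in> K" for n by (intro v.closed y)
    have one: "(\<lambda>n. u (?q n)) \<longlonglongrightarrow> 1" if "valued_field K u" "u y > 1" for u
    proof -
      interpret u: valued_field K u by fact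
      have l: "(\<lambda>n. u (?q n - 1)) \<longlonglongrightarrow> 0" by (rule u.v_quotient_gt[OF y(1) that(2)])
      have "(\<lambda>n. u (?q n) - 1) \<longlonglongrightarrow> 0"
      proof (rule Lim_null_comparison[OF _ l])
        have "\<bar>u (?q n) - 1\<bar> \<le> u (?q n - 1)" for n
          using u.v_1 u.v_diff_ge[OF q, of 1 n] u.closed by simp
        thus "\<forall>\<^sub>F n in sequentially. norm (u (?q n) - 1) \<le> u (?q n - 1)" by simp
      qed
      from tendsto_add[OF this tendsto_const[of 1]] show ?thesis by simp
    qed
    have "\<forall>\<^sub>F n in sequentially. s (?q n * z) < 1" if "s \<in> S" for s
    proof -
      interpret s: valued_field K s by (rule insert.prems) (use that in simp)
      have "(\<lambda>n. s (?q n) * s z) \<longlonglongrightarrow> 0 * s z"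
        using y that by (intro tendsto_intros s.v_quotient_lt) auto
      from order_tendstoD(2)[OF this, of 1] show ?thesis
        using q z by (simp add: s.v_mult[OF q])
    qed
    hence "\<forall>\<^sub>F n in sequentially. \<forall>s\<in>S. s (?q n * z) < 1"
      using insert by (intro eventually_ball_finite) auto
    moreover have "\<forall>\<^sub>F n in sequentially. w (?q n * z) < 1"
    proof -
      have "(\<lambda>n. w (?q n) * w z) \<longlonglongrightarrow> 1 * w z"
        by (intro tendsto_intros one w.valued_field_axioms 3)
      from order_tendstoD(2)[OF this, of 1] show ?thesis
        using q z by (simp add: w.v_mult[OF q])
    qed
    moreover have "\<forall>\<^sub>F n in sequentially. v (?q n * z) > 1"
    proof -
      have "(\<lambda>n. v (?q n) * v z) \<longlonglongrightarrow> 1 * v z"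
        by (intro tendsto_intros one v.valued_field_axioms y)
      from order_tendstoD(1)[OF this, of 1] show ?thesis
        using q z by (simp add: v.v_mult[OF q])
    qed
    ultimately have "\<forall>\<^sub>F n in sequentially. v (?q n * z) > 1 \<and> w (?q n * z) < 1 \<and> (\<forall>s\<in>S. s (?q n * z) < 1)"
      by eventually_elim auto
    then obtain n where "v (?q n * z) > 1 \<and> w (?q n * z) < 1 \<and> (\<forall>s\<in>S. s (?q n * z) < 1)"
      by (auto simp: eventually_sequentially)
    thus ?thesis using v.mult_closed[OF q z(1)] by (intro bexI[of _ "?q n * z"]) auto
  qed
qed

text \<open>For a separating \<open>y\<close>, the quotients
  \<open>y ^ n * inverse (1 + y ^ n)\<close> tend to 1 for \<open>v\<close> and to 0 for all members
  of \<open>S\<close>.\<close>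

lemma weak_approximation:
  assumes v: "valued_field K v" and fin: "finite S" and S: "\<And>w. w \<in> S \<Longrightarrow> valued_field K w"
    and rat: "\<And>w q. w \<in> S \<Longrightarrow> v (of_rat q) = w (of_rat q)" and \<rho>: "v (of_rat \<rho>) > 1"
    and distinct: "\<And>w. w \<in> S \<Longrightarrow> \<exists>x\<in>K. v x \<noteq> w x" and \<epsilon>: "\<epsilon> > 0"
  shows "\<exists>y\<in>K. v (y - 1) < \<epsilon> \<and> (\<forall>w\<in>S. w y < \<epsilon>)"
proof -
  interpret v: valued_field K v by fact
  have "\<exists>y\<in>K. v y > 1 \<and> (\<forall>w\<in>S. w y < 1)"
    by (rule weak_approximation_separate[where \<rho> = \<rho>]) (fact v fin S rat \<rho> distinct)+
  then obtain y where y: "y \<in> K" "v y > 1" "\<And>w. w \<in> S \<Longrightarrow> w y < 1" by blast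
  let ?q = "\<lambda>n. y ^ n * inverse (1 + y ^ n)"
  have "\<forall>\<^sub>F n in sequentially. v (?q n - 1) < \<epsilon>"
    using order_tendstoD(2)[OF v.v_quotient_gt(1)[OF y(1,2)] \<epsilon>] .
  moreover have "\<forall>\<^sub>F n in sequentially. w (?q n) < \<epsilon>" if "w \<in> S" for w
    using order_tendstoD(2)[OF valued_field.v_quotient_lt[OF S[OF that] y(1) y(3)[OF that]] \<epsilon>] .
  hence "\<forall>\<^sub>F n in sequentially. \<forall>w\<in>S. w (?q n) < \<epsilon>"
    using fin by (intro eventually_ball_finite) auto
  ultimately have "\<forall>\<^sub>F n in sequentially. v (?q n - 1) < \<epsilon> \<and> (\<forall>w\<in>S. w (?q n) < \<epsilon>)"
    by eventually_elim auto
  then obtain n where "v (?q n - 1) < \<epsilon> \<and> (\<forall>w\<in>S. w (?q n) < \<epsilon>)"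
    by (auto simp: eventually_sequentially)
  moreover have "?q n \<in> K" by (intro v.closed y)
  ultimately show ?thesis by blast
qed

section \<open>Simple extensions of \<open>\<rat>\<close>\<close>


definition ev :: "rat poly \<Rightarrow> complex \<Rightarrow> complex" where
  "ev p x = poly (map_poly of_rat p) x"

lemma ev_pCons [simp]: "ev (pCons a p) x = of_rat a + x * ev p x"
  by (cases "a = 0 \<and> p = 0") (auto simp: ev_def map_poly_pCons)

lemma ev_0 [simp]: "ev 0 x = 0"
  by (simp add: ev_def)

lemma ev_1 [simp]: "ev 1 x = 1"
  by (simp add: one_pCons)

lemma ev_add [simp]: "ev (p + q) x = ev p x + ev q x"
  by (induction p q rule: poly_induct2) (auto simp: algebra_simps of_rat_add)

lemma ev_smult [simp]: "ev (smult c p) x = of_rat c * ev p x"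
  by (induction p) (auto simp: algebra_simps of_rat_mult)

lemma ev_mult [simp]: "ev (p * q) x = ev p x * ev q x"
  by (induction p) (auto simp: algebra_simps)

lemma ev_minus [simp]: "ev (- p) x = - ev p x"
  using ev_smult[of "-1" p x] by (simp add: of_rat_minus)

lemma ev_diff [simp]: "ev (p - q) x = ev p x - ev q x"
  using ev_add[of p "- q" x] by simp

lemma ev_power [simp]: "ev (p ^ n) x = ev p x ^ n"
  by (induction n) auto

lemma ev_sum [simp]: "ev (\<Sum>i\<in>A. f i) x = (\<Sum>i\<in>A. ev (f i) x)"
  by (induction A rule: infinite_finite_induct) auto

lemma ev_pcompose [simp]: "ev (p \<circ>\<^sub>p q) x = ev p (ev q x)"
  by (induction p) (auto simp: pcompose_pCons)

lemma ev_altdef: "ev p x = (\<Sum>i\<le>degree p. of_rat (coeff p i) * x ^ i)"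
  by (simp add: ev_def poly_altdef degree_map_poly coeff_map_poly)

lemma algebraic_ev: "algebraic x \<Longrightarrow> algebraic (ev p x)"
  unfolding ev_altdef by (intro algebraic_sum algebraic_plus_mult algebraic_power) auto

lemma algebraic_if_ev_eq_0: "p \<noteq> 0 \<Longrightarrow> ev p x = 0 \<Longrightarrow> algebraic x"
  by (rule algebraicI'[of "map_poly of_rat p"]) (auto simp: ev_def coeff_map_poly map_poly_eq_0_iff)

text \<open>The minimal polynomial up to a non-zero rational factor, in the form in which
  \<open>totally_real\<close> quantifies over it.\<close>

definition is_minpoly :: "rat poly \<Rightarrow> complex \<Rightarrow> bool" where
  "is_minpoly f x \<longleftrightarrow> irreducible f \<and> ev f x = 0"

lemma minpoly_exists:
  assumes "algebraic x"
  obtains f where "is_minpoly f x"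
proof -
  obtain q where "q \<noteq> 0" "poly (map_poly of_int q) x = 0"
    using algebraicE'[OF assms] by blast
  hence "\<exists>p. p \<noteq> 0 \<and> ev p x = 0"
    by (intro exI[of _ "map_poly of_int q"])
       (auto simp: ev_def map_poly_map_poly o_def map_poly_eq_0_iff)
  then obtain p0 where p0: "p0 \<noteq> 0 \<and> ev p0 x = 0" by blast
  have "\<exists>f. (f \<noteq> 0 \<and> ev f x = 0) \<and> (\<forall>p. (p \<noteq> 0 \<and> ev p x = 0) \<longrightarrow> degree f \<le> degree p)"
    by (rule ex_has_least_nat[where P = "\<lambda>p. p \<noteq> 0 \<and> ev p x = 0", OF p0])
  then obtain f where f: "f \<noteq> 0" "ev f x = 0"
    and min: "\<And>p. p \<noteq> 0 \<Longrightarrow> ev p x = 0 \<Longrightarrow> degree f \<le> degree p" by auto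
  have "irreducible f"
  proof (rule irreducibleI)
    show "f \<noteq> 0" by (rule f)
    show "\<not> f dvd 1"
    proof
      assume "f dvd 1"
      then obtain g where "1 = f * g" by (elim dvdE)
      from arg_cong[OF this, of "\<lambda>p. ev p x"] show False using f by simp
    qed
    fix a b assume ab: "f = a * b"
    hence nz: "a \<noteq> 0" "b \<noteq> 0" using f by auto
    have "degree f = degree a + degree b" using ab nz by (simp add: degree_mult_eq)
    moreover have "ev a x = 0 \<or> ev b x = 0" using f ab by simp
    hence "degree f \<le> degree a \<or> degree f \<le> degree b" using min nz by blast
    ultimately have "degree b = 0 \<or> degree a = 0" by auto
    thus "a dvd 1 \<or> b dvd 1" using nz by (auto simp: is_unit_iff_degree)
  qed
  thus ?thesis using that f by (auto simp: is_minpoly_def)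
qed

lemma irreducible_bezout:
  fixes f p :: "rat poly"
  assumes "irreducible f" "\<not> f dvd p"
  obtains a b where "a * f + b * p = 1"
proof -
  have "coprime f p"
    using assms by (intro prime_elem_imp_coprime irreducible_imp_prime_elem)
  thus ?thesis using that bezout_coefficients_fst_snd[of f p] by (metis coprime_imp_gcd_eq_1)
qed

context
  fixes f :: "rat poly" and \<alpha> :: complex
  assumes f: "is_minpoly f \<alpha>"
begin

lemma minpoly_nz: "f \<noteq> 0" and minpoly_root: "ev f \<alpha> = 0" and minpoly_irreducible: "irreducible f"
  using f by (auto simp: is_minpoly_def)

lemma minpoly_dvd_iff: "ev p \<alpha> = 0 \<longleftrightarrow> f dvd p"
proof
  assume p: "ev p \<alpha> = 0"
  show "f dvd p"
  proof (rule ccontr)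
    assume "\<not> f dvd p"
    then obtain a b where "a * f + b * p = 1" using irreducible_bezout[OF minpoly_irreducible] by blast
    from arg_cong[OF this, of "\<lambda>p. ev p \<alpha>"] show False using p minpoly_root by simp
  qed
qed (auto simp: minpoly_root)

lemma minpoly_degree_pos: "degree f > 0"
proof (rule ccontr)
  assume "\<not> degree f > 0"
  then obtain c where c: "f = [:c:]" by (metis degree_eq_zeroE not_gr0)
  thus False using minpoly_nz minpoly_root by simp
qed

text \<open>The difference of the two polynomials is divisible by \<open>f\<close>. This makes the
  embedding sending \<alpha> to \<beta> well defined on the values
  \<open>ev p \<alpha>\<close>.\<close>

lemma ev_eq_conjugate: "ev f \<beta> = 0 \<Longrightarrow> ev p \<alpha> = ev q \<alpha> \<Longrightarrow> ev p \<beta> = ev q \<beta>"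
proof -
  assume \<beta>: "ev f \<beta> = 0" and eq: "ev p \<alpha> = ev q \<alpha>"
  have "f dvd p - q" using eq minpoly_dvd_iff[of "p - q"] by simp
  then obtain g where "p - q = f * g" by (elim dvdE)
  from arg_cong[OF this, of "\<lambda>p. ev p \<beta>"] \<beta> show "ev p \<beta> = ev q \<beta>" by simp
qed

text \<open>A Bezout coefficient of \<open>p\<close> modulo \<open>f\<close> serves as the inverse
  at all roots of \<open>f\<close> at once, so inversion is compatible with conjugation.\<close>

lemma minpoly_inverse:
  assumes "ev p \<alpha> \<noteq> 0"
  obtains q where "ev q \<alpha> = inverse (ev p \<alpha>)" "\<And>\<beta>. ev f \<beta> = 0 \<Longrightarrow> ev q \<beta> = inverse (ev p \<beta>) \<and> ev p \<beta> \<noteq> 0"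
proof -
  have "\<not> f dvd p" using assms minpoly_root by (auto elim!: dvdE)
  then obtain a b where ab: "a * f + b * p = 1" using irreducible_bezout[OF minpoly_irreducible] by blast
  have *: "ev b \<beta> = inverse (ev p \<beta>) \<and> ev p \<beta> \<noteq> 0" if "ev f \<beta> = 0" for \<beta>
  proof -
    from arg_cong[OF ab, of "\<lambda>p. ev p \<beta>"] that have "ev b \<beta> * ev p \<beta> = 1" by simp
    thus ?thesis by (metis inverse_unique mult.commute mult_zero_right zero_neq_one)
  qed
  show ?thesis using that[of b] * minpoly_root by blast
qed

text \<open>In characteristic 0 an irreducible \<open>f\<close> is coprime to its derivative, so its
  roots are simple.\<close>

lemma minpoly_roots:
  "finite {z. ev f z = 0}" "card {z. ev f z = 0} = degree f"
  "proots (map_poly of_rat f) = mset_set {z. ev f z = 0}"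
proof -
  let ?F = "map_poly of_rat f :: complex poly"
  have F: "?F \<noteq> 0" using minpoly_nz by (simp add: map_poly_eq_0_iff)
  have set: "set_mset (proots ?F) = {z. ev f z = 0}" using F by (simp add: ev_def)
  show fin: "finite {z. ev f z = 0}" unfolding set[symmetric] by simp
  have "pderiv f \<noteq> 0" using minpoly_degree_pos by (simp add: pderiv_eq_0_iff)
  hence "\<not> f dvd pderiv f"
    using minpoly_degree_pos by (auto dest!: dvd_imp_degree_le simp: degree_pderiv)
  then obtain a b where ab: "a * f + b * pderiv f = 1"
    using irreducible_bezout[OF minpoly_irreducible] by blast
  have pd: "pderiv ?F = map_poly of_rat (pderiv f)"
    by (rule poly_eqI) (simp add: coeff_pderiv coeff_map_poly of_rat_mult of_rat_add)
  have "count (proots ?F) z \<le> 1" for z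
  proof (cases "ev f z = 0")
    case True
    have "ev (pderiv f) z \<noteq> 0" using arg_cong[OF ab, of "\<lambda>p. ev p z"] True by auto
    hence "poly (pderiv ?F) z \<noteq> 0" by (simp add: pd ev_def)
    moreover have "order z ?F \<noteq> 0" using True F by (simp add: ev_def order_root)
    ultimately have "order z ?F = 1"
      using order_pderiv[OF F, of z] True order_root[of "pderiv ?F" z] by (auto simp: ev_def)
    thus ?thesis using F by simp
  qed (use F in \<open>simp add: ev_def order_root\<close>)
  moreover have "count (proots ?F) z > 0 \<longleftrightarrow> ev f z = 0" for z
    using set by (simp add: set_eq_iff flip: count_greater_zero_iff)
  ultimately have "count (proots ?F) z = count (mset_set {z. ev f z = 0}) z" for z
    using fin by (cases "ev f z = 0") (auto simp: count_mset_set' intro!: antisym)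
  thus eq: "proots ?F = mset_set {z. ev f z = 0}" by (rule multiset_eqI)
  have "degree f = size (proots ?F)" by (simp add: size_proots_complex degree_map_poly)
  thus "card {z. ev f z = 0} = degree f" by (simp add: eq)
qed

lemma ev_reduce:
  obtains q where "degree q < degree f" "ev q \<alpha> = ev p \<alpha>"
proof -
  have "ev (p div f * f + p mod f) \<alpha> = ev (p mod f) \<alpha>"
    by (simp only: ev_add ev_mult minpoly_root) simp
  hence "ev (p mod f) \<alpha> = ev p \<alpha>" by simp
  moreover have "degree (p mod f) < degree f"
    using degree_mod_less[of f p] minpoly_nz minpoly_degree_pos by auto
  ultimately show ?thesis using that by blast
qed

interpretation C: field complex_ring
  by (rule field_from_type_algebra)

lemma complex_ring_simps:
  "carrier complex_ring = UNIV" "\<one>\<^bsub>complex_ring\<^esub> = 1" "\<zero>\<^bsub>complex_ring\<^esub> = 0"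
  "x \<otimes>\<^bsub>complex_ring\<^esub> y = x * y" "x \<oplus>\<^bsub>complex_ring\<^esub> y = x + y"
  by (simp_all add: ring_of_type_algebra_def)

lemma complex_ring_uminus: "\<ominus>\<^bsub>complex_ring\<^esub> x = - x"
  by (rule C.minus_equality) (auto simp: complex_ring_simps)

lemma complex_ring_inv: "x \<noteq> 0 \<Longrightarrow> inv\<^bsub>complex_ring\<^esub> x = inverse x"
  by (rule C.comm_inv_char) (auto simp: complex_ring_simps)

lemma adjoin_rat_eq: "adjoin_rat \<alpha> = {ev p \<alpha> | p. True}"
proof (intro equalityI subsetI)
  fix x assume "x \<in> adjoin_rat \<alpha>"
  hence "x \<in> generate_field complex_ring {\<alpha>}" by (simp add: adjoin_rat_def)
  thus "x \<in> {ev p \<alpha> | p. True}"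
  proof (induction rule: generate_field.induct)
    case one
    show ?case by (auto simp: complex_ring_simps intro!: exI[of _ 1])
  next
    case (incl h)
    thus ?case by (auto intro!: exI[of _ "[:0, 1:]"])
  next
    case (a_inv h)
    then obtain p where "h = ev p \<alpha>" by auto
    thus ?case by (auto simp: complex_ring_uminus intro!: exI[of _ "- p"])
  next
    case (m_inv h)
    then obtain p where p: "h = ev p \<alpha>" by auto
    hence "ev p \<alpha> \<noteq> 0" using m_inv by (simp add: complex_ring_simps)
    from minpoly_inverse[OF this] obtain q where "ev q \<alpha> = inverse (ev p \<alpha>)" by blast
    thus ?case using p m_inv by (auto simp: complex_ring_inv complex_ring_simps intro!: exI[of _ q])
  next
    case (eng_add g h)
    then obtain p q where "g = ev p \<alpha>" "h = ev q \<alpha>" by auto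
    thus ?case by (auto simp: complex_ring_simps intro!: exI[of _ "p + q"])
  next
    case (eng_mult g h)
    then obtain p q where "g = ev p \<alpha>" "h = ev q \<alpha>" by auto
    thus ?case by (auto simp: complex_ring_simps intro!: exI[of _ "p * q"])
  qed
next
  let ?G = "generate_field complex_ring {\<alpha>}"
  have 0: "0 \<in> ?G" using C.zero_in_generate[of "{\<alpha>}"] by (simp add: complex_ring_simps)
  have 1: "1 \<in> ?G" using generate_field.one[of complex_ring "{\<alpha>}"] by (simp add: complex_ring_simps)
  have add: "x + y \<in> ?G" if "x \<in> ?G" "y \<in> ?G" for x y
    using generate_field.eng_add[OF that] by (simp add: complex_ring_simps)
  have mult: "x * y \<in> ?G" if "x \<in> ?G" "y \<in> ?G" for x y
    using generate_field.eng_mult[OF that] by (simp add: complex_ring_simps)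
  have neg: "- x \<in> ?G" if "x \<in> ?G" for x
    using generate_field.a_inv[OF that] by (simp add: complex_ring_uminus)
  have inv: "inverse x \<in> ?G" if "x \<in> ?G" for x
    using generate_field.m_inv[OF that] 0 by (cases "x = 0") (auto simp: complex_ring_simps complex_ring_inv)
  have nat: "of_nat n \<in> ?G" for n by (induction n) (auto intro: 0 1 add)
  have int: "of_int n \<in> ?G" for n by (cases n rule: int_cases2) (auto intro: nat neg)
  have rat: "of_rat q \<in> ?G" for q
  proof -
    obtain a b where "q = of_int a / of_int b" by (metis quotient_of_div prod.exhaust)
    hence "of_rat q = (of_int a * inverse (of_int b) :: complex)" by (simp add: of_rat_divide field_simps)
    thus ?thesis using mult int inv by simp
  qed
  fix x assume "x \<in> {ev p \<alpha> | p. True}"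
  then obtain p where x: "x = ev p \<alpha>" by auto
  have \<alpha>: "\<alpha> \<in> ?G" by (rule generate_field.incl) simp
  have "ev p \<alpha> \<in> ?G"
    by (induction p) (auto intro!: 0 add mult rat \<alpha>)
  thus "x \<in> adjoin_rat \<alpha>" by (simp add: x adjoin_rat_def)
qed

lemma Rats_subfield: "subfield \<rat> complex_ring"
proof (rule C.subfieldI')
  show "subring \<rat> complex_ring"
    by (rule C.subringI) (auto simp: complex_ring_simps complex_ring_uminus)
qed (auto simp: complex_ring_simps complex_ring_inv)

lemma complex_combine:
  "length Ks = length Us \<Longrightarrow> C.combine Ks Us = (\<Sum>i<length Us. Ks ! i * Us ! i)"
proof (induction Ks Us rule: list_induct2)
  case (Cons k Ks u Us)
  have "(\<Sum>i<length (u # Us). (k # Ks) ! i * (u # Us) ! i) = k * u + (\<Sum>i<length Us. Ks ! i * Us ! i)"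
    by (simp only: length_Cons sum.lessThan_Suc_shift nth_Cons_0 nth_Cons_Suc)
  thus ?case using Cons by (simp add: complex_ring_simps)
qed (simp add: complex_ring_simps)

lemma adjoin_rat_span:
  assumes "x \<in> adjoin_rat \<alpha>"
  obtains c :: "nat \<Rightarrow> rat" where "x = (\<Sum>i<degree f. of_rat (c i) * \<alpha> ^ i)"
proof -
  obtain p where "x = ev p \<alpha>" using assms by (auto simp: adjoin_rat_eq)
  then obtain q where q: "degree q < degree f" "ev q \<alpha> = x" by (metis ev_reduce)
  have "x = (\<Sum>i\<le>degree q. of_rat (coeff q i) * \<alpha> ^ i)" by (simp add: q(2)[symmetric] ev_altdef)
  also have "\<dots> = (\<Sum>i<degree f. of_rat (coeff q i) * \<alpha> ^ i)"
    using q(1) by (intro sum.mono_neutral_left) (auto simp: not_le coeff_eq_0)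
  finally show ?thesis by (rule that)
qed

lemma dim_adjoin_rat: "ring.dim complex_ring \<rat> (adjoin_rat \<alpha>) = degree f"
proof -
  define Us where "Us = map (\<lambda>i. \<alpha> ^ i) [0..<degree f]"
  have Us: "length Us = degree f" "\<And>i. i < degree f \<Longrightarrow> Us ! i = \<alpha> ^ i" "set Us \<subseteq> carrier complex_ring"
    by (auto simp: Us_def complex_ring_simps)
  have comb: "C.combine Ks Us = (\<Sum>i<degree f. Ks ! i * \<alpha> ^ i)" if "length Ks = length Us" for Ks
    using complex_combine[OF that] Us by simp
  have "C.independent \<rat> Us"
  proof (rule ccontr)
    assume "\<not> C.independent \<rat> Us"
    then obtain Ks where Ks: "length Ks = length Us" "C.combine Ks Us = 0" "set Ks \<subseteq> \<rat>" "set Ks \<noteq> {0}"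
      using C.dependent_imp_non_trivial_combine[OF Rats_subfield Us(3)] by (auto simp: complex_ring_simps)
    define c where "c = (\<lambda>i. SOME q. Ks ! i = of_rat q)"
    have c: "Ks ! i = of_rat (c i)" if i: "i < degree f" for i
    proof -
      have "Ks ! i \<in> \<rat>" using i Ks(1,3) Us(1) nth_mem[of i Ks] by auto
      then obtain q where "Ks ! i = of_rat q" by (elim Rats_cases)
      thus ?thesis unfolding c_def by (rule someI)
    qed
    define p where "p = (\<Sum>i<degree f. monom (c i) i)"
    have cp: "coeff p i = (if i < degree f then c i else 0)" for i
      by (simp add: p_def coeff_sum)
    have "ev (monom a i) \<alpha> = of_rat a * \<alpha> ^ i" for a i
      by (induction i) (auto simp: monom_0 monom_Suc)
    hence "ev p \<alpha> = (\<Sum>i<degree f. of_rat (c i) * \<alpha> ^ i)" by (simp add: p_def)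
    also have "\<dots> = 0" using Ks(2) c by (simp add: comb[OF Ks(1)])
    finally have "f dvd p" by (simp add: minpoly_dvd_iff)
    moreover have "p = 0 \<or> degree p < degree f"
      using minpoly_degree_pos cp by (metis (full_types) leading_coeff_0_iff not_less)
    ultimately have "p = 0" by (auto dest: dvd_imp_degree_le)
    hence "c i = 0" if "i < degree f" for i using cp[of i] that by simp
    hence "Ks ! i = 0" if "i < degree f" for i using c that by simp
    hence "set Ks \<subseteq> {0}" using Ks(1) Us(1) by (auto simp: set_conv_nth)
    moreover have "set Ks \<noteq> {}" using Ks(1) Us(1) minpoly_degree_pos by auto
    ultimately show False using Ks(4) subset_singletonD by metis
  qed
  moreover have "C.Span \<rat> Us = adjoin_rat \<alpha>"
  proof (intro equalityI subsetI)
    fix x assume "x \<in> C.Span \<rat> Us"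
    then obtain Ks where Ks: "set Ks \<subseteq> \<rat>" "length Ks = length Us" "x = C.combine Ks Us"
      unfolding C.Span_mem_iff_length_version[OF Rats_subfield Us(3)] by blast
    have x: "x = (\<Sum>i<degree f. Ks ! i * \<alpha> ^ i)" using Ks comb by simp
    have "Ks ! i * \<alpha> ^ i \<in> {ev p \<alpha> | p. True}" if "i < degree f" for i
    proof -
      have "Ks ! i \<in> \<rat>" using that Ks Us(1) nth_mem[of i Ks] by auto
      then obtain q where "Ks ! i = of_rat q" by (elim Rats_cases)
      thus ?thesis by (auto intro!: exI[of _ "[:q:] * [:0, 1:] ^ i"])
    qed
    hence "\<forall>i\<in>{..<degree f}. \<exists>p. Ks ! i * \<alpha> ^ i = ev p \<alpha>" by blast
    from bchoice[OF this] obtain p where "\<And>i. i < degree f \<Longrightarrow> Ks ! i * \<alpha> ^ i = ev (p i) \<alpha>" by auto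
    hence "x = ev (\<Sum>i<degree f. p i) \<alpha>" by (simp add: x)
    thus "x \<in> adjoin_rat \<alpha>" unfolding adjoin_rat_eq by blast
  next
    fix x assume "x \<in> adjoin_rat \<alpha>"
    then obtain c :: "nat \<Rightarrow> rat" where c: "x = (\<Sum>i<degree f. of_rat (c i) * \<alpha> ^ i)"
      by (rule adjoin_rat_span)
    let ?Ks = "map (\<lambda>i. of_rat (c i) :: complex) [0..<degree f]"
    have "x = C.combine ?Ks Us" using c Us(1) by (subst comb) auto
    thus "x \<in> C.Span \<rat> Us"
      unfolding C.Span_mem_iff_length_version[OF Rats_subfield Us(3)]
      using Us(1) by (intro exI[of _ ?Ks]) auto
  qed
  ultimately have "C.dimension (degree f) \<rat> (adjoin_rat \<alpha>)"
    using C.dimension_independent[of \<rat> Us] Us by simp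
  from C.dimI[OF Rats_subfield this] show ?thesis by (simp add: over_def)
qed

lemma valued_field_adjoin_rat:
  assumes "absolute_value_on (adjoin_rat \<alpha>) v"
  shows "valued_field (adjoin_rat \<alpha>) v"
proof
  show "\<rat> \<subseteq> adjoin_rat \<alpha>"
  proof
    fix x :: complex assume "x \<in> \<rat>"
    then obtain q where "x = of_rat q" by (elim Rats_cases)
    thus "x \<in> adjoin_rat \<alpha>" by (auto simp: adjoin_rat_eq intro!: exI[of _ "[:q:]"])
  qed
  fix x y assume "x \<in> adjoin_rat \<alpha>" "y \<in> adjoin_rat \<alpha>"
  then obtain p q where "x = ev p \<alpha>" "y = ev q \<alpha>" by (auto simp: adjoin_rat_eq)
  hence "x + y = ev (p + q) \<alpha>" "x * y = ev (p * q) \<alpha>" by simp_all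
  thus "x + y \<in> adjoin_rat \<alpha>" "x * y \<in> adjoin_rat \<alpha>" unfolding adjoin_rat_eq by blast+
next
  fix x assume "x \<in> adjoin_rat \<alpha>"
  then obtain p where p: "x = ev p \<alpha>" by (auto simp: adjoin_rat_eq)
  show "inverse x \<in> adjoin_rat \<alpha>"
  proof (cases "ev p \<alpha> = 0")
    case True
    thus ?thesis using p by (auto simp: adjoin_rat_eq intro!: exI[of _ 0])
  next
    case False
    from minpoly_inverse[OF this] obtain q where "ev q \<alpha> = inverse (ev p \<alpha>)" by blast
    thus ?thesis using p by (auto simp: adjoin_rat_eq intro!: exI[of _ q])
  qed
qed fact

end

section \<open>Places and heights\<close>


lemma padic_abs_of_int:
  "padic_abs p (of_int n) = (if n = 0 then 0 else real p powi (- int (multiplicity (int p) n)))"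
  by (simp add: padic_abs_def)

lemma padic_abs_of_int_le:
  assumes "prime p"
  shows "padic_abs p (of_int n) \<le> 1"
proof -
  have "1 \<le> real p ^ multiplicity (int p) n"
    using prime_gt_1_nat[OF assms] by (intro one_le_power) simp
  thus ?thesis by (simp add: padic_abs_of_int power_int_minus inverse_le_1_iff)
qed

lemma padic_abs_unit: "\<not> int p dvd n \<Longrightarrow> padic_abs p (of_int n) = 1"
  by (auto simp: padic_abs_of_int not_dvd_imp_multiplicity_0)

lemma padic_abs_self:
  assumes "prime p"
  shows "padic_abs p (of_nat p) = 1 / p"
  using padic_abs_of_int[of p "int p"] assms prime_gt_1_nat[OF assms]
  by (simp add: power_int_minus divide_inverse)

lemma padic_abs_inverse_self:
  assumes "prime p"
  shows "padic_abs p (1 / of_nat p) = p"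
proof -
  have "quotient_of (1 / of_nat p) = (1, int p)"
    using prime_gt_0_nat[OF assms] quotient_of_Fract[of 1 "int p"]
    by (auto simp: Fract_of_int_quotient normalize_def)
  thus ?thesis using assms prime_gt_0_nat[OF assms] by (simp add: padic_abs_def)
qed

text \<open>The place at infinity is indexed by \<open>0\<close>, the other places of \<open>\<rat>\<close> by their primes.\<close>

definition rat_abs :: "nat \<Rightarrow> rat \<Rightarrow> real" where
  "rat_abs i q = (if i = 0 then \<bar>of_rat q\<bar> else padic_abs i q)"

lemma rat_abs_gt_1:
  assumes "i = 0 \<or> prime i"
  shows "\<exists>\<rho>. rat_abs i \<rho> > 1"
proof (cases "i = 0")
  case True
  thus ?thesis by (intro exI[of _ 2]) (simp add: rat_abs_def)
next
  case False
  thus ?thesis using assms padic_abs_inverse_self[of i] prime_gt_1_nat[of i]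
    by (intro exI[of _ "1 / of_nat i"]) (simp add: rat_abs_def)
qed

text \<open>A prime \<open>j\<close> is the test element: it has absolute value below 1 at the place
  \<open>j\<close> and at least 1 at all others.\<close>

lemma rat_abs_inj:
  assumes "i = 0 \<or> prime i" "j = 0 \<or> prime j" "rat_abs i = rat_abs j"
  shows "i = j"
proof (rule ccontr)
  have aux: False if "i = 0 \<or> prime i" "prime j" "i \<noteq> j" "rat_abs i = rat_abs j" for i j
  proof -
    have "rat_abs j (of_nat j) < 1"
      using that(2) prime_gt_1_nat[OF that(2)] by (simp add: rat_abs_def padic_abs_self)
    moreover have "rat_abs i (of_nat j) \<ge> 1"
    proof (cases "i = 0")
      case True
      thus ?thesis using prime_gt_1_nat[OF that(2)] by (simp add: rat_abs_def)
    next
      case False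
      hence "\<not> i dvd j" using that primes_dvd_imp_eq by blast
      hence "\<not> int i dvd int j" by simp
      from padic_abs_unit[OF this] show ?thesis using False by (simp add: rat_abs_def)
    qed
    ultimately show False using that(4) by simp
  qed
  assume "i \<noteq> j"
  thus False using assms aux[of i j] aux[of j i] by metis
qed

lemma places_iff:
  "v \<in> places K \<longleftrightarrow> v \<in> extensional K \<and> absolute_value_on K v \<and>
     (\<exists>i. (i = 0 \<or> prime i) \<and> (\<forall>q. v (of_rat q) = rat_abs i q))"
proof -
  have 1: "(\<forall>q. v (of_rat q) = rat_abs 0 q) \<longleftrightarrow> (\<forall>q. v (of_rat q) = \<bar>of_rat q\<bar>)"
    by (simp add: rat_abs_def)
  have 2: "(\<forall>q. v (of_rat q) = rat_abs p q) \<longleftrightarrow> (\<forall>q. v (of_rat q) = padic_abs p q)" if "prime p" for p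
    using prime_gt_0_nat[OF that] by (simp add: rat_abs_def)
  show ?thesis unfolding places_def using 1 2 by blast
qed

section \<open>Places of a simple extension, and the height bounded by sums over conjugates\<close>

context
  fixes f :: "rat poly" and \<alpha> :: complex
  assumes f: "is_minpoly f \<alpha>"
begin

abbreviation "K\<alpha> \<equiv> adjoin_rat \<alpha>"

lemma valued_field_places: "v \<in> places K\<alpha> \<Longrightarrow> valued_field K\<alpha> v"
  using valued_field_adjoin_rat[OF f] by (simp add: places_iff)

lemma mem_adjoin_rat: "\<alpha> \<in> K\<alpha>"
  by (auto simp: adjoin_rat_eq[OF f] intro!: exI[of _ "[:0, 1:]"])

text \<open>
  By weak approximation there are elements of \<open>K\<close> that are close to the standard basis vectors with
  respect to finitely many given places, so the number of places is at most the degree.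
\<close>

lemma finite_places_over:
  assumes \<rho>: "u \<rho> > 1"
  shows "finite {v \<in> places K\<alpha>. \<forall>q. v (of_rat q) = u q}" (is "finite ?P")
proof (rule ccontr)
  assume "infinite ?P"
  from infinite_arbitrarily_large[OF this, of "Suc (degree f)"]
  obtain S where S': "S \<subseteq> ?P" and S: "finite S" "card S = Suc (degree f)" by (elim exE conjE)
  have pl: "v \<in> places K\<alpha>" and rat: "v (of_rat q) = u q" if "v \<in> S" for v q
    using subsetD[OF S' that] by auto
  have vf: "valued_field K\<alpha> v" if "v \<in> S" for v by (rule valued_field_places[OF pl[OF that]])
  \<comment> \<open>Chosen so that \<open>card S\<close> errors below \<epsilon> add up to less than
    1, which gives the final contradiction.\<close>
  define \<epsilon> where "\<epsilon> = 1 / (card S + 1 :: real)"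
  have \<epsilon>: "\<epsilon> > 0" by (simp add: \<epsilon>_def)
  have "\<forall>v\<in>S. \<exists>y\<in>K\<alpha>. v (y - 1) < \<epsilon> \<and> (\<forall>w\<in>S - {v}. w y < \<epsilon>)"
  proof
    fix v assume v: "v \<in> S"
    show "\<exists>y\<in>K\<alpha>. v (y - 1) < \<epsilon> \<and> (\<forall>w\<in>S - {v}. w y < \<epsilon>)"
    proof (rule weak_approximation[where \<rho> = \<rho>])
      fix w assume w: "w \<in> S - {v}"
      hence "w \<in> extensional K\<alpha>" "v \<in> extensional K\<alpha>" "v \<noteq> w"
        using v pl[of v] pl[of w] by (auto simp: places_iff)
      thus "\<exists>x\<in>K\<alpha>. v x \<noteq> w x" using extensionalityI[of v K\<alpha> w] by blast
    next
      show "v (of_rat q) = w (of_rat q)" if "w \<in> S - {v}" for w q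
        using rat[OF v, of q] rat[of w q] that by simp
      show "v (of_rat \<rho>) > 1" using rat[OF v, of \<rho>] \<rho> by simp
    qed (use v S(1) vf \<epsilon> in auto)
  qed
  from bchoice[OF this[unfolded Bex_def]] obtain e where e: "\<And>v. v \<in> S \<Longrightarrow> e v \<in> K\<alpha>" "\<And>v. v \<in> S \<Longrightarrow> v (e v - 1) < \<epsilon>"
    "\<And>v w. v \<in> S \<Longrightarrow> w \<in> S \<Longrightarrow> w \<noteq> v \<Longrightarrow> w (e v) < \<epsilon>" by auto
  have "\<forall>v\<in>S. \<exists>c :: nat \<Rightarrow> rat. e v = (\<Sum>i<degree f. of_rat (c i) * \<alpha> ^ i)"
    using e(1) adjoin_rat_span[OF f] by blast
  from bchoice[OF this] obtain c :: "(complex \<Rightarrow> real) \<Rightarrow> nat \<Rightarrow> rat"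
    where c: "\<And>v. v \<in> S \<Longrightarrow> e v = (\<Sum>i<degree f. of_rat (c v i) * \<alpha> ^ i)" by auto
  \<comment> \<open>\<open>card S\<close> exceeds the degree, so the elements \<open>e v\<close>
    satisfy a non-trivial rational relation. At the place \<open>v0\<close> with the largest
    coefficient, they are too close to the entries 0 and 1 of a standard basis vector for
    that.\<close>
  obtain \<mu> where \<mu>: "\<exists>v\<in>S. \<mu> v \<noteq> (0 :: rat)" "\<And>i. i < degree f \<Longrightarrow> (\<Sum>v\<in>S. \<mu> v * c v i) = 0"
    by (rule exists_kernel_vector[of UNIV S "degree f" c]) (use S in auto)
  have "(\<Sum>v\<in>S. of_rat (\<mu> v) * e v) = (\<Sum>v\<in>S. \<Sum>i<degree f. of_rat (\<mu> v * c v i) * \<alpha> ^ i)"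
    by (intro sum.cong refl) (simp add: c sum_distrib_left of_rat_mult mult_ac)
  also have "\<dots> = (\<Sum>i<degree f. of_rat (\<Sum>v\<in>S. \<mu> v * c v i) * \<alpha> ^ i)"
    by (subst sum.swap) (simp add: of_rat_sum sum_distrib_right)
  also have "\<dots> = 0" using \<mu>(2) by simp
  finally have zero: "(\<Sum>v\<in>S. of_rat (\<mu> v) * e v) = 0" .
  have "Max ((\<lambda>v. u (\<mu> v)) ` S) \<in> (\<lambda>v. u (\<mu> v)) ` S" using S by (intro Max_in) auto
  then obtain v0 where v0: "v0 \<in> S" "u (\<mu> v0) = Max ((\<lambda>v. u (\<mu> v)) ` S)" by auto
  have max: "u (\<mu> v) \<le> u (\<mu> v0)" if "v \<in> S" for v
    unfolding v0(2) using that S(1) by (intro Max_ge) auto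
  interpret v0: valued_field K\<alpha> v0 by (rule vf[OF v0(1)])
  obtain v1 where v1: "v1 \<in> S" "\<mu> v1 \<noteq> 0" using \<mu>(1) by blast
  have "u (\<mu> v1) > 0"
    using v0.v_nonneg[OF v0.of_rat_closed[of "\<mu> v1"]] v0.v_eq_0[OF v0.of_rat_closed[of "\<mu> v1"]] v1 rat[OF v0(1)]
    by (simp add: less_le)
  hence pos: "u (\<mu> v0) > 0" using max[OF v1(1)] by simp
  have "(\<Sum>v\<in>S. of_rat (\<mu> v) * ((if v = v0 then 1 else 0) - e v)) =
      (\<Sum>v\<in>S. (if v = v0 then of_rat (\<mu> v) else 0) - of_rat (\<mu> v) * e v)"
    by (intro sum.cong) (auto simp: algebra_simps)
  also have "\<dots> = of_rat (\<mu> v0)" using zero S(1) v0(1) by (simp add: sum_subtractf)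
  finally have "v0 (of_rat (\<mu> v0)) = v0 (\<Sum>v\<in>S. of_rat (\<mu> v) * ((if v = v0 then 1 else 0) - e v))"
    by (rule arg_cong[OF sym])
  also have "\<dots> \<le> (\<Sum>v\<in>S. v0 (of_rat (\<mu> v) * ((if v = v0 then 1 else 0) - e v)))"
    using e(1) by (intro v0.v_sum v0.closed) (auto intro: v0.closed)
  also have "\<dots> \<le> (\<Sum>v\<in>S. u (\<mu> v0) * \<epsilon>)"
  proof (rule sum_mono)
    fix v assume v: "v \<in> S"
    have K: "(if v = v0 then 1 else 0) - e v \<in> K\<alpha>" using v e(1) by (auto intro: v0.closed)
    have "v0 ((if v = v0 then 1 else 0) - e v) < \<epsilon>"
      using e(2)[OF v] e(3)[OF v v0(1)] v0.v_minus[OF K] v0.v_minus[OF e(1)[OF v]]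
      by (cases "v = v0") auto
    thus "v0 (of_rat (\<mu> v) * ((if v = v0 then 1 else 0) - e v)) \<le> u (\<mu> v0) * \<epsilon>"
      unfolding v0.v_mult[OF v0.of_rat_closed K] rat[OF v0(1)]
      using max[OF v] pos v0.v_nonneg[OF K] by (intro mult_mono) auto
  qed
  also have "\<dots> = u (\<mu> v0) * (card S / (card S + 1))" by (simp add: \<epsilon>_def)
  also have "\<dots> < u (\<mu> v0) * 1" using pos by (intro mult_strict_left_mono) auto
  finally show False using rat[OF v0(1)] by simp
qed

text \<open>If \<open>k * \<alpha>\<close> is an algebraic integer, \<alpha> can exceed 1 only at
  places over infinity or over primes dividing \<open>k\<close>, and each of these rational places
  has finitely many places above it. The sum that defines the height is therefore finite.\<close>

lemma finite_large_places: "finite {v \<in> places K\<alpha>. v \<alpha> > 1}"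
proof -
  have "algebraic \<alpha>" using f by (auto simp: is_minpoly_def intro: algebraic_if_ev_eq_0)
  then obtain k where k: "k \<noteq> 0" "algebraic_int (of_int k * \<alpha>)"
    by (rule algebraic_imp_int_multiple)
  define I where "I = insert 0 (prime_factors (nat \<bar>k\<bar>))"
  have I: "finite I" "\<And>i. i \<in> I \<Longrightarrow> i = 0 \<or> prime i" by (auto simp: I_def)
  have "{v \<in> places K\<alpha>. v \<alpha> > 1} \<subseteq> (\<Union>i\<in>I. {v \<in> places K\<alpha>. \<forall>q. v (of_rat q) = rat_abs i q})"
  proof
    fix v assume v: "v \<in> {v \<in> places K\<alpha>. v \<alpha> > 1}"
    then obtain i where i: "i = 0 \<or> prime i" "\<And>q. v (of_rat q) = rat_abs i q"
      by (auto simp: places_iff)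
    interpret v: valued_field K\<alpha> v using v valued_field_places by simp
    have "i \<in> I"
    proof (rule ccontr)
      assume ni: "i \<notin> I"
      hence "i \<noteq> 0" by (auto simp: I_def)
      hence p: "prime i" using i by simp
      have "\<not> i dvd nat \<bar>k\<bar>" using ni k p by (auto simp: I_def in_prime_factors_iff)
      hence nd: "\<not> int i dvd k" by simp
      have kK: "of_int k \<in> K\<alpha>" using v.of_rat_closed[of "of_int k"] by simp
      have vi: "v (of_int n) = padic_abs i (of_int n)" for n
        using i(2)[of "of_int n"] \<open>i \<noteq> 0\<close> by (simp add: rat_abs_def)
      have "v (of_int k * \<alpha>) \<le> 1"
      proof (rule v.v_le_one_if_algebraic_int)
        show "v (of_int n) \<le> 1" for n unfolding vi by (rule padic_abs_of_int_le[OF p])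
      qed (intro v.mult_closed kK mem_adjoin_rat k)+
      hence "v \<alpha> \<le> 1"
        by (simp add: v.v_mult[OF kK mem_adjoin_rat] vi padic_abs_unit[OF nd])
      thus False using v by simp
    qed
    thus "v \<in> (\<Union>i\<in>I. {v \<in> places K\<alpha>. \<forall>q. v (of_rat q) = rat_abs i q})" using v i by auto
  qed
  moreover have "finite (\<Union>i\<in>I. {v \<in> places K\<alpha>. \<forall>q. v (of_rat q) = rat_abs i q})"
    using I rat_abs_gt_1 finite_places_over by blast
  ultimately show ?thesis by (rule finite_subset)
qed

lemma local_degree_basis:
  assumes "v \<in> places K\<alpha>"
  obtains b where "valued_field.local_basis K\<alpha> v b (local_degree K\<alpha> v)"
proof -
  interpret v: valued_field K\<alpha> v by (rule valued_field_places[OF assms])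
  obtain b m where "v.local_basis b m"
  proof (rule v.local_basis_exists[of "degree f" "\<lambda>i. \<alpha> ^ i"])
    show "\<exists>c. x = (\<Sum>i<degree f. of_rat (c i) * \<alpha> ^ i)" if "x \<in> K\<alpha>" for x
      using adjoin_rat_span[OF f that] by metis
  qed (auto intro: v.closed mem_adjoin_rat)
  thus ?thesis using that v.local_degree_eq by blast
qed

lemma ln_weil_height:
  "ln (weil_height \<alpha>) = (\<Sum>\<^sub>\<infinity>v\<in>places K\<alpha>. real (local_degree K\<alpha> v) / degree f * ln (max 1 (v \<alpha>)))"
proof -
  have "ln (max 1 (normalized_abs K\<alpha> v \<alpha>)) = real (local_degree K\<alpha> v) / degree f * ln (max 1 (v \<alpha>))"
    if "v \<in> places K\<alpha>" for v
  proof -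
    interpret v: valued_field K\<alpha> v by (rule valued_field_places[OF that])
    define t where "t = real (local_degree K\<alpha> v) / degree f"
    have t: "t \<ge> 0" by (simp add: t_def)
    have nn: "v \<alpha> \<ge> 0" by (rule v.v_nonneg[OF mem_adjoin_rat])
    have "ln (max 1 (v \<alpha> powr t)) = t * ln (max 1 (v \<alpha>))"
    proof (cases "v \<alpha> \<le> 1")
      case True
      hence "v \<alpha> powr t \<le> 1" using nn t powr_mono2[of t "v \<alpha>" 1] by simp
      thus ?thesis using True by (simp add: max_def)
    next
      case False
      hence "v \<alpha> powr t \<ge> 1" using t by (intro ge_one_powr_ge_zero) auto
      thus ?thesis using False by (simp add: max_def ln_powr)
    qed
    thus ?thesis by (simp add: normalized_abs_def dim_adjoin_rat[OF f] t_def)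
  qed
  thus ?thesis unfolding weil_height_def weil_height_in_def ln_exp by (intro infsum_cong) simp
qed

text \<open>All terms are non-negative, so places that no pair \<open>(i, \<beta>)\<close> induces
  may be dropped, and each local degree may be replaced by the number of pairs that induce the
  place.\<close>

lemma height_lower_bound:
  assumes S: "finite S" "\<And>p. p \<in> S \<Longrightarrow> prime p"
    and w: "\<And>i. i \<in> insert 0 S \<Longrightarrow> absolute_value_on {x. algebraic x} (w i)"
    and w_rat: "\<And>i q. i \<in> insert 0 S \<Longrightarrow> w i (of_rat q) = rat_abs i q"
  shows "(\<Sum>i\<in>insert 0 S. \<Sum>\<beta> | ev f \<beta> = 0. ln (max 1 (w i \<beta>))) \<le> degree f * ln (weil_height \<alpha>)"
proof -
  let ?I = "insert 0 S"
  define Z where "Z = {\<beta>. ev f \<beta> = 0}"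
  have Z: "finite Z" using minpoly_roots[OF f] by (simp add: Z_def)
  have fnz: "f \<noteq> 0" and d0: "degree f > 0" using minpoly_nz[OF f] minpoly_degree_pos[OF f] by auto
  have algZ: "algebraic \<beta>" if "\<beta> \<in> Z" for \<beta>
    using that fnz by (auto simp: Z_def intro: algebraic_if_ev_eq_0)
  \<comment> \<open>The embedding that sends \<alpha> to \<beta>; the choice of the representing
    polynomial is immaterial by \<open>ev_eq_conjugate\<close>.\<close>
  define \<sigma> where "\<sigma> = (\<lambda>\<beta> x. ev (SOME p. ev p \<alpha> = x) \<beta>)"
  have \<sigma>: "\<sigma> \<beta> (ev p \<alpha>) = ev p \<beta>" if "\<beta> \<in> Z" for \<beta> p
  proof -
    have "ev (SOME q. ev q \<alpha> = ev p \<alpha>) \<alpha> = ev p \<alpha>" by (rule someI[of _ p]) simp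
    moreover have "ev f \<beta> = 0" using that by (simp add: Z_def)
    ultimately show ?thesis unfolding \<sigma>_def by (rule ev_eq_conjugate[OF f, rotated])
  qed
  have K_ev: "\<exists>p. x = ev p \<alpha>" if "x \<in> K\<alpha>" for x using that by (auto simp: adjoin_rat_eq[OF f])
  have ev_K: "ev p \<alpha> \<in> K\<alpha>" for p by (auto simp: adjoin_rat_eq[OF f])
  have \<sigma>_alg: "algebraic (\<sigma> \<beta> x)" if "\<beta> \<in> Z" "x \<in> K\<alpha>" for \<beta> x
    using K_ev[OF that(2)] \<sigma>[OF that(1)] algebraic_ev[OF algZ[OF that(1)]] by auto
  have \<sigma>_rat: "\<sigma> \<beta> (of_rat q) = of_rat q" if "\<beta> \<in> Z" for \<beta> q
    using \<sigma>[OF that, of "[:q:]"] by simp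
  have \<sigma>_add: "\<sigma> \<beta> (x + y) = \<sigma> \<beta> x + \<sigma> \<beta> y" and \<sigma>_mult: "\<sigma> \<beta> (x * y) = \<sigma> \<beta> x * \<sigma> \<beta> y"
    if \<beta>: "\<beta> \<in> Z" and xy: "x \<in> K\<alpha>" "y \<in> K\<alpha>" for \<beta> x y
  proof -
    obtain p q where "x = ev p \<alpha>" "y = ev q \<alpha>" using K_ev xy by meson
    thus "\<sigma> \<beta> (x + y) = \<sigma> \<beta> x + \<sigma> \<beta> y" "\<sigma> \<beta> (x * y) = \<sigma> \<beta> x * \<sigma> \<beta> y"
      using \<sigma>[OF \<beta>, of p] \<sigma>[OF \<beta>, of q] \<sigma>[OF \<beta>, of "p + q"] \<sigma>[OF \<beta>, of "p * q"] by simp_all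
  qed
  have \<sigma>_\<alpha>: "\<sigma> \<beta> \<alpha> = \<beta>" if "\<beta> \<in> Z" for \<beta> using \<sigma>[OF that, of "[:0, 1:]"] by simp
  have \<sigma>_0: "\<sigma> \<beta> x = 0 \<longleftrightarrow> x = 0" if \<beta>: "\<beta> \<in> Z" and x: "x \<in> K\<alpha>" for \<beta> x
  proof
    assume *: "\<sigma> \<beta> x = 0"
    show "x = 0"
    proof (rule ccontr)
      assume "x \<noteq> 0"
      obtain p where p: "x = ev p \<alpha>" using K_ev[OF x] by blast
      with \<open>x \<noteq> 0\<close> have "ev p \<alpha> \<noteq> 0" by simp
      from minpoly_inverse[OF f this] have "ev p \<beta> \<noteq> 0" using \<beta> unfolding Z_def by blast
      thus False using * p \<sigma>[OF \<beta>] by simp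
    qed
  qed (use \<sigma>_rat[OF \<beta>, of 0] in simp)
  \<comment> \<open>The restriction makes the function extensional, so that pairs inducing the same
    place yield equal functions.\<close>
  define pl where "pl = (\<lambda>(i, \<beta>). restrict (\<lambda>x. w i (\<sigma> \<beta> x)) K\<alpha>)"
  have ratK: "of_rat q \<in> K\<alpha>" for q using ev_K[of "[:q:]"] by simp
  have pl_rat: "pl (i, \<beta>) (of_rat q) = rat_abs i q" if "i \<in> ?I" "\<beta> \<in> Z" for i \<beta> q
    using ratK by (simp add: pl_def \<sigma>_rat[OF that(2)] w_rat[OF that(1)])
  have pl_places: "pl (i, \<beta>) \<in> places K\<alpha>" if i: "i \<in> ?I" and \<beta>: "\<beta> \<in> Z" for i \<beta>
  proof -
    interpret w: valued_field "{x. algebraic x}" "w i" by (rule valued_field_algebraic[OF w[OF i]])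
    have "absolute_value_on K\<alpha> (pl (i, \<beta>))"
      unfolding absolute_value_on_def
    proof (intro conjI ballI)
      fix x assume x: "x \<in> K\<alpha>"
      have "algebraic (\<sigma> \<beta> x)" by (rule \<sigma>_alg[OF \<beta> x])
      thus "0 \<le> pl (i, \<beta>) x" "(pl (i, \<beta>) x = 0) = (x = 0)"
        using x w.v_nonneg w.v_eq_0 \<sigma>_0[OF \<beta> x] by (auto simp: pl_def)
      fix y assume y: "y \<in> K\<alpha>"
      have alg: "algebraic (\<sigma> \<beta> y)" by (rule \<sigma>_alg[OF \<beta> y])
      obtain p q where "x = ev p \<alpha>" "y = ev q \<alpha>" using K_ev x y by meson
      hence K: "x + y \<in> K\<alpha>" "x * y \<in> K\<alpha>" using ev_K[of "p + q"] ev_K[of "p * q"] by auto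
      show "pl (i, \<beta>) (x * y) = pl (i, \<beta>) x * pl (i, \<beta>) y"
        using x y K alg \<open>algebraic (\<sigma> \<beta> x)\<close> by (simp add: pl_def \<sigma>_mult[OF \<beta>] w.v_mult)
      show "pl (i, \<beta>) (x + y) \<le> pl (i, \<beta>) x + pl (i, \<beta>) y"
        using x y K alg \<open>algebraic (\<sigma> \<beta> x)\<close> by (simp add: pl_def \<sigma>_add[OF \<beta>] w.v_add)
    qed
    moreover have "pl (i, \<beta>) \<in> extensional K\<alpha>" by (simp add: pl_def)
    moreover have "i = 0 \<or> prime i" using i S by auto
    ultimately show ?thesis using pl_rat[OF i \<beta>] by (auto simp: places_iff)
  qed
  have pl_\<alpha>: "pl (i, \<beta>) \<alpha> = w i \<beta>" if "\<beta> \<in> Z" for i \<beta>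
    using mem_adjoin_rat by (simp add: pl_def \<sigma>_\<alpha>[OF that])
  define V where "V = pl ` (?I \<times> Z)"
  have V: "finite V" "V \<subseteq> places K\<alpha>" using S Z pl_places by (auto simp: V_def)
  have fibre: "card {x \<in> ?I \<times> Z. pl x = v} \<le> local_degree K\<alpha> v" if v: "v \<in> V" for v
  proof -
    obtain i0 \<beta>0 where i0: "i0 \<in> ?I" "\<beta>0 \<in> Z" "v = pl (i0, \<beta>0)" using v by (auto simp: V_def)
    define J where "J = {\<beta> \<in> Z. pl (i0, \<beta>) = v}"
    \<comment> \<open>A place determines its restriction to \<rat>, so all pairs in one fibre share
      the rational place \<open>i0\<close>.\<close>
    have "i = i0" if "i \<in> ?I" "\<beta> \<in> Z" "pl (i, \<beta>) = v" for i \<beta>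
    proof -
      have "rat_abs i q = rat_abs i0 q" for q
        using pl_rat[OF that(1,2), of q] pl_rat[OF i0(1,2), of q] that(3) i0(3) by simp
      thus ?thesis using that(1) i0(1) S by (intro rat_abs_inj) auto
    qed
    hence "{x \<in> ?I \<times> Z. pl x = v} = {i0} \<times> J" using i0 by (auto simp: J_def)
    hence "card {x \<in> ?I \<times> Z. pl x = v} = card J" by (simp add: card_cartesian_product)
    also have "card J \<le> local_degree K\<alpha> v"
    proof -
      have vp: "v \<in> places K\<alpha>" using v V by blast
      obtain b where b: "valued_field.local_basis K\<alpha> v b (local_degree K\<alpha> v)"
        using local_degree_basis[OF vp] by blast
      show ?thesis
      proof (rule valued_field.card_embeddings_le[OF valued_field_places[OF vp] b _ w[OF i0(1)], where \<sigma> = \<sigma> and \<alpha> = \<alpha>])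
        show "w i0 (\<sigma> \<beta> x) = v x" if "\<beta> \<in> J" "x \<in> K\<alpha>" for \<beta> x
          using that by (auto simp: J_def pl_def)
        show "inj_on (\<lambda>\<beta>. \<sigma> \<beta> \<alpha>) J" using \<sigma>_\<alpha> by (auto simp: J_def inj_on_def)
      qed (use Z \<sigma>_alg \<sigma>_add \<sigma>_mult \<sigma>_rat mem_adjoin_rat in \<open>auto simp: J_def\<close>)
    qed
    finally show ?thesis .
  qed
  define T where "T = {v \<in> places K\<alpha>. v \<alpha> > 1}"
  have T: "finite T" "T \<subseteq> places K\<alpha>" using finite_large_places by (auto simp: T_def)
  define g where "g = (\<lambda>v. real (local_degree K\<alpha> v) / degree f * ln (max 1 (v \<alpha>)))"
  have g: "g v \<ge> 0" for v by (simp add: g_def)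
  have "ln (weil_height \<alpha>) = infsum g (places K\<alpha>)" by (simp add: ln_weil_height g_def)
  also have "\<dots> = infsum g (T \<union> V)"
    by (rule infsum_cong_neutral) (use T V in \<open>auto simp: T_def g_def max_def\<close>)
  also have "\<dots> = sum g (T \<union> V)" using T V by simp
  also have "\<dots> \<ge> sum g V" using T V g by (intro sum_mono2) auto
  finally have "degree f * ln (weil_height \<alpha>) \<ge> degree f * sum g V"
    by (intro mult_left_mono) auto
  also have "degree f * sum g V = (\<Sum>v\<in>V. local_degree K\<alpha> v * ln (max 1 (v \<alpha>)))"
    using d0 by (simp add: g_def sum_distrib_left)
  also have "\<dots> \<ge> (\<Sum>v\<in>V. card {x \<in> ?I \<times> Z. pl x = v} * ln (max 1 (v \<alpha>)))"
    by (intro sum_mono mult_right_mono) (auto simp: fibre)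
  also have "(\<Sum>v\<in>V. card {x \<in> ?I \<times> Z. pl x = v} * ln (max 1 (v \<alpha>))) =
      (\<Sum>v\<in>V. \<Sum>x | x \<in> ?I \<times> Z \<and> pl x = v. ln (max 1 (pl x \<alpha>)))"
    by (intro sum.cong refl) simp
  also have "\<dots> = (\<Sum>x\<in>?I \<times> Z. ln (max 1 (pl x \<alpha>)))"
    unfolding V_def using S Z by (intro sum.image_gen[symmetric]) auto
  also have "\<dots> = (\<Sum>i\<in>?I. \<Sum>\<beta>\<in>Z. ln (max 1 (w i \<beta>)))"
    unfolding sum.cartesian_product by (intro sum.cong refl) (auto simp: pl_\<alpha>)
  finally show ?thesis by (simp add: Z_def)
qed

end

section \<open>Conjugates, norms and the product formula\<close>


lemma poly_eq_prod_roots: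
  "poly p x = lead_coeff p * (\<Prod>a\<in>#proots p. x - a)" for p :: "complex poly"
proof -
  have "poly p x = poly (smult (lead_coeff p) (\<Prod>x\<in>#proots p. [:-x, 1:])) x"
    by (simp only: complex_poly_decompose_multiset)
  also have "\<dots> = lead_coeff p * (\<Prod>a\<in>#proots p. x - a)"
    by (simp add: poly_prod_mset image_mset.compositionality o_def)
  finally show ?thesis .
qed

lemma lead_coeff_of_rat_poly: "lead_coeff (map_poly of_rat p :: complex poly) = of_rat (lead_coeff p)"
  by (simp add: degree_map_poly coeff_map_poly)

lemma ev_eq_prod_roots:
  "ev p x = of_rat (lead_coeff p) * (\<Prod>a\<in>#proots (map_poly of_rat p). x - a)"
  unfolding ev_def by (subst poly_eq_prod_roots) (simp only: lead_coeff_of_rat_poly)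

text \<open>Up to powers of leading coefficients the product is a resultant; the induction is the Euclidean algorithm.\<close>

lemma prod_roots_rational:
  assumes "p \<noteq> 0"
  shows "(\<Prod>x\<in>#proots (map_poly of_rat p). ev q x) \<in> \<rat>"
  using assms
proof (induction "degree p" arbitrary: p q rule: less_induct)
  case less
  let ?P = "map_poly of_rat p :: complex poly"
  have P: "?P \<noteq> 0" using less.prems by (simp add: map_poly_eq_0_iff)
  define r where "r = q mod p"
  let ?R = "map_poly of_rat r :: complex poly"
  have ev_r: "ev r x = ev q x" if "x \<in># proots ?P" for x
  proof -
    have "ev p x = 0" using that P by (simp add: ev_def)
    hence "ev (q div p * p + r) x = ev r x" by (simp only: ev_add ev_mult) simp
    thus ?thesis by (simp add: r_def)
  qed
  have eq: "(\<Prod>x\<in>#proots ?P. ev q x) = (\<Prod>x\<in>#proots ?P. ev r x)"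
    by (intro arg_cong[where f = prod_mset] image_mset_cong) (simp add: ev_r)
  show ?case
  proof (cases "degree p = 0 \<or> r = 0")
    case True
    thus ?thesis
    proof
      assume "degree p = 0"
      hence "size (proots ?P) = 0" by (simp add: size_proots_complex degree_map_poly)
      thus ?thesis by simp
    next
      assume "r = 0"
      hence "(\<Prod>x\<in>#proots ?P. ev r x) = (\<Prod>x\<in>#proots ?P. 0)"
        by (intro arg_cong[where f = prod_mset] image_mset_cong) simp
      thus ?thesis unfolding eq by (simp only: prod_mset_constant) simp
    qed
  next
    case False
    hence r: "r \<noteq> 0" "degree r < degree p"
      using degree_mod_less[of p q] less.prems by (auto simp: r_def)
    define l where "l = (of_rat (lead_coeff r) :: complex)"
    define k where "k = (of_rat (lead_coeff p) :: complex)"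
    have k0: "k \<noteq> 0" using less.prems by (simp add: k_def)
    have "(\<Prod>x\<in>#proots ?P. ev r x) = (\<Prod>x\<in>#proots ?P. l * (\<Prod>y\<in>#proots ?R. x - y))"
      by (simp only: ev_eq_prod_roots[of r] l_def)
    also have "\<dots> = l ^ size (proots ?P) * (\<Prod>x\<in>#proots ?P. \<Prod>y\<in>#proots ?R. (-1) * (y - x))"
      by (simp add: prod_mset.distrib)
    also have "(\<Prod>x\<in>#proots ?P. \<Prod>y\<in>#proots ?R. (-1) * (y - x)) =
        ((-1) ^ size (proots ?R)) ^ size (proots ?P) * (\<Prod>x\<in>#proots ?P. \<Prod>y\<in>#proots ?R. y - x)"
      by (simp only: prod_mset.distrib prod_mset_constant)
    also have "(\<Prod>x\<in>#proots ?P. \<Prod>y\<in>#proots ?R. y - x) = (\<Prod>y\<in>#proots ?R. \<Prod>x\<in>#proots ?P. y - x)"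
      by (rule prod_mset.swap)
    also have "(\<Prod>y\<in>#proots ?R. \<Prod>x\<in>#proots ?P. y - x) = (\<Prod>y\<in>#proots ?R. inverse k * ev p y)"
      unfolding ev_eq_prod_roots[of p] k_def[symmetric] using k0
      by (simp flip: mult.assoc)
    also have "\<dots> = inverse k ^ size (proots ?R) * (\<Prod>y\<in>#proots ?R. ev p y)"
      by (simp only: prod_mset.distrib prod_mset_constant)
    also have "l ^ size (proots ?P) * (((-1) ^ size (proots ?R)) ^ size (proots ?P) * \<dots>) \<in> \<rat>"
      using less.hyps[OF r(2,1), of p]
      by (intro Rats_mult Rats_power Rats_inverse) (auto simp: l_def k_def)
    finally show ?thesis unfolding eq .
  qed
qed

text \<open>Induction through P = (X - q0) * R + P(q0): the constant is rational, and
  \<open>R\<close> takes rational values away from \<open>q0\<close>. The exceptional set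
  \<open>E\<close> collects the points already divided out.\<close>

lemma rational_values_imp_rational_coeffs:
  fixes P :: "complex poly"
  assumes "finite E" "\<And>q :: rat. q \<notin> E \<Longrightarrow> poly P (of_rat q) \<in> \<rat>"
  shows "coeff P i \<in> \<rat>"
  using assms
proof (induction "degree P" arbitrary: P E i rule: less_induct)
  case less
  obtain q0 where q0: "q0 \<notin> E" using less.prems(1) ex_new_if_finite[OF infinite_UNIV_char_0] by blast
  define c where "c = poly P (of_rat q0)"
  have c: "c \<in> \<rat>" using less.prems(2)[OF q0] by (simp add: c_def)
  show ?case
  proof (cases "degree P = 0")
    case True
    then obtain a where "P = [:a:]" by (elim degree_eq_zeroE)
    thus ?thesis using c by (auto simp: c_def coeff_pCons split: nat.splits)
  next
    case False
    have "poly (P - [:c:]) (of_rat q0) = 0" by (simp add: c_def)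
    hence "[:- of_rat q0, 1:] dvd P - [:c:]" by (simp only: poly_eq_0_iff_dvd)
    then obtain R where R: "P - [:c:] = [:- of_rat q0, 1:] * R" by (elim dvdE)
    have dP: "degree (P - [:c:]) = degree P" 
      unfolding diff_conv_add_uminus by (rule degree_add_eq_left) (use False in simp)
    hence "R \<noteq> 0" using R False by auto
    hence "degree R < degree P" using dP unfolding R by (subst (asm) degree_mult_eq) auto
    moreover have "poly R (of_rat q) \<in> \<rat>" if q: "q \<notin> insert q0 E" for q
    proof -
      have "poly P (of_rat q) - c = (of_rat q - of_rat q0) * poly R (of_rat q)"
        using arg_cong[OF R, of "\<lambda>p. poly p (of_rat q)"] by (simp add: algebra_simps)
      moreover have "of_rat q - of_rat q0 \<noteq> (0 :: complex)" using q by simp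
      ultimately have "poly R (of_rat q) = (poly P (of_rat q) - c) / (of_rat q - of_rat q0)"
        by (simp add: field_simps)
      thus ?thesis using less.prems(2)[of q] q c by (auto intro!: Rats_divide Rats_diff)
    qed
    ultimately have R_rat: "coeff R j \<in> \<rat>" for j
      using less.hyps[of R "insert q0 E"] less.prems(1) by blast
    have "P = [:- of_rat q0, 1:] * R + [:c:]" using R by (simp add: algebra_simps)
    hence "coeff P i = coeff ([:- of_rat q0, 1:] * R + [:c:]) i" by simp
    also have "\<dots> \<in> \<rat>"
      using R_rat c by (cases i) (auto intro!: Rats_add Rats_diff Rats_mult)
    finally show ?thesis .
  qed
qed

lemma rational_coeffs_imp_of_rat_poly:
  fixes P :: "complex poly"
  assumes "\<And>i. coeff P i \<in> \<rat>"
  obtains p where "P = map_poly of_rat p"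
proof -
  define g where "g = (\<lambda>x. if x = 0 then 0 else SOME q. x = (of_rat q :: complex))"
  have g: "of_rat (g x) = x" if x: "x \<in> \<rat>" for x
  proof -
    obtain q where "x = of_rat q" using x by (elim Rats_cases)
    hence "x = of_rat (SOME q. x = (of_rat q :: complex))" by (rule someI)
    thus ?thesis by (simp add: g_def)
  qed
  have "g 0 = 0" by (simp add: g_def)
  hence "P = map_poly of_rat (map_poly g P)"
    using assms g by (intro poly_eqI) (simp add: coeff_map_poly)
  thus ?thesis by (rule that)
qed

text \<open>A root of \<open>p\<close> is a root of \<open>f\<close>, so \<open>f\<close> divides
  \<open>p\<close> and can be split off until a constant remains. Each factor contributes every root
  of \<open>f\<close> exactly once.\<close>

lemma proots_eq_repeat_minpoly:
  assumes f: "irreducible f" and p: "p \<noteq> 0" and roots: "\<And>x. ev p x = 0 \<Longrightarrow> ev f x = 0"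
  shows "\<exists>e. proots (map_poly of_rat p :: complex poly) = repeat_mset e (mset_set {x. ev f x = 0})"
  using p roots
proof (induction "degree p" arbitrary: p rule: less_induct)
  case less
  let ?P = "\<lambda>p. map_poly of_rat p :: complex poly"
  show ?case
  proof (cases "degree p = 0")
    case True
    hence "size (proots (?P p)) = 0" by (simp add: size_proots_complex degree_map_poly)
    thus ?thesis by (intro exI[of _ 0]) simp
  next
    case False
    hence "degree (?P p) \<noteq> 0" by (simp add: degree_map_poly)
    hence "\<not> constant (poly (?P p))" by (simp add: constant_degree)
    then obtain x where x: "ev p x = 0" using fundamental_theorem_of_algebra[of "?P p"] by (auto simp: ev_def)
    have mf: "is_minpoly f x" using f less.prems(2)[OF x] by (simp add: is_minpoly_def)
    then obtain g where g: "p = f * g" using x minpoly_dvd_iff[OF mf] by (auto elim: dvdE)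
    hence nz: "f \<noteq> 0" "g \<noteq> 0" using less.prems by auto
    have "degree g < degree p"
      using nz minpoly_degree_pos[OF mf] by (simp add: g degree_mult_eq)
    moreover have "ev f y = 0" if "ev g y = 0" for y using less.prems(2)[of y] that by (simp add: g)
    ultimately obtain e where e: "proots (?P g) = repeat_mset e (mset_set {x. ev f x = 0})"
      using less.hyps[of g] nz by blast
    have "?P p = ?P f * ?P g"
      by (intro poly_eq_poly_eq_iff[THEN iffD1] ext) (simp add: g ev_mult[unfolded ev_def])
    hence "proots (?P p) = proots (?P f) + proots (?P g)"
      using nz by (simp add: proots_mult map_poly_eq_0_iff)
    also have "\<dots> = repeat_mset (Suc e) (mset_set {x. ev f x = 0})"
      using minpoly_roots(3)[OF mf] e by simp
    finally show ?thesis by blast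
  qed
qed

text \<open>
  The polynomial with roots \<open>g(t)\<close> is rational and all its roots are conjugates of \<open>g(\<theta>)\<close>, so it is a
  power of \<open>f\<close> up to a constant.
\<close>

lemma sum_over_conjugates:
  fixes F :: "complex \<Rightarrow> real"
  assumes m: "is_minpoly m \<theta>" and f: "is_minpoly f (ev g \<theta>)"
  shows "degree f * (\<Sum>t | ev m t = 0. F (ev g t)) = degree m * (\<Sum>\<beta> | ev f \<beta> = 0. F \<beta>)"
proof -
  define T where "T = {t. ev m t = 0}"
  define Z where "Z = {\<beta>. ev f \<beta> = 0}"
  have T: "finite T" "card T = degree m" "proots (map_poly of_rat m) = mset_set T"
    using minpoly_roots[OF m] by (simp_all add: T_def)
  have Z: "finite Z" "card Z = degree f" using minpoly_roots[OF f] by (simp_all add: Z_def)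
  define P where "P = (\<Prod>t\<in>T. [:- ev g t, 1:])"
  have "poly P (of_rat q) \<in> \<rat>" for q
  proof -
    have "poly P (of_rat q) = (\<Prod>t\<in>T. ev ([:q:] - g) t)"
      by (simp add: P_def poly_prod)
    also have "\<dots> = (\<Prod>t\<in>#proots (map_poly of_rat m). ev ([:q:] - g) t)"
      by (simp only: T(3) prod_unfold_prod_mset)
    also have "\<dots> \<in> \<rat>" by (rule prod_roots_rational[OF minpoly_nz[OF m]])
    finally show ?thesis .
  qed
  hence "coeff P i \<in> \<rat>" for i using rational_values_imp_rational_coeffs[of "{}" P] by simp
  then obtain p where p: "P = map_poly of_rat p" by (rule rational_coeffs_imp_of_rat_poly)
  have "P \<noteq> 0" using T(1) by (simp add: P_def)
  hence "p \<noteq> 0" using p by auto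
  have "ev f x = 0" if "ev p x = 0" for x
  proof -
    have "poly P x = 0" using that p by (simp add: ev_def)
    then obtain t where t: "t \<in> T" "x = ev g t" using T(1) by (auto simp: P_def poly_prod)
    have "ev (f \<circ>\<^sub>p g) \<theta> = 0" using minpoly_root[OF f] by simp
    hence "m dvd f \<circ>\<^sub>p g" using minpoly_dvd_iff[OF m] by blast
    then obtain h where "f \<circ>\<^sub>p g = m * h" by (elim dvdE)
    from arg_cong[OF this, of "\<lambda>p. ev p t"] show ?thesis using t by (simp add: T_def)
  qed
  then obtain e where e: "proots P = repeat_mset e (mset_set Z)"
    using proots_eq_repeat_minpoly[OF minpoly_irreducible[OF f] \<open>p \<noteq> 0\<close>] p by (auto simp: Z_def)
  have "proots P = (\<Sum>t\<in>T. {#ev g t#})" unfolding P_def by (subst proots_prod) auto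
  also have "\<dots> = image_mset (ev g) (mset_set T)"
    using T(1) by (induction T rule: finite_induct) auto
  finally have im: "image_mset (ev g) (mset_set T) = repeat_mset e (mset_set Z)" using e by simp
  have "(\<Sum>t\<in>T. F (ev g t)) = sum_mset (image_mset F (image_mset (ev g) (mset_set T)))"
    by (simp add: sum_unfold_sum_mset image_mset.compositionality o_def)
  also have "\<dots> = sum_mset (image_mset F (repeat_mset e (mset_set Z)))" by (simp only: im)
  also have "\<dots> = e * (\<Sum>\<beta>\<in>Z. F \<beta>)"
  proof -
    have "sum_mset (image_mset F (repeat_mset e M)) = e * sum_mset (image_mset F M)" for M
      by (induction e) (simp_all add: distrib_right sum_mset.distrib)
    thus ?thesis by (simp only: sum_unfold_sum_mset)
  qed
  finally have sum: "(\<Sum>t\<in>T. F (ev g t)) = e * (\<Sum>\<beta>\<in>Z. F \<beta>)" .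
  \<comment> \<open>Comparing sizes identifies \<open>e\<close> as the quotient of the degrees of
    \<open>m\<close> and \<open>f\<close>, that is, the degree of \<rat>(\<theta>) over
    \<rat>(g(\<theta>)).\<close>
  have "size (image_mset (ev g) (mset_set T)) = size (repeat_mset e (mset_set Z))" by (simp only: im)
  hence "degree m = e * degree f" using T Z by simp
  thus ?thesis using sum by (simp add: T_def Z_def)
qed

section \<open>The primitive element theorem\<close>

definition coeffs_in :: "complex set \<Rightarrow> complex poly \<Rightarrow> bool" where
  "coeffs_in k p \<longleftrightarrow> (\<forall>i. coeff p i \<in> k)"

text \<open>A step of long division subtracts a monomial multiple of \<open>q\<close> with
  coefficient in \<open>k\<close>, so the remainder over the complex numbers is already one over
  \<open>k\<close>. Polynomials over the subfield \<rat>(\<theta>) can thus be handled as complex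
  polynomials.\<close>

lemma coeffs_in_mod:
  assumes k: "0 \<in> k" "\<And>x y. x \<in> k \<Longrightarrow> y \<in> k \<Longrightarrow> x - y \<in> k" "\<And>x y. x \<in> k \<Longrightarrow> y \<in> k \<Longrightarrow> x * y \<in> k"
      "\<And>x. x \<in> k \<Longrightarrow> inverse x \<in> k"
    and q: "coeffs_in k q" and p: "coeffs_in k p"
  shows "coeffs_in k (p mod q)"
  using p
proof (induction "degree p" arbitrary: p rule: less_induct)
  case less
  show ?case
  proof (cases "q = 0 \<or> degree p < degree q \<or> p = 0")
    case True
    thus ?thesis using less.prems by (auto simp: mod_poly_less)
  next
    case False
    hence nz: "q \<noteq> 0" "p \<noteq> 0" "degree q \<le> degree p" by auto
    define c where "c = lead_coeff p * inverse (lead_coeff q)"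
    define d where "d = degree p - degree q"
    have c: "c \<in> k" using less.prems q by (auto simp: c_def coeffs_in_def intro: k)
    define p' where "p' = p - monom c d * q"
    have "coeff p' i = coeff p i - (if d \<le> i then c * coeff q (i - d) else 0)" for i
      by (simp add: p'_def coeff_monom_mult)
    hence k': "coeffs_in k p'" using less.prems q c by (auto simp: coeffs_in_def intro!: k)
    have eq: "p' mod q = p mod q" unfolding p'_def by (simp add: poly_mod_diff_left)
    show ?thesis
    proof (cases "p' = 0")
      case True
      thus ?thesis using eq k(1) by (simp add: coeffs_in_def)
    next
      case False
      have "degree (monom c d * q) \<le> degree p"
        using degree_mult_le[of "monom c d" q] degree_monom_le[of c d] nz by (simp add: d_def)
      hence "degree p' \<le> degree p" by (simp add: p'_def degree_diff_le)
      moreover have "coeff p' (degree p) = 0"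
        using nz by (simp add: p'_def coeff_monom_mult d_def c_def)
      ultimately have "degree p' < degree p" using False by (metis eq_zero_or_degree_less)
      thus ?thesis using less.hyps[OF _ k'] eq by simp
    qed
  qed
qed

text \<open>
  For all but finitely many \<open>n\<close>, the number \<open>\<beta>\<close> is the only common root of \<open>g(y)\<close> and
  \<open>f(\<theta> - n y)\<close>, where \<open>\<theta> = \<alpha> + n \<beta>\<close>; as it is a simple one, its minimal polynomial over \<open>\<rat>(\<theta>)\<close> is linear.
\<close>

lemma primitive_element2:
  assumes "algebraic \<alpha>" "algebraic \<beta>"
  obtains \<theta> g h where "algebraic \<theta>" "\<alpha> = ev g \<theta>" "\<beta> = ev h \<theta>"
proof -
  obtain f where f: "is_minpoly f \<alpha>" using minpoly_exists[OF assms(1)] .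
  obtain g where g: "is_minpoly g \<beta>" using minpoly_exists[OF assms(2)] .
  define A where "A = {x. ev f x = 0}"
  define Y where "Y = {y. ev g y = 0}"
  have fin: "finite A" "finite Y" using minpoly_roots[OF f] minpoly_roots[OF g] by (simp_all add: A_def Y_def)
  \<comment> \<open>This set contains every n for which some root y of \<open>g\<close> other than
    \<beta> makes \<theta> - n y a root of \<open>f\<close>.\<close>
  have "finite ((\<lambda>(x, y). (x - \<alpha>) / (\<beta> - y)) ` (A \<times> Y))" using fin by simp
  hence "finite {n :: nat. of_nat n \<in> (\<lambda>(x, y). (x - \<alpha>) / (\<beta> - y)) ` (A \<times> Y)}"
    using finite_vimageI[of _ "of_nat :: nat \<Rightarrow> complex"] by (simp add: vimage_def inj_on_def)
  then obtain n :: nat where n: "of_nat n \<notin> (\<lambda>(x, y). (x - \<alpha>) / (\<beta> - y)) ` (A \<times> Y)"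
    using ex_new_if_finite[OF infinite_UNIV_nat] by blast
  define \<theta> where "\<theta> = \<alpha> + of_nat n * \<beta>"
  have alg: "algebraic \<theta>"
    using algebraic_of_rat[of "of_nat n"] unfolding \<theta>_def by (intro algebraic_plus_mult assms) simp
  obtain m where m: "is_minpoly m \<theta>" using minpoly_exists[OF alg] .
  define k where "k = {ev p \<theta> | p. True}"
  have kI: "ev p \<theta> \<in> k" for p by (auto simp: k_def)
  have kE: "\<exists>p. x = ev p \<theta>" if "x \<in> k" for x using that by (auto simp: k_def)
  have k_rat: "of_rat q \<in> k" for q using kI[of "[:q:]"] by simp
  have k0: "0 \<in> k" using kI[of 0] by simp
  have k\<theta>: "\<theta> \<in> k" using kI[of "[:0, 1:]"] by simp
  have k_diff: "x - y \<in> k" and k_mult: "x * y \<in> k" if xy: "x \<in> k" "y \<in> k" for x y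
  proof -
    obtain p q where "x = ev p \<theta>" "y = ev q \<theta>" using kE xy by meson
    thus "x - y \<in> k" "x * y \<in> k" using kI[of "p - q"] kI[of "p * q"] by simp_all
  qed
  have k_inv: "inverse x \<in> k" if x: "x \<in> k" for x
  proof (cases "x = 0")
    case False
    obtain p where p: "x = ev p \<theta>" using kE[OF x] by blast
    with False have "ev p \<theta> \<noteq> 0" by simp
    from minpoly_inverse[OF m this] obtain q where "ev q \<theta> = inverse (ev p \<theta>)" by blast
    thus ?thesis using kI[of q] p by simp
  qed (use k0 in simp)
  have k_add: "x + y \<in> k" if "x \<in> k" "y \<in> k" for x y
    using k_diff[OF that(1) k_diff[OF k0 that(2)]] by simp
  let ?G = "map_poly of_rat g :: complex poly"
  define B where "B = map_poly of_rat f \<circ>\<^sub>p [:\<theta>, - of_nat n:]"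
  have nk: "- of_nat n \<in> k" using k_rat[of "- of_nat n"] by (simp add: of_rat_minus)
  have Gk: "coeffs_in k ?G" using k_rat by (simp add: coeffs_in_def coeff_map_poly)
  have comp: "coeffs_in k (map_poly of_rat p \<circ>\<^sub>p [:\<theta>, - of_nat n:])" for p
  proof (induction p)
    case (pCons a p)
    have "coeff ([:\<theta>, - of_nat n:] * q) i \<in> k" if "coeffs_in k q" for q i
    proof (cases i)
      case 0
      thus ?thesis using that k\<theta> by (simp add: coeffs_in_def k_mult)
    next
      case (Suc j)
      have "coeff ([:\<theta>, - of_nat n:] * q) i = \<theta> * coeff q i + (- of_nat n) * coeff q j"
        by (simp add: Suc)
      thus ?thesis using that k\<theta> nk unfolding coeffs_in_def by (simp only: k_add k_mult)
    qed
    moreover have "coeff [:of_rat a :: complex:] i \<in> k" for i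
      using k_rat[of a] k0 by (auto simp: coeff_pCons split: nat.splits)
    moreover have "map_poly of_rat (pCons a p) \<circ>\<^sub>p [:\<theta>, - of_nat n:] =
       [:of_rat a:] + [:\<theta>, - of_nat n:] * (map_poly of_rat p \<circ>\<^sub>p [:\<theta>, - of_nat n:])"
      using pCons.hyps by (simp add: map_poly_pCons pcompose_pCons)
    ultimately show ?case using pCons.IH k_add unfolding coeffs_in_def
      by (simp only: coeff_add) blast
  qed (use k0 in \<open>simp add: coeffs_in_def\<close>)
  have G0: "?G \<noteq> 0" using minpoly_nz[OF g] by (simp add: map_poly_eq_0_iff)
  have "?G \<noteq> 0 \<and> coeffs_in k ?G \<and> poly ?G \<beta> = 0"
    using G0 Gk minpoly_root[OF g] by (simp add: ev_def)
  \<comment> \<open>A polynomial of least degree plays the role of the minimal polynomial of \<beta>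
    over \<rat>(\<theta>).\<close>
  from ex_has_least_nat[where P = "\<lambda>p. p \<noteq> 0 \<and> coeffs_in k p \<and> poly p \<beta> = 0" and m = degree, OF this]
  obtain h where h: "h \<noteq> 0" "coeffs_in k h" "poly h \<beta> = 0"
    and min: "\<And>p. p \<noteq> 0 \<Longrightarrow> coeffs_in k p \<Longrightarrow> poly p \<beta> = 0 \<Longrightarrow> degree h \<le> degree p" by auto
  have dvd: "h dvd p" if "coeffs_in k p" "poly p \<beta> = 0" for p
  proof (rule ccontr)
    assume "\<not> h dvd p"
    hence nz: "p mod h \<noteq> 0" by (simp add: dvd_eq_mod_eq_0)
    have "poly (p mod h) \<beta> = 0"
      using that(2) h(3) by (simp add: poly_mod)
    moreover have "coeffs_in k (p mod h)"
      by (rule coeffs_in_mod[OF k0 k_diff k_mult k_inv h(2) that(1)])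
    ultimately have "degree h \<le> degree (p mod h)" using min nz by blast
    moreover have "degree (p mod h) < degree h" using degree_mod_less[of h p] h(1) nz by auto
    ultimately show False by simp
  qed
  have hG: "h dvd ?G" using Gk minpoly_root[OF g] by (intro dvd) (auto simp: ev_def)
  have hB: "h dvd B"
    using comp minpoly_root[OF f] unfolding B_def
    by (intro dvd) (auto simp: ev_def poly_pcompose \<theta>_def)
  have only: "y = \<beta>" if y: "poly h y = 0" for y
  proof (rule ccontr)
    assume ne: "y \<noteq> \<beta>"
    have "poly ?G y = 0" "poly B y = 0" using hG hB y by (auto elim!: dvdE)
    hence yY: "y \<in> Y" and "ev f (\<theta> - of_nat n * y) = 0"
      by (auto simp: Y_def ev_def B_def poly_pcompose mult.commute)
    hence "\<alpha> + of_nat n * \<beta> - of_nat n * y \<in> A" by (simp add: A_def \<theta>_def)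
    moreover have "of_nat n = (\<alpha> + of_nat n * \<beta> - of_nat n * y - \<alpha>) / (\<beta> - y)"
      using ne by (simp add: field_simps)
    ultimately show False using n yY by (metis (mono_tags, lifting) SigmaI case_prod_conv image_eqI)
  qed
  have "proots h \<subseteq># mset_set Y"
  proof -
    obtain q where q: "?G = h * q" using hG by (elim dvdE)
    hence "q \<noteq> 0" using G0 by auto
    hence "mset_set Y = proots h + proots q"
      using minpoly_roots(3)[OF g] q h(1) by (simp add: Y_def proots_mult)
    thus ?thesis by simp
  qed
  hence "count (proots h) \<beta> \<le> count (mset_set Y) \<beta>" by (rule mset_subset_eq_count)
  also have "\<dots> \<le> 1" by (simp add: count_mset_set')
  finally have "count (proots h) \<beta> \<le> 1" .
  hence "proots h \<subseteq># {#\<beta>#}"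
    using only h(1) by (intro mset_subset_eqI) (auto simp: order_root)
  from size_mset_mono[OF this] have "size (proots h) \<le> 1" by simp
  hence "degree h \<le> 1" by (simp add: size_proots_complex)
  moreover have "degree h \<noteq> 0"
  proof
    assume "degree h = 0"
    then obtain a where "h = [:a:]" by (elim degree_eq_zeroE)
    thus False using h by simp
  qed
  ultimately have "degree h = 1" by simp
  then obtain a b where ab: "h = [:a, b:]" "b \<noteq> 0" by (rule degree1_coeffs)
  have "a \<in> k" "b \<in> k" using h(2) ab by (auto simp: coeffs_in_def coeff_pCons dest: spec[of _ 0] spec[of _ 1])
  moreover have "\<beta> = (0 - a) * inverse b" using h(3) ab by (simp add: field_simps eq_neg_iff_add_eq_0)
  ultimately have \<beta>: "\<beta> \<in> k" by (metis k_mult k_inv k_diff k0)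
  have "\<alpha> = \<theta> - (- (- of_nat n)) * \<beta>" by (simp add: \<theta>_def)
  hence "\<alpha> = \<theta> + (- of_nat n) * \<beta>" by simp
  hence "\<alpha> \<in> k" using k_add k_mult nk \<beta> k\<theta> by metis
  thus ?thesis using that alg kE \<beta> by metis
qed

lemma primitive_element:
  assumes "finite A" "\<And>\<alpha>. \<alpha> \<in> A \<Longrightarrow> algebraic \<alpha>"
  shows "\<exists>\<theta>. algebraic \<theta> \<and> (\<forall>\<alpha>\<in>A. \<exists>g. \<alpha> = ev g \<theta>)"
  using assms
proof (induction A rule: finite_induct)
  case empty
  show ?case by (intro exI[of _ 0]) auto
next
  case (insert \<alpha> A)
  then obtain \<theta> where \<theta>: "algebraic \<theta>" "\<forall>\<alpha>\<in>A. \<exists>g. \<alpha> = ev g \<theta>" by auto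
  have "algebraic \<alpha>" using insert by simp
  then obtain \<eta> g h where \<eta>: "algebraic \<eta>" "\<alpha> = ev g \<eta>" "\<theta> = ev h \<eta>"
    by (rule primitive_element2[OF _ \<theta>(1)])
  have "\<exists>g. \<beta> = ev g \<eta>" if \<beta>: "\<beta> \<in> A" for \<beta>
  proof -
    obtain g where "\<beta> = ev g \<theta>" using bspec[OF \<theta>(2) \<beta>] by (elim exE)
    hence "\<beta> = ev (g \<circ>\<^sub>p h) \<eta>" using \<eta>(3) by simp
    thus ?thesis by blast
  qed
  thus ?case using \<eta> by blast
qed

section \<open>The product formula over \<rat>\<close>

lemma product_formula_int:
  assumes a: "a \<noteq> 0" and S: "finite S" "\<And>p. p \<in> S \<Longrightarrow> prime p" "nat ` prime_factors a \<subseteq> S"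
  shows "ln \<bar>real_of_int a\<bar> = (\<Sum>p\<in>S. real (multiplicity (int p) a) * ln p)"
proof -
  have "\<bar>a\<bar> = (\<Prod>p\<in>prime_factors a. p ^ multiplicity p a)"
    using prod_prime_factors[OF a] by simp
  hence "\<bar>real_of_int a\<bar> = (\<Prod>p\<in>prime_factors a. real_of_int p ^ multiplicity p a)"
    by (metis (no_types, lifting) of_int_abs of_int_power of_int_prod prod.cong)
  hence "ln \<bar>real_of_int a\<bar> = (\<Sum>p\<in>prime_factors a. ln (real_of_int p ^ multiplicity p a))"
    by (simp add: ln_prod in_prime_factors_iff prime_gt_0_int)
  also have "\<dots> = (\<Sum>p\<in>prime_factors a. real (multiplicity p a) * ln p)"
    by (intro sum.cong refl) (simp add: ln_realpow in_prime_factors_iff prime_gt_0_int)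
  also have "\<dots> = (\<Sum>p\<in>nat ` prime_factors a. real (multiplicity (int p) a) * ln p)"
  proof (subst sum.reindex)
    show "inj_on nat (prime_factors a)"
      by (intro inj_onI) (metis in_prime_factors_iff nat_eq_iff prime_ge_0_int)
  qed (auto intro!: sum.cong simp: in_prime_factors_iff prime_ge_0_int)
  also have "\<dots> = (\<Sum>p\<in>S. real (multiplicity (int p) a) * ln p)"
  proof (rule sum.mono_neutral_left[OF S(1,3)], rule ballI)
    fix p assume p: "p \<in> S - nat ` prime_factors a"
    have "\<not> int p dvd a"
    proof
      assume "int p dvd a"
      hence "int p \<in> prime_factors a" using p S(2)[of p] a by (auto simp: in_prime_factors_iff)
      hence "p \<in> nat ` prime_factors a" by (metis image_eqI nat_int)
      thus False using p by simp
    qed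
    thus "real (multiplicity (int p) a) * ln p = 0" by (simp add: not_dvd_imp_multiplicity_0)
  qed
  finally show ?thesis .
qed

text \<open>\<open>S0\<close> consists of the primes in numerator and denominator; the terms at
  other primes vanish. Admitting every larger \<open>S\<close> lets several numbers share one finite
  set of primes.\<close>

lemma product_formula:
  assumes q: "q \<noteq> 0"
  shows "\<exists>S0. finite S0 \<and> (\<forall>p\<in>S0. prime p) \<and>
    (\<forall>S. finite S \<and> (\<forall>p\<in>S. prime p) \<and> S0 \<subseteq> S \<longrightarrow> (\<Sum>i\<in>insert 0 S. ln (rat_abs i q)) = 0)"
proof -
  obtain a b where ab: "quotient_of q = (a, b)" by fastforce
  hence b: "b > 0" and q_eq: "q = of_int a / of_int b" using quotient_of_denom_pos quotient_of_div by auto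
  have a: "a \<noteq> 0" using q_eq q by auto
  let ?S0 = "nat ` prime_factors a \<union> nat ` prime_factors b"
  have main: "(\<Sum>i\<in>insert 0 S. ln (rat_abs i q)) = 0"
    if S: "finite S" "\<And>p. p \<in> S \<Longrightarrow> prime p" "?S0 \<subseteq> S" for S
  proof -
    have S0: "0 \<notin> S" using S(2)[of 0] by auto
    have "ln (rat_abs p q) = real (multiplicity (int p) b) * ln p - real (multiplicity (int p) a) * ln p"
      if "p \<in> S" for p
    proof -
      have p: "prime p" "p > 0" using S(2)[OF that] prime_gt_0_nat by auto
      have "ln (real p powi (int (multiplicity (int p) b) - int (multiplicity (int p) a))) =
         real (multiplicity (int p) b) * ln p - real (multiplicity (int p) a) * ln p"
        using p by (simp add: power_int_diff ln_div ln_realpow)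
      thus ?thesis using p q by (simp add: rat_abs_def padic_abs_def ab)
    qed
    moreover have "ln (rat_abs 0 q) = ln \<bar>real_of_int a\<bar> - ln \<bar>real_of_int b\<bar>"
      using a b by (simp add: rat_abs_def q_eq of_rat_divide abs_divide ln_div)
    ultimately have "(\<Sum>i\<in>insert 0 S. ln (rat_abs i q)) = ln \<bar>real_of_int a\<bar> - ln \<bar>real_of_int b\<bar> +
       (\<Sum>p\<in>S. real (multiplicity (int p) b) * ln p - real (multiplicity (int p) a) * ln p)"
      using S(1) S0 by simp
    also have "\<dots> = 0"
      using product_formula_int[OF a S(1,2)] product_formula_int[of b S] b S by (simp add: sum_subtractf)
    finally show ?thesis .
  qed
  have primes: "prime p" if "p \<in> ?S0" for p
    using that by (auto simp: in_prime_factors_iff prime_ge_0_int)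
  show ?thesis using primes main by (intro exI[of _ ?S0] conjI allI impI ballI) (simp | blast)+
qed

section \<open>The lower bound\<close>


text \<open>One extension per rational place is fixed, on all algebraic numbers at once; the
  different places of a number field are reached from it by conjugating the argument.\<close>

definition w_abs :: "nat \<Rightarrow> complex \<Rightarrow> real" where
  "w_abs i = (if i = 0 then cmod else SOME w. absolute_value_on {x. algebraic x} w \<and>
     (\<forall>q. w (of_rat q) = padic_abs i q) \<and>
     (\<forall>x y. algebraic x \<longrightarrow> algebraic y \<longrightarrow> w (x + y) \<le> max (w x) (w y)) \<and>
     (\<forall>x. algebraic_int x \<longrightarrow> w x \<le> 1))"

lemma w_abs_prime:
  assumes "prime p"
  shows "absolute_value_on {x. algebraic x} (w_abs p)" "w_abs p (of_rat q) = padic_abs p q"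
    "algebraic x \<Longrightarrow> algebraic y \<Longrightarrow> w_abs p (x + y) \<le> max (w_abs p x) (w_abs p y)"
    "algebraic_int x \<Longrightarrow> w_abs p x \<le> 1"
proof -
  let ?P = "\<lambda>w. absolute_value_on {x. algebraic x} w \<and> (\<forall>q. w (of_rat q) = padic_abs p q) \<and>
     (\<forall>x y. algebraic x \<longrightarrow> algebraic y \<longrightarrow> w (x + y) \<le> max (w x) (w y)) \<and>
     (\<forall>x. algebraic_int x \<longrightarrow> w x \<le> 1)"
  obtain w where w: "?P w" by (rule padic_extension[OF assms]) auto
  have "?P (SOME w. ?P w)" by (rule someI[where P = ?P, OF w])
  hence "?P (w_abs p)" using prime_gt_0_nat[OF assms] unfolding w_abs_def by simp
  thus "absolute_value_on {x. algebraic x} (w_abs p)" "w_abs p (of_rat q) = padic_abs p q"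
    "algebraic x \<Longrightarrow> algebraic y \<Longrightarrow> w_abs p (x + y) \<le> max (w_abs p x) (w_abs p y)"
    "algebraic_int x \<Longrightarrow> w_abs p x \<le> 1" by blast+
qed

lemma w_abs_0 [simp]: "w_abs 0 = cmod"
  by (simp add: w_abs_def)

lemma absolute_value_cmod: "absolute_value_on K cmod"
  by (auto simp: absolute_value_on_def norm_mult norm_triangle_ineq)

lemma w_abs:
  assumes "i = 0 \<or> prime i"
  shows "absolute_value_on {x. algebraic x} (w_abs i)" "w_abs i (of_rat q) = rat_abs i q"
proof -
  have "cmod (of_rat q) = \<bar>of_rat q\<bar>"
    by (cases q) (simp add: of_rat_rat norm_divide)
  thus "absolute_value_on {x. algebraic x} (w_abs i)" "w_abs i (of_rat q) = rat_abs i q"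
    using assms w_abs_prime[of i] absolute_value_cmod prime_gt_0_nat[of i]
    by (cases "i = 0"; simp add: rat_abs_def)+
qed

section \<open>Sums over the conjugates of a primitive element\<close>

context
  fixes m :: "rat poly" and \<theta> :: complex
  assumes m: "is_minpoly m \<theta>"
begin

lemma root_algebraic: "ev m t = 0 \<Longrightarrow> algebraic t"
  using minpoly_nz[OF m] by (rule algebraic_if_ev_eq_0)

lemma conjugate_relation:
  assumes "ev q (ev g \<theta>) = 0" "ev m t = 0"
  shows "ev q (ev g t) = 0"
  using ev_eq_conjugate[OF m assms(2), of "q \<circ>\<^sub>p g" 0] assms(1) by simp

text \<open>The product of \<open>ev b t\<close> over all conjugates t is a non-zero rational
  number, the norm, and the product formula over \<rat> applies to it.\<close>

lemma conjugate_product_formula: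
  assumes b: "ev b \<theta> \<noteq> 0"
  shows "\<exists>S0. finite S0 \<and> (\<forall>p\<in>S0. prime p) \<and>
    (\<forall>S. finite S \<and> (\<forall>p\<in>S. prime p) \<and> S0 \<subseteq> S \<longrightarrow>
       (\<Sum>i\<in>insert 0 S. \<Sum>t | ev m t = 0. ln (w_abs i (ev b t))) = 0)"
proof -
  define T where "T = {t. ev m t = 0}"
  have T: "finite T" "proots (map_poly of_rat m) = mset_set T"
    using minpoly_roots[OF m] by (simp_all add: T_def)
  have nz: "ev b t \<noteq> 0" if "t \<in> T" for t
    using minpoly_inverse[OF m b] that unfolding T_def by blast
  have alg: "algebraic (ev b t)" if "t \<in> T" for t
    using that by (auto simp: T_def intro: algebraic_ev root_algebraic)
  have "(\<Prod>t\<in>T. ev b t) \<in> \<rat>"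
    using prod_roots_rational[OF minpoly_nz[OF m], of b] by (simp only: T(2) prod_unfold_prod_mset)
  then obtain q where q: "(\<Prod>t\<in>T. ev b t) = of_rat q" by (elim Rats_cases)
  have "(\<Prod>t\<in>T. ev b t) \<noteq> 0" using T(1) nz by simp
  hence q0: "q \<noteq> 0" using q by auto
  obtain S0 where S0: "finite S0" "\<forall>p\<in>S0. prime p"
    "\<forall>S. finite S \<and> (\<forall>p\<in>S. prime p) \<and> S0 \<subseteq> S \<longrightarrow> (\<Sum>i\<in>insert 0 S. ln (rat_abs i q)) = 0"
    using product_formula[OF q0] by (elim exE conjE)
  have ln_eq: "(\<Sum>t\<in>T. ln (w_abs i (ev b t))) = ln (rat_abs i q)" if i: "i = 0 \<or> prime i" for i
  proof -
    interpret w: valued_field "{x. algebraic x}" "w_abs i"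
      by (rule valued_field_algebraic[OF w_abs(1)[OF i]])
    have "w_abs i (\<Prod>t\<in>A. ev b t) = (\<Prod>t\<in>A. w_abs i (ev b t)) \<and> algebraic (\<Prod>t\<in>A. ev b t)" if "A \<subseteq> T" for A
      using finite_subset[OF that T(1)] that
    proof (induction A rule: finite_induct)
      case empty
      show ?case using w.v_1 w.zero_one_closed by simp
    next
      case (insert t A)
      thus ?case using alg[of t] by (auto simp: w.v_mult intro: algebraic_plus_mult)
    qed
    from this[of T] have "rat_abs i q = (\<Prod>t\<in>T. w_abs i (ev b t))"
      using q w_abs(2)[OF i, of q] by simp
    moreover have "w_abs i (ev b t) \<noteq> 0" if "t \<in> T" for t
      using w.v_eq_0[of "ev b t"] nz[OF that] alg[OF that] by simp
    ultimately show ?thesis using ln_prod[of T "\<lambda>t. w_abs i (ev b t)"] T(1) by simp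
  qed
  have "(\<Sum>i\<in>insert 0 S. \<Sum>t\<in>T. ln (w_abs i (ev b t))) = 0"
    if S: "finite S \<and> (\<forall>p\<in>S. prime p) \<and> S0 \<subseteq> S" for S
  proof -
    have "(\<Sum>i\<in>insert 0 S. \<Sum>t\<in>T. ln (w_abs i (ev b t))) = (\<Sum>i\<in>insert 0 S. ln (rat_abs i q))"
      using S by (intro sum.cong refl ln_eq) auto
    also have "\<dots> = 0" by (rule S0(3)[rule_format, OF S])
    finally show ?thesis .
  qed
  with S0(1,2) show ?thesis unfolding T_def by (intro exI[of _ S0] conjI allI impI)
qed

text \<open>The conjugates of \<open>ev g \<theta>\<close> are hit equally often by the conjugates
  of \<theta>. This expresses the heights of different numbers through sums over the same index
  set.\<close>

lemma height_conjugate_sum: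
  assumes S: "finite S" "\<And>p. p \<in> S \<Longrightarrow> prime p"
  shows "(\<Sum>i\<in>insert 0 S. \<Sum>t | ev m t = 0. ln (max 1 (w_abs i (ev g t)))) \<le> degree m * ln (weil_height (ev g \<theta>))"
proof -
  have "algebraic \<theta>" using root_algebraic minpoly_root[OF m] by blast
  hence "algebraic (ev g \<theta>)" by (rule algebraic_ev)
  then obtain f where f: "is_minpoly f (ev g \<theta>)" by (rule minpoly_exists)
  define F where "F = (\<lambda>\<beta>. \<Sum>i\<in>insert 0 S. ln (max 1 (w_abs i \<beta>)))"
  have d: "real (degree f) > 0" using minpoly_degree_pos[OF f] by simp
  have prime: "i = 0 \<or> prime i" if "i \<in> insert 0 S" for i using that S(2) by auto
  have "(\<Sum>\<beta> | ev f \<beta> = 0. F \<beta>) \<le> degree f * ln (weil_height (ev g \<theta>))"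
    unfolding F_def
    by (subst sum.swap) (intro height_lower_bound[OF f S] w_abs prime; assumption)
  hence "degree m * (\<Sum>\<beta> | ev f \<beta> = 0. F \<beta>) \<le> degree m * (degree f * ln (weil_height (ev g \<theta>)))"
    by (intro mult_left_mono) auto
  hence "degree f * (\<Sum>t | ev m t = 0. F (ev g t)) \<le> degree f * (degree m * ln (weil_height (ev g \<theta>)))"
    using sum_over_conjugates[OF m f, of F] by (simp add: mult_ac)
  hence "(\<Sum>t | ev m t = 0. F (ev g t)) \<le> degree m * ln (weil_height (ev g \<theta>))"
    using d by simp
  thus ?thesis unfolding F_def by (subst (asm) sum.swap)
qed

end

section \<open>The local inequalities\<close>

lemma sinh_add_ge:
  fixes a b :: real
  assumes "a \<ge> 0" "b \<ge> 0"
  shows "sinh a + sinh b \<le> sinh (a + b)"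
proof -
  have "sinh a * 1 \<le> sinh a * cosh b" "1 * sinh b \<le> cosh a * sinh b"
    using assms by (intro mult_left_mono mult_right_mono cosh_real_ge_1; simp)+
  thus ?thesis by (simp add: sinh_add)
qed

text \<open>\<open>sinh\<close> is superadditive on non-negative arguments because
  \<open>cosh\<close> is at least 1. This merges the estimates for the single summands into one in
  U, the quantity that the heights control.\<close>

lemma sum_sinh_le:
  fixes u :: "'i \<Rightarrow> real"
  assumes "\<And>i. i \<in> A \<Longrightarrow> u i \<ge> 0"
  shows "(\<Sum>i\<in>A. sinh (u i)) \<le> sinh (\<Sum>i\<in>A. u i)"
  using assms
proof (induction A rule: infinite_finite_induct)
  case (insert i A)
  have "(\<Sum>i\<in>insert i A. sinh (u i)) \<le> sinh (u i) + sinh (\<Sum>i\<in>A. u i)" using insert by simp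
  also have "\<dots> \<le> sinh (u i + (\<Sum>i\<in>A. u i))" using insert by (intro sinh_add_ge sum_nonneg) auto
  finally show ?case using insert by simp
qed auto

definition golden :: real where "golden = (1 + sqrt 5) / 2"

lemma golden_gt_1: "golden > 1"
  by (simp add: golden_def real_less_rsqrt)

lemma golden_square: "golden ^ 2 = golden + 1"
  by (simp add: golden_def power2_eq_square field_simps)

lemma inverse_golden: "inverse golden = golden - 1"
  using golden_square golden_gt_1 by (simp add: field_simps power2_eq_square)

text \<open>The origin of the golden ratio in the bound: golden - 1 / golden = 1, so ln (2 sinh U)
  vanishes at \<open>ln golden\<close>.\<close>

lemma sinh_ln_golden: "sinh (ln golden) = 1 / 2"
  using golden_gt_1 by (simp add: sinh_ln_real inverse_golden)

text \<open>The graph of the concave function \<open>ln (2 sinh U)\<close> lies below its tangent at \<open>ln golden\<close>.\<close>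

lemma ln_sinh_le_tangent:
  assumes U: "U > 0"
  shows "ln (2 * sinh U) \<le> sqrt 5 * (U - ln golden)"
proof -
  define F where "F = (\<lambda>x. sqrt 5 * (x - ln golden) - ln (2 * sinh x))"
  define F' where "F' = (\<lambda>x. sqrt 5 - cosh x / sinh x)"
  have deriv: "(F has_real_derivative F' x) (at x)" if "x > 0" for x
    unfolding F_def F'_def using that by (auto intro!: derivative_eq_intros simp: field_simps)
  have l: "ln golden > 0" using golden_gt_1 by simp
  have F0: "F (ln golden) = 0" by (simp add: F_def sinh_ln_golden)
  \<comment> \<open>The condition coth x <= sqrt 5 reads 1 + sinh^2 x <= 5 sinh^2 x, that is, sinh x
    >= 1/2. So the sign of \<open>F'\<close> changes exactly at \<open>ln golden\<close>.\<close>
  have cs: "cosh x \<le> sqrt 5 * sinh x \<longleftrightarrow> sinh x \<ge> 1 / 2" if "x > 0" for x :: real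
  proof -
    have s: "sinh x > 0" using that by simp
    have "cosh x \<le> sqrt 5 * sinh x \<longleftrightarrow> cosh x ^ 2 \<le> (sqrt 5 * sinh x) ^ 2"
      using s cosh_real_pos[of x] by (intro power_mono_iff[symmetric]) auto
    also have "\<dots> \<longleftrightarrow> (1 / 2) ^ 2 \<le> sinh x ^ 2"
      by (simp add: cosh_square_eq power_mult_distrib power_divide mult.commute)
    also have "\<dots> \<longleftrightarrow> 1 / 2 \<le> sinh x" using s by (intro power_mono_iff) auto
    finally show ?thesis .
  qed
  have cs': "sqrt 5 * sinh x \<le> cosh x \<longleftrightarrow> sinh x \<le> 1 / 2" if "x > 0" for x :: real
  proof -
    have s: "sinh x > 0" using that by simp
    have "sqrt 5 * sinh x \<le> cosh x \<longleftrightarrow> (sqrt 5 * sinh x) ^ 2 \<le> cosh x ^ 2"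
      using s cosh_real_pos[of x] by (intro power_mono_iff[symmetric]) auto
    also have "\<dots> \<longleftrightarrow> sinh x ^ 2 \<le> (1 / 2) ^ 2"
      by (simp add: cosh_square_eq power_mult_distrib power_divide mult.commute)
    also have "\<dots> \<longleftrightarrow> sinh x \<le> 1 / 2" using s by (intro power_mono_iff) auto
    finally show ?thesis .
  qed
  have "F U \<ge> 0"
  proof (cases "U \<ge> ln golden")
    case True
    have "F (ln golden) \<le> F U"
    proof (rule DERIV_nonneg_imp_nondecreasing[OF True])
      fix x assume x: "ln golden \<le> x" "x \<le> U"
      have "sinh (ln golden) \<le> sinh x" using x(1) by (simp only: sinh_real_le_iff)
      hence "sinh x \<ge> 1 / 2" by (simp only: sinh_ln_golden)
      hence "F' x \<ge> 0" using cs[of x] x l by (simp add: F'_def field_simps)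
      thus "\<exists>y. (F has_real_derivative y) (at x) \<and> 0 \<le> y" using deriv[of x] x l by auto
    qed
    thus ?thesis using F0 by simp
  next
    case False
    hence le: "U \<le> ln golden" by simp
    have "F (ln golden) \<le> F U"
    proof (rule DERIV_nonpos_imp_nonincreasing[OF le])
      fix x assume x: "U \<le> x" "x \<le> ln golden"
      have "sinh x \<le> sinh (ln golden)" using x(2) by (simp only: sinh_real_le_iff)
      hence "sinh x \<le> 1 / 2" by (simp only: sinh_ln_golden)
      hence "cosh x \<ge> sqrt 5 * sinh x" using cs'[of x] x U by simp
      hence "F' x \<le> 0" using x U by (simp add: F'_def field_simps)
      thus "\<exists>y. (F has_real_derivative y) (at x) \<and> y \<le> 0" using deriv[of x] x U by auto
    qed
    thus ?thesis using F0 by simp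
  qed
  thus ?thesis by (simp add: F_def)
qed

text \<open>As the sum is real it may be conjugated, and \<open>cnj x - 1/x\<close> is small when \<open>\<bar>x\<bar>\<close> is close to \<open>1\<close>.\<close>

lemma archimedean_bound:
  fixes x :: "'i \<Rightarrow> complex"
  assumes nz: "\<And>j. j \<in> J \<Longrightarrow> x j \<noteq> 0" and real: "(\<Sum>j\<in>J. x j) \<in> \<real>"
    and a: "(\<Sum>j\<in>J. x j) - (\<Sum>j\<in>J. inverse (x j)) \<noteq> 0"
  shows "ln (cmod ((\<Sum>j\<in>J. x j) - (\<Sum>j\<in>J. inverse (x j)))) \<le> sqrt 5 * ((\<Sum>j\<in>J. \<bar>ln (cmod (x j))\<bar>) - ln golden)"
proof -
  let ?a = "(\<Sum>j\<in>J. x j) - (\<Sum>j\<in>J. inverse (x j))"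
  define U where "U = (\<Sum>j\<in>J. \<bar>ln (cmod (x j))\<bar>)"
  have each: "cmod (cnj (x j) - inverse (x j)) = 2 * sinh \<bar>ln (cmod (x j))\<bar>" if j: "j \<in> J" for j
  proof -
    define c where "c = cmod (x j)"
    have c: "c > 0" using nz[OF j] by (simp add: c_def)
    \<comment> \<open>Multiplying by \<open>x j\<close> leaves a real number that depends on
      \<open>c\<close> alone, so the modulus of the difference is |c - 1/c|, which is 2 sinh |ln
      c|.\<close>
    have "(cnj (x j) - inverse (x j)) * x j = of_real (c ^ 2 - 1)"
      using nz[OF j] complex_norm_square[of "x j"] by (simp add: left_diff_distrib right_diff_distrib mult.commute c_def)
    hence "cmod (cnj (x j) - inverse (x j)) * c = \<bar>c ^ 2 - 1\<bar>"
      unfolding c_def by (metis norm_mult norm_of_real)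
    hence "cmod (cnj (x j) - inverse (x j)) = \<bar>c ^ 2 - 1\<bar> / c" using c by (simp add: field_simps)
    also have "\<dots> = \<bar>(c ^ 2 - 1) / c\<bar>" using c by simp
    also have "(c ^ 2 - 1) / c = c - inverse c" using c by (simp add: field_simps power2_eq_square)
    also have "c - inverse c = 2 * sinh (ln c)" using c by (simp add: sinh_ln_real)
    also have "\<bar>2 * sinh (ln c)\<bar> = 2 * sinh \<bar>ln c\<bar>" by (cases "ln c \<ge> 0") auto
    finally show ?thesis by (simp add: c_def)
  qed
  have "(\<Sum>j\<in>J. x j) = cnj (\<Sum>j\<in>J. x j)" using real by (simp add: Reals_cnj_iff)
  hence "?a = (\<Sum>j\<in>J. cnj (x j) - inverse (x j))" by (simp add: cnj_sum sum_subtractf)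
  hence "cmod ?a \<le> (\<Sum>j\<in>J. cmod (cnj (x j) - inverse (x j)))" using norm_sum by metis
  also have "\<dots> = 2 * (\<Sum>j\<in>J. sinh \<bar>ln (cmod (x j))\<bar>)" by (simp add: each sum_distrib_left)
  also have "\<dots> \<le> 2 * sinh U" unfolding U_def by (intro mult_left_mono sum_sinh_le) auto
  finally have le: "cmod ?a \<le> 2 * sinh U" .
  have pos: "cmod ?a > 0" using a by simp
  \<comment> \<open>That the difference is non-zero forces U > 0, as the tangent bound
    requires.\<close>
  hence "sinh U > 0" using le by linarith
  hence "U > 0" by simp
  have "ln (cmod ?a) \<le> ln (2 * sinh U)" using le pos by (intro ln_mono) auto
  also have "\<dots> \<le> sqrt 5 * (U - ln golden)" by (rule ln_sinh_le_tangent) fact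
  finally show ?thesis by (simp add: U_def)
qed

text \<open>The sum of the \<open>x j\<close> has value at most 1 by integrality, and the
  ultrametric inequality bounds the sum of the inverses by the largest of them.\<close>

lemma nonarchimedean_bound:
  fixes x :: "'i \<Rightarrow> complex"
  assumes p: "prime p" and J: "finite J"
    and x: "\<And>j. j \<in> J \<Longrightarrow> algebraic (x j)" "\<And>j. j \<in> J \<Longrightarrow> x j \<noteq> 0"
    and N: "algebraic_int (\<Sum>j\<in>J. x j)" and a: "(\<Sum>j\<in>J. x j) - (\<Sum>j\<in>J. inverse (x j)) \<noteq> 0"
  shows "ln (w_abs p ((\<Sum>j\<in>J. x j) - (\<Sum>j\<in>J. inverse (x j)))) \<le> (\<Sum>j\<in>J. \<bar>ln (w_abs p (x j))\<bar>)"
proof -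
  interpret w: valued_field "{x. algebraic x}" "w_abs p"
    by (rule valued_field_algebraic[OF w_abs_prime(1)[OF p]])
  \<comment> \<open>A product of \<open>max 1 _\<close> in place of a maximum, because its logarithm
    is a sum over \<open>J\<close>.\<close>
  define M where "M = (\<lambda>A. \<Prod>j\<in>A. max 1 (w_abs p (inverse (x j))))"
  have M1: "M A \<ge> 1" for A unfolding M_def by (intro prod_ge_1) auto
  have pos: "w_abs p y > 0" if "algebraic y" "y \<noteq> 0" for y
    using w.v_nonneg[of y] w.v_eq_0[of y] that by (simp add: less_le)
  have alg_sum: "algebraic (\<Sum>j\<in>A. inverse (x j))" if "A \<subseteq> J" for A
    using x that by (intro algebraic_sum) auto
  have sum_le: "w_abs p (\<Sum>j\<in>A. inverse (x j)) \<le> M A" if "A \<subseteq> J" for A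
    using finite_subset[OF that J] that
  proof (induction A rule: finite_induct)
    case empty
    show ?case using w.v_0 M1[of "{}"] by simp
  next
    case (insert j A)
    have "w_abs p (inverse (x j) + (\<Sum>j\<in>A. inverse (x j))) \<le> max (w_abs p (inverse (x j))) (w_abs p (\<Sum>j\<in>A. inverse (x j)))"
      using insert.prems x(1) alg_sum[of A] by (intro w_abs_prime(3)[OF p]) auto
    also have "\<dots> \<le> max (w_abs p (inverse (x j))) (M A)" using insert by auto
    also have "\<dots> \<le> max 1 (w_abs p (inverse (x j))) * M A"
    proof (rule max.boundedI)
      have "max 1 (w_abs p (inverse (x j))) * 1 \<le> max 1 (w_abs p (inverse (x j))) * M A"
        using M1[of A] by (intro mult_left_mono) auto
      thus "w_abs p (inverse (x j)) \<le> max 1 (w_abs p (inverse (x j))) * M A" by simp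
      have "1 * M A \<le> max 1 (w_abs p (inverse (x j))) * M A"
        using M1[of A] by (intro mult_right_mono) auto
      thus "M A \<le> max 1 (w_abs p (inverse (x j))) * M A" by simp
    qed
    also have "\<dots> = M (insert j A)" using insert by (simp add: M_def)
    finally show ?case using insert by simp
  qed
  let ?a = "(\<Sum>j\<in>J. x j) - (\<Sum>j\<in>J. inverse (x j))"
  have algN: "algebraic (\<Sum>j\<in>J. x j)" using N by auto
  have "w_abs p ?a \<le> max (w_abs p (\<Sum>j\<in>J. x j)) (w_abs p (- (\<Sum>j\<in>J. inverse (x j))))"
    using w_abs_prime(3)[OF p, of "\<Sum>j\<in>J. x j" "- (\<Sum>j\<in>J. inverse (x j))"] algN alg_sum[of J] by simp
  also have "\<dots> \<le> M J"
    using w_abs_prime(4)[OF p N] M1[of J] sum_le[of J] w.v_minus[of "\<Sum>j\<in>J. inverse (x j)"] alg_sum[of J] by simp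
  finally have "ln (w_abs p ?a) \<le> ln (M J)"
    using a algN alg_sum[of J] by (intro ln_mono pos algebraic_diff) auto
  also have "\<dots> = (\<Sum>j\<in>J. ln (max 1 (w_abs p (inverse (x j)))))"
    unfolding M_def by (intro ln_prod J) (auto simp: less_max_iff_disj)
  also have "\<dots> \<le> (\<Sum>j\<in>J. \<bar>ln (w_abs p (x j))\<bar>)"
  proof (rule sum_mono)
    fix j assume j: "j \<in> J"
    have "w_abs p (x j) > 0" using x j by (intro pos) auto
    moreover have "w_abs p (inverse (x j)) = inverse (w_abs p (x j))"
      using x(1)[OF j] by (intro w.v_inverse) simp
    ultimately show "ln (max 1 (w_abs p (inverse (x j)))) \<le> \<bar>ln (w_abs p (x j))\<bar>"
      by (auto simp: max_def ln_inverse)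
  qed
  finally show ?thesis .
qed

lemma sum_ln_height_ge:
  fixes \<alpha> :: "'i \<Rightarrow> complex"
  assumes J: "finite J" and \<alpha>: "\<And>j. j \<in> J \<Longrightarrow> algebraic (\<alpha> j)" "\<And>j. j \<in> J \<Longrightarrow> \<alpha> j \<noteq> 0"
    and N_int: "algebraic_int N" and N_real: "totally_real N"
    and N: "(\<Sum>j\<in>J. \<alpha> j) = N" and ne: "(\<Sum>j\<in>J. inverse (\<alpha> j)) \<noteq> N"
  shows "ln golden \<le> 2 * (\<Sum>j\<in>J. ln (weil_height (\<alpha> j)))"
proof -
  obtain \<theta> where \<theta>: "algebraic \<theta>" "\<forall>x\<in>\<alpha> ` J. \<exists>g. x = ev g \<theta>"
    using primitive_element[of "\<alpha> ` J"] J \<alpha>(1) by auto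
  have "\<forall>j\<in>J. \<exists>g. \<alpha> j = ev g \<theta>" using \<theta>(2) by blast
  from bchoice[OF this] obtain g where g: "\<And>j. j \<in> J \<Longrightarrow> \<alpha> j = ev (g j) \<theta>" by blast
  obtain m where m: "is_minpoly m \<theta>" using minpoly_exists[OF \<theta>(1)] .
  define T where "T = {t. ev m t = 0}"
  define n where "n = degree m"
  have T: "finite T" "card T = n" using minpoly_roots[OF m] by (simp_all add: T_def n_def)
  have n: "n > 0" using minpoly_degree_pos[OF m] by (simp add: n_def)
  \<comment> \<open>The inverses are needed as polynomials in \<theta> that are inverses at every
    conjugate as well, so that \<open>a\<close> is conjugated term by term.\<close>
  have "\<exists>h. ev h \<theta> = inverse (\<alpha> j) \<and> (\<forall>t\<in>T. ev h t = inverse (ev (g j) t) \<and> ev (g j) t \<noteq> 0)" if j: "j \<in> J" for j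
  proof -
    have "ev (g j) \<theta> \<noteq> 0" using \<alpha>(2)[OF j] g[OF j] by simp
    from minpoly_inverse[OF m this] obtain h where "ev h \<theta> = inverse (ev (g j) \<theta>)"
      "\<And>\<beta>. ev m \<beta> = 0 \<Longrightarrow> ev h \<beta> = inverse (ev (g j) \<beta>) \<and> ev (g j) \<beta> \<noteq> 0" by blast
    thus ?thesis using g[OF j] by (intro exI[of _ h]) (auto simp: T_def)
  qed
  hence "\<forall>j\<in>J. \<exists>h. ev h \<theta> = inverse (\<alpha> j) \<and> (\<forall>t\<in>T. ev h t = inverse (ev (g j) t) \<and> ev (g j) t \<noteq> 0)" by blast
  from bchoice[OF this] obtain h where h\<theta>: "\<And>j. j \<in> J \<Longrightarrow> ev (h j) \<theta> = inverse (\<alpha> j)"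
    and ht: "\<And>j t. j \<in> J \<Longrightarrow> t \<in> T \<Longrightarrow> ev (h j) t = inverse (ev (g j) t)"
    and gt: "\<And>j t. j \<in> J \<Longrightarrow> t \<in> T \<Longrightarrow> ev (g j) t \<noteq> 0" by blast
  define G where "G = (\<Sum>j\<in>J. g j)"
  define a where "a = G - (\<Sum>j\<in>J. h j)"
  have G\<theta>: "ev G \<theta> = N" using N g by (simp add: G_def)
  have "ev a \<theta> = N - (\<Sum>j\<in>J. inverse (\<alpha> j))" using G\<theta> h\<theta> by (simp add: a_def)
  hence a\<theta>: "ev a \<theta> \<noteq> 0" using ne by simp
  have at: "ev a t = (\<Sum>j\<in>J. ev (g j) t) - (\<Sum>j\<in>J. inverse (ev (g j) t))" if "t \<in> T" for t
    using ht that by (simp add: a_def G_def)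
  have at0: "ev a t \<noteq> 0" if "t \<in> T" for t
    using minpoly_inverse[OF m a\<theta>] that unfolding T_def by blast
  have alg: "algebraic (ev q t)" if "t \<in> T" for q t
    using that unfolding T_def by (auto intro: algebraic_ev root_algebraic[OF m])
  \<comment> \<open>The values of \<open>G\<close> at the conjugates of \<theta> are conjugates of
    \<open>N\<close>, hence real; the Archimedean bound thus applies at every t.\<close>
  have Gt_real: "ev G t \<in> \<real>" if t: "t \<in> T" for t
  proof -
    obtain f where f: "is_minpoly f N" using minpoly_exists[OF algebraic_int_imp_algebraic[OF N_int]] .
    have "ev f (ev G t) = 0"
      using conjugate_relation[OF m, of f G t] minpoly_root[OF f] t by (simp add: G\<theta> T_def)
    thus ?thesis using N_real f unfolding totally_real_def is_minpoly_def ev_def by blast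
  qed
  have Gt_int: "algebraic_int (ev G t)" if t: "t \<in> T" for t
  proof -
    obtain p where p: "poly (map_poly of_int p) N = 0" "lead_coeff p = 1"
      using N_int by (auto simp: algebraic_int_altdef_ipoly)
    have ev_p: "ev (map_poly of_int p) z = poly (map_poly of_int p) z" for z
      by (simp add: ev_def map_poly_map_poly o_def)
    have "ev (map_poly of_int p) (ev G t) = 0"
      using conjugate_relation[OF m, of "map_poly of_int p" G t] p(1) t by (simp add: G\<theta> T_def ev_p)
    thus ?thesis using p(2) by (auto simp: algebraic_int_altdef_ipoly ev_p)
  qed
  \<comment> \<open>A set of primes is good for \<open>b\<close> if the product formula for
    \<open>b\<close> holds over all larger sets. The union \<open>S\<close> below then serves
    \<open>a\<close> and all \<open>g j\<close> simultaneously.\<close>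
  define good where "good = (\<lambda>b S0. finite S0 \<and> (\<forall>p\<in>S0. prime p) \<and>
    (\<forall>S. finite S \<and> (\<forall>p\<in>S. prime p) \<and> S0 \<subseteq> S \<longrightarrow>
       (\<Sum>i\<in>insert 0 S. \<Sum>t\<in>T. ln (w_abs i (ev b t))) = 0))"
  have good: "\<exists>S0. good b S0" if "ev b \<theta> \<noteq> 0" for b
    using conjugate_product_formula[OF m that] unfolding good_def T_def .
  obtain Sa where Sa: "good a Sa" using good[OF a\<theta>] by blast
  have "\<forall>j\<in>J. \<exists>S0. good (g j) S0"
    using \<alpha>(2) g good by metis
  from bchoice[OF this] obtain Sg where Sg: "\<And>j. j \<in> J \<Longrightarrow> good (g j) (Sg j)" by blast
  define S where "S = Sa \<union> (\<Union>j\<in>J. Sg j)"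
  have S: "finite S" "\<And>p. p \<in> S \<Longrightarrow> prime p"
    using Sa Sg J by (auto simp: S_def good_def)
  have sum_0: "(\<Sum>i\<in>insert 0 S. \<Sum>t\<in>T. ln (w_abs i (ev b t))) = 0" if "good b S0" "S0 \<subseteq> S" for b S0
    using that S unfolding good_def by blast
  have sum_a: "(\<Sum>i\<in>insert 0 S. \<Sum>t\<in>T. ln (w_abs i (ev a t))) = 0"
    by (rule sum_0[OF Sa]) (simp add: S_def)
  have sum_g: "(\<Sum>i\<in>insert 0 S. \<Sum>t\<in>T. ln (w_abs i (ev (g j) t))) = 0" if j: "j \<in> J" for j
    by (rule sum_0[OF Sg[OF j]]) (use j in \<open>auto simp: S_def\<close>)
  have S0: "0 \<notin> S" using S(2)[of 0] by auto
  define L where "L = (\<lambda>i t j. \<bar>ln (w_abs i (ev (g j) t))\<bar>)"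
  have height: "(\<Sum>i\<in>insert 0 S. \<Sum>t\<in>T. L i t j) \<le> 2 * n * ln (weil_height (\<alpha> j))" if j: "j \<in> J" for j
  proof -
    \<comment> \<open>The first term on the right sums to 0 by the product formula, which leaves the
      absolute values of the logarithms equal to twice the sum that bounds the height from
      below.\<close>
    have "2 * ln (max 1 (w_abs i (ev (g j) t))) = ln (w_abs i (ev (g j) t)) + L i t j"
      if i: "i \<in> insert 0 S" and t: "t \<in> T" for i t
    proof -
      have ip: "i = 0 \<or> prime i" using i S(2) by auto
      interpret w: valued_field "{x. algebraic x}" "w_abs i"
        by (rule valued_field_algebraic[OF w_abs(1)[OF ip]])
      have "w_abs i (ev (g j) t) > 0"
        using w.v_nonneg[of "ev (g j) t"] w.v_eq_0[of "ev (g j) t"] gt[OF j t] alg[OF t] by (simp add: less_le)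
      thus ?thesis by (auto simp: L_def max_def)
    qed
    hence "2 * (\<Sum>i\<in>insert 0 S. \<Sum>t\<in>T. ln (max 1 (w_abs i (ev (g j) t)))) =
        (\<Sum>i\<in>insert 0 S. \<Sum>t\<in>T. ln (w_abs i (ev (g j) t)) + L i t j)"
      unfolding sum_distrib_left by (intro sum.cong refl)
    also have "\<dots> = (\<Sum>i\<in>insert 0 S. \<Sum>t\<in>T. L i t j)"
      using sum_g[OF j] by (simp only: sum.distrib) 
    finally show ?thesis
      using height_conjugate_sum[OF m S, of "g j"] g[OF j] by (simp add: T_def n_def)
  qed
  have bound_arch: "ln (w_abs 0 (ev a t)) \<le> sqrt 5 * ((\<Sum>j\<in>J. L 0 t j) - ln golden)" if t: "t \<in> T" for t
    using archimedean_bound[of J "\<lambda>j. ev (g j) t"] gt[OF _ t] Gt_real[OF t] at0[OF t]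
    by (simp add: at[OF t] L_def G_def)
  have bound_p: "ln (w_abs p (ev a t)) \<le> sqrt 5 * (\<Sum>j\<in>J. L p t j)" if t: "t \<in> T" and p: "p \<in> S" for t p
  proof -
    have "ln (w_abs p (ev a t)) \<le> (\<Sum>j\<in>J. L p t j)"
      using nonarchimedean_bound[OF S(2)[OF p] J, of "\<lambda>j. ev (g j) t"] gt[OF _ t] Gt_int[OF t] at0[OF t] alg[OF t]
      by (simp add: at[OF t] L_def G_def)
    \<comment> \<open>The sum is non-negative, so the slope 1 may be raised to the slope used at the
      Archimedean place.\<close>
    also have "\<dots> \<le> sqrt 5 * (\<Sum>j\<in>J. L p t j)"
    proof -
      have "0 \<le> (\<Sum>j\<in>J. L p t j)" by (intro sum_nonneg) (simp add: L_def)
      moreover have "1 \<le> sqrt 5" by simp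
      ultimately show ?thesis using mult_right_mono[of 1 "sqrt 5" "\<Sum>j\<in>J. L p t j"] by simp
    qed
    finally show ?thesis .
  qed
  have "0 = (\<Sum>t\<in>T. ln (w_abs 0 (ev a t))) + (\<Sum>p\<in>S. \<Sum>t\<in>T. ln (w_abs p (ev a t)))"
    using sum_a S(1) S0 by simp
  also have "\<dots> \<le> (\<Sum>t\<in>T. sqrt 5 * ((\<Sum>j\<in>J. L 0 t j) - ln golden)) + (\<Sum>p\<in>S. \<Sum>t\<in>T. sqrt 5 * (\<Sum>j\<in>J. L p t j))"
    by (intro add_mono sum_mono bound_arch bound_p)
  \<comment> \<open>The constant \<open>ln golden\<close> occurs once for each of the
    \<open>n\<close> conjugates, which matches the factor \<open>n\<close> in the height
    estimate.\<close>
  also have "\<dots> = sqrt 5 * ((\<Sum>i\<in>insert 0 S. \<Sum>t\<in>T. \<Sum>j\<in>J. L i t j) - n * ln golden)"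
    using S(1) S0 T(2) by (simp add: sum_distrib_left sum_subtractf algebra_simps)
  finally have "0 \<le> (\<Sum>i\<in>insert 0 S. \<Sum>t\<in>T. \<Sum>j\<in>J. L i t j) - n * ln golden"
    by (simp add: zero_le_mult_iff)
  hence "n * ln golden \<le> (\<Sum>i\<in>insert 0 S. \<Sum>t\<in>T. \<Sum>j\<in>J. L i t j)" by simp
  also have "\<dots> = (\<Sum>i\<in>insert 0 S. \<Sum>j\<in>J. \<Sum>t\<in>T. L i t j)"
    by (intro sum.cong refl sum.swap)
  also have "\<dots> = (\<Sum>j\<in>J. \<Sum>i\<in>insert 0 S. \<Sum>t\<in>T. L i t j)" by (rule sum.swap)
  also have "\<dots> \<le> (\<Sum>j\<in>J. 2 * n * ln (weil_height (\<alpha> j)))" by (intro sum_mono height)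
  also have "\<dots> = n * (2 * (\<Sum>j\<in>J. ln (weil_height (\<alpha> j))))" by (simp add: sum_distrib_left mult_ac)
  finally show ?thesis using n by simp
qed

section \<open>The golden ratio\<close>


abbreviation golden_c :: complex where "golden_c \<equiv> complex_of_real golden"

lemma golden_c_square: "golden_c ^ 2 = golden_c + 1"
  using arg_cong[OF golden_square, of complex_of_real] by simp

lemma golden_algebraic_int: "algebraic_int golden_c"
  unfolding algebraic_int_altdef_ipoly
  using golden_c_square by (intro exI[of _ "[:-1, -1, 1:]"]) (simp add: power2_eq_square algebra_simps)

lemma golden_irrational: "golden_c \<notin> \<rat>"
proof
  assume "golden_c \<in> \<rat>"
  hence "golden_c \<in> \<int>" by (rule rational_algebraic_int_is_int[OF golden_algebraic_int])
  then obtain k where "golden_c = of_int k" by (elim Ints_cases)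
  hence k: "golden = of_int k" by (metis of_real_eq_iff of_real_of_int_eq)
  have "sqrt 5 < 3" by (rule real_less_lsqrt) simp_all
  hence "golden < 2" by (simp add: golden_def)
  hence "k < 2" "1 < k" using golden_gt_1 unfolding k by simp_all
  thus False by simp
qed

lemma minpoly_golden:
  obtains f where "is_minpoly f golden_c" "degree f = 2"
proof -
  obtain f where f: "is_minpoly f golden_c"
    using minpoly_exists[OF algebraic_int_imp_algebraic[OF golden_algebraic_int]] .
  have "ev [:-1, -1, 1:] golden_c = 0"
    using golden_c_square by (simp add: of_rat_minus power2_eq_square algebra_simps)
  hence "f dvd [:-1, -1, 1:]" by (simp only: minpoly_dvd_iff[OF f])
  hence "degree f \<le> 2" by (auto dest: dvd_imp_degree_le)
  moreover have "degree f \<noteq> 1"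
  proof
    assume "degree f = 1"
    then obtain a b where ab: "f = [:a, b:]" "b \<noteq> 0" by (rule degree1_coeffs)
    have "of_rat a + golden_c * of_rat b = 0" using minpoly_root[OF f] by (simp add: ab)
    hence "golden_c = of_rat (- a / b)"
      using ab by (simp add: of_rat_divide of_rat_minus field_simps eq_neg_iff_add_eq_0)
    thus False using golden_irrational by simp
  qed
  ultimately have "degree f = 2" using minpoly_degree_pos[OF f] by simp
  thus ?thesis using that f by blast
qed

lemma totally_real_golden: "totally_real golden_c"
  unfolding totally_real_def
proof (intro conjI allI impI)
  show "algebraic golden_c" using golden_algebraic_int by auto
  fix p and z :: complex assume p: "irreducible p \<and> poly (map_poly of_rat p) golden_c = 0"
    and z: "poly (map_poly of_rat p) z = 0"
  have mp: "is_minpoly p golden_c" using p by (simp add: is_minpoly_def ev_def)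
  have "ev [:-1, -1, 1:] golden_c = 0"
    using golden_c_square by (simp add: of_rat_minus power2_eq_square algebra_simps)
  hence "p dvd [:-1, -1, 1:]" by (simp only: minpoly_dvd_iff[OF mp])
  then obtain g where "[:-1, -1, 1:] = p * g" by (elim dvdE)
  from arg_cong[OF this, of "\<lambda>p. ev p z"] z have "z ^ 2 = z + 1"
    by (simp add: ev_def[symmetric] of_rat_minus power2_eq_square algebra_simps)
  hence "(z - golden_c) * (z + golden_c - 1) = 0"
    using golden_c_square by (simp add: power2_eq_square algebra_simps)
  hence "z - golden_c = 0 \<or> z + golden_c - 1 = 0" by (simp only: mult_eq_0_iff)
  hence "z = golden_c \<or> z = of_real (1 - golden)" by (simp add: eq_diff_eq)
  thus "z \<in> \<real>" by auto
qed

lemma golden_c_inverse_ne: "inverse golden_c \<noteq> golden_c"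
proof -
  have "inverse golden \<noteq> golden" by (simp add: inverse_golden)
  thus ?thesis by (metis of_real_eq_iff of_real_inverse)
qed

text \<open>The number 1 - golden satisfies the same quadratic equation as golden, so
  \<open>a\<close> and \<open>b\<close> are consecutive Fibonacci numbers. Starting at exponent 1
  gives \<open>b \<ge> 1\<close>, which allows division by \<open>b\<close>.\<close>

lemma golden_conjugate_powers:
  assumes "n > 0"
  shows "\<exists>a b :: int. a \<ge> 0 \<and> b \<ge> 1 \<and> (1 - golden_c) ^ n = of_int a + of_int b * (1 - golden_c)"
  using assms
proof (induction n rule: nat_induct_non_zero)
  case 1
  show ?case by (intro exI[of _ 0] exI[of _ 1]) simp
next
  case (Suc n)
  then obtain a b :: int where ab: "a \<ge> 0" "b \<ge> 1" "(1 - golden_c) ^ n = of_int a + of_int b * (1 - golden_c)"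
    by blast
  have "(1 - golden_c) ^ 2 = 1 + (1 - golden_c)"
    using golden_c_square by (simp add: power2_eq_square algebra_simps)
  moreover have "(1 - golden_c) ^ Suc n = of_int a * (1 - golden_c) + of_int b * (1 - golden_c) ^ 2"
    by (simp only: power_Suc ab(3)) (simp add: power2_eq_square algebra_simps)
  ultimately have "(1 - golden_c) ^ Suc n = of_int b + of_int (a + b) * (1 - golden_c)"
    by (simp only: of_int_add) (simp add: algebra_simps)
  thus ?case using ab(1,2) by (intro exI[of _ b] exI[of _ "a + b"]) auto
qed

text \<open>
  The powers of \<open>1 - golden = -1/golden\<close> are of the form \<open>a + b (1 - golden)\<close> with integers \<open>b \<ge> 1\<close>, so
  that \<open>- a / b\<close> converges quickly to \<open>1 - golden\<close> both in \<open>\<complex>\<close> and with respect to any \<open>v\<close> as below.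
\<close>

lemma golden_approximation:
  assumes v: "absolute_value_on (adjoin_rat golden_c) v" and vr: "\<And>q. v (of_rat q) = \<bar>of_rat q\<bar>"
    and vg: "v golden_c = golden" and x: "x \<in> adjoin_rat golden_c" and e: "e > 0"
  shows "\<exists>c. v (x - of_rat c) < e \<and> cmod (x - of_rat c) < e"
proof -
  obtain f where f: "is_minpoly f golden_c" "degree f = 2" by (rule minpoly_golden)
  let ?K = "adjoin_rat golden_c"
  have gK: "golden_c \<in> ?K" by (rule mem_adjoin_rat[OF f(1)])
  obtain d :: "nat \<Rightarrow> rat" where "x = (\<Sum>i<degree f. of_rat (d i) * golden_c ^ i)"
    using adjoin_rat_span[OF f(1) x] .
  hence xd: "x = of_rat (d 0) + of_rat (d 1) * golden_c"
    by (simp add: f(2) numeral_2_eq_2)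
  define B where "B = \<bar>real_of_rat (d 1)\<bar> + 1"
  have B: "B > 0" unfolding B_def by (rule add_nonneg_pos) auto
  obtain n0 where n0: "B / e < golden ^ n0" using real_arch_pow[OF golden_gt_1] by blast
  define n where "n = Suc n0"
  have n: "n > 0" "B / golden ^ n < e"
  proof -
    have "golden ^ n0 \<le> golden ^ n" using golden_gt_1 by (intro power_increasing) (auto simp: n_def)
    hence "B / e < golden ^ n" using n0 by simp
    thus "B / golden ^ n < e" using e golden_gt_1 by (simp add: field_simps)
  qed (simp add: n_def)
  obtain a b :: int where ab: "a \<ge> 0" "b \<ge> 1" "(1 - golden_c) ^ n = of_int a + of_int b * (1 - golden_c)"
    using golden_conjugate_powers[OF n(1)] by blast
  \<comment> \<open>Results from x = d 0 + d 1 * golden by replacing golden with 1 + a / b. The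
    error is d 1 / b times the n-th power of 1 - golden, up to sign.\<close>
  define c where "c = d 0 + d 1 + d 1 * of_int a / of_int b"
  have gen: "(p + q * g) - (p + q + q * A / B) = - (q / B * (A + B * (1 - g)))" if "B \<noteq> 0"
    for p q g A B :: complex
  proof -
    have "q / B * (A + B * (1 - g)) = q * A / B + q * (1 - g)" using that by (simp add: distrib_left)
    thus ?thesis by (simp only: right_diff_distrib mult_1_right) simp
  qed
  have "of_rat c = of_rat (d 0) + of_rat (d 1) + of_rat (d 1) * of_int a / (of_int b :: complex)"
    by (simp add: c_def of_rat_add of_rat_mult of_rat_divide)
  hence "x - of_rat c = - (of_rat (d 1) / of_int b * (of_int a + of_int b * (1 - golden_c)))"
    unfolding xd using gen[of "of_int b" "of_rat (d 0)" "of_rat (d 1)" golden_c "of_int a"] ab(2) by simp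
  hence c: "x - of_rat c = - (of_rat (d 1 / of_int b) * (1 - golden_c) ^ n)"
    by (simp only: ab(3)) (simp add: of_rat_divide)
  \<comment> \<open>Stated for any \<open>u\<close>, to be used for both \<open>v\<close> and
    \<open>cmod\<close>. The value of \<open>u\<close> at 1 - golden is forced by golden * (1 -
    golden) = -1.\<close>
  have bound: "u (x - of_rat c) < e" if u: "absolute_value_on ?K u" and ur: "\<And>q. u (of_rat q) = \<bar>of_rat q\<bar>"
    and ug: "u golden_c = golden" for u
  proof -
    interpret u: valued_field ?K u by (rule valued_field_adjoin_rat[OF f(1) u])
    have gK': "1 - golden_c \<in> ?K" by (intro u.closed gK)
    have "golden_c * (1 - golden_c) = - 1"
      using golden_c_square by (simp add: power2_eq_square algebra_simps)
    hence "golden * u (1 - golden_c) = 1"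
      using u.v_mult[OF gK gK'] ug u.v_minus[of 1] u.v_1 u.closed(3) by simp
    hence ug': "u (1 - golden_c) = 1 / golden" using golden_gt_1 by (simp add: field_simps)
    have "u (x - of_rat c) = u (of_rat (d 1 / of_int b)) * u (1 - golden_c) ^ n"
      unfolding c using gK' by (simp only: u.v_minus u.v_mult u.v_power u.closed)
    also have "\<dots> = \<bar>real_of_rat (d 1)\<bar> / \<bar>real_of_int b\<bar> / golden ^ n"
      unfolding ur ug' by (simp add: of_rat_divide power_divide)
    also have "\<dots> \<le> B / 1 / golden ^ n"
      using ab(2) golden_gt_1 by (intro divide_right_mono frac_le) (auto simp: B_def)
    also have "\<dots> < e" using n by simp
    finally show ?thesis .
  qed
  have "cmod (of_rat q) = \<bar>of_rat q\<bar>" for q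
    by (cases q) (simp add: of_rat_rat norm_divide)
  hence "cmod (x - of_rat c) < e"
    using golden_gt_1 by (intro bound absolute_value_cmod) auto
  thus ?thesis using bound[OF v vr vg] by blast
qed

text \<open>Integrality of golden excludes finite places. The triangle inequality, used in both
  directions with the known value at the square root of 5, then fixes \<open>v golden_c\<close>;
  rational approximation determines \<open>v\<close> everywhere and makes the completion
  one-dimensional. The condition \<open>v golden_c > 1\<close> discards the other real place, where
  golden has absolute value 1 / golden.\<close>

lemma golden_place:
  assumes v: "v \<in> places (adjoin_rat golden_c)" and gt: "v golden_c > 1"
  shows "v = restrict cmod (adjoin_rat golden_c)" "local_degree (adjoin_rat golden_c) v = 1" "v golden_c = golden"
proof -
  obtain f where f: "is_minpoly f golden_c" "degree f = 2" by (rule minpoly_golden)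
  let ?K = "adjoin_rat golden_c"
  interpret v: valued_field ?K v by (rule valued_field_places[OF f(1) v])
  have gK: "golden_c \<in> ?K" by (rule mem_adjoin_rat[OF f(1)])
  obtain i where i: "i = 0 \<or> prime i" "\<And>q. v (of_rat q) = rat_abs i q" using v by (auto simp: places_iff)
  have "i = 0"
  proof (rule ccontr)
    assume "i \<noteq> 0"
    hence p: "prime i" using i by simp
    have "v golden_c \<le> 1"
    proof (rule v.v_le_one_if_algebraic_int[OF _ gK golden_algebraic_int])
      show "v (of_int n) \<le> 1" for n
        using i(2)[of "of_int n"] padic_abs_of_int_le[OF p, of n] \<open>i \<noteq> 0\<close> by (simp add: rat_abs_def)
    qed
    thus False using gt by simp
  qed
  hence vr: "v (of_rat q) = \<bar>of_rat q\<bar>" for q using i(2)[of q] by (simp add: rat_abs_def)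
  \<comment> \<open>A square root of 5, so \<open>v s\<close> is determined by
    \<open>v 5 = 5\<close>. Since 2 golden = 1 + s and s = golden - (1 - golden), it bounds
    \<open>v golden_c\<close> from above and from below.\<close>
  define s where "s = 2 * golden_c - 1"
  have K2: "2 \<in> ?K" and v2: "v 2 = 2" using v.of_rat_closed[of 2] vr[of 2] by simp_all
  have sK: "s \<in> ?K" unfolding s_def by (intro v.closed K2 gK)
  have "s ^ 2 = 4 * golden_c ^ 2 - 4 * golden_c + 1"
    by (simp add: s_def power2_eq_square algebra_simps)
  hence "s ^ 2 = of_rat 5" by (simp add: golden_c_square)
  hence "v s ^ 2 = 5" using v.v_power[OF sK, of 2] vr[of 5] by simp
  hence vs: "v s = sqrt 5" using v.v_nonneg[OF sK] by (metis real_sqrt_abs abs_of_nonneg)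
  define t where "t = v golden_c"
  have gK': "1 - golden_c \<in> ?K" by (intro v.closed gK)
  have "golden_c * (1 - golden_c) = - 1"
    using golden_c_square by (simp add: power2_eq_square algebra_simps)
  hence "t * v (1 - golden_c) = 1"
    using v.v_mult[OF gK gK'] v.v_minus[of 1] v.v_1 v.closed(3) by (simp add: t_def)
  hence vg': "v (1 - golden_c) = 1 / t" using gt by (simp add: field_simps t_def)
  have "2 * t \<le> 1 + sqrt 5"
    using v.v_mult[OF K2 gK] v.v_add[of 1 s] v.v_1 vs v2 sK v.closed(3) by (simp add: s_def t_def)
  hence le: "t \<le> golden" by (simp add: golden_def)
  have "sqrt 5 \<le> t + 1 / t"
    using v.v_diff[OF gK gK'] vs vg' by (simp add: t_def s_def)
  moreover have "sqrt 5 = golden + 1 / golden"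
    using inverse_golden by (simp add: golden_def field_simps)
  ultimately have "golden + 1 / golden - (t + 1 / t) \<le> 0" by simp
  \<comment> \<open>The function t + 1 / t is increasing for t > 1; the factorization turns a
    comparison of its values into one of the arguments.\<close>
  moreover have "(g - t) * (1 - 1 / (g * t)) = g + 1 / g - (t + 1 / t)" if "g > 0" "t > 0" for g t :: real
  proof -
    have "(g - t) / (g * t) = 1 / t - 1 / g" using that by (simp add: diff_divide_distrib)
    thus ?thesis by (simp add: right_diff_distrib)
  qed
  ultimately have "(golden - t) * (1 - 1 / (golden * t)) \<le> 0"
    using gt golden_gt_1 by (simp add: t_def)
  moreover have "golden * t > 1" using less_1_mult[OF golden_gt_1, of t] gt by (simp add: t_def)
  hence "1 - 1 / (golden * t) > 0" by simp
  ultimately have "golden - t \<le> 0" by (simp add: mult_le_0_iff)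
  thus vg: "v golden_c = golden" using le by (simp add: t_def)
  have v_eq: "v x = cmod x" if x: "x \<in> ?K" for x
  proof -
    have "\<bar>v x - cmod x\<bar> \<le> e" if e: "e > 0" for e
    proof -
      obtain c where c: "v (x - of_rat c) < e / 2" "cmod (x - of_rat c) < e / 2"
        using golden_approximation[OF v.absolute_value vr vg x, of "e / 2"] e by auto
      have "cmod (of_rat c) = \<bar>of_rat c\<bar>" by (cases c) (simp add: of_rat_rat norm_divide)
      hence "\<bar>v x - \<bar>of_rat c\<bar>\<bar> < e / 2" "\<bar>cmod x - \<bar>of_rat c\<bar>\<bar> < e / 2"
        using v.v_diff_ge[OF x v.of_rat_closed[of c]] norm_triangle_ineq3[of x "of_rat c"] c vr[of c] by simp_all
      thus ?thesis by linarith
    qed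
    from field_le_epsilon[of "\<bar>v x - cmod x\<bar>" 0] this show ?thesis by simp
  qed
  show "v = restrict cmod ?K"
    using v v_eq by (auto simp: places_iff intro!: extensionalityI[of v ?K])
  \<comment> \<open>Rational numbers are dense for \<open>v\<close> in the field, so the element 1
    alone is a basis, with constant 1 in the coefficient bound.\<close>
  have "v.local_basis (\<lambda>_. 1) 1"
    unfolding v.local_basis_def
  proof (intro conjI allI impI ballI)
    show "\<exists>C. \<forall>c :: nat \<Rightarrow> rat. \<forall>i<1. v (of_rat (c i)) \<le> C * v (\<Sum>j<1. of_rat (c j) * 1)"
      by (intro exI[of _ 1]) simp
    fix x and e :: real assume "x \<in> ?K" "e > 0"
    then obtain c where "v (x - of_rat c) < e"
      using golden_approximation[OF v.absolute_value vr vg] by blast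
    thus "\<exists>c :: nat \<Rightarrow> rat. v (x - (\<Sum>j<1. of_rat (c j) * 1)) < e"
      by (intro exI[of _ "\<lambda>_. c"]) simp
  qed (simp add: v.closed)
  thus "local_degree ?K v = 1" by (rule v.local_degree_eq)
qed

text \<open>At most one place contributes, with local degree 1 out of a total degree 2, whence the
  factor 1/2. The reverse inequality is an instance of \<open>sum_ln_height_ge\<close>.\<close>

lemma ln_height_golden_le: "ln (weil_height golden_c) \<le> 1 / 2 * ln golden"
proof -
  obtain f where f: "is_minpoly f golden_c" "degree f = 2" by (rule minpoly_golden)
  let ?K = "adjoin_rat golden_c"
  define g where "g = (\<lambda>v. real (local_degree ?K v) / degree f * ln (max 1 (v golden_c)))"
  define T where "T = places ?K \<inter> {v. v golden_c > 1}"
  have T: "T \<subseteq> {restrict cmod ?K}" using golden_place(1) by (auto simp: T_def)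
  have gT: "g v = 1 / 2 * ln golden" if "v \<in> T" for v
    using golden_place(2,3)[of v] that golden_gt_1 by (simp add: T_def g_def f(2))
  have "ln (weil_height golden_c) = infsum g (places ?K)" by (simp add: ln_weil_height[OF f(1)] g_def)
  also have "\<dots> = infsum g T"
    by (rule infsum_cong_neutral) (auto simp: T_def g_def max_def)
  also have "\<dots> = sum g T" using T by (simp add: finite_subset)
  also have "\<dots> = (\<Sum>v\<in>T. 1 / 2 * ln golden)" by (intro sum.cong refl gT)
  also have "\<dots> = card T * (1 / 2 * ln golden)" by simp
  also have "\<dots> \<le> 1 * (1 / 2 * ln golden)"
    using card_mono[OF _ T] golden_gt_1 by (intro mult_right_mono) auto
  finally show ?thesis by simp
qed

theorem corollary2p2:
  shows "(\<forall>(r :: nat) (\<alpha> :: nat \<Rightarrow> complex) (N :: complex).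
            r \<ge> 1 \<longrightarrow>
            (\<forall>i\<in>{1..r}. algebraic (\<alpha> i) \<and> \<alpha> i \<noteq> 0) \<longrightarrow>
            algebraic_int N \<longrightarrow>
            totally_real N \<longrightarrow>
            (\<Sum>i=1..r. \<alpha> i) = N \<longrightarrow>
            (\<Sum>i=1..r. inverse (\<alpha> i)) \<noteq> N \<longrightarrow>
            (\<Sum>i=1..r. ln (weil_height (\<alpha> i))) \<ge> 1 / 2 * ln ((1 + sqrt 5) / 2))
       \<and> (let \<phi> = complex_of_real ((1 + sqrt 5) / 2) in
            algebraic \<phi> \<and> \<phi> \<noteq> 0 \<and> algebraic_int \<phi> \<and> totally_real \<phi> \<and> inverse \<phi> \<noteq> \<phi> \<and>
            ln (weil_height \<phi>) = 1 / 2 * ln ((1 + sqrt 5) / 2))"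
proof (intro conjI allI impI)
  fix r :: nat and \<alpha> :: "nat \<Rightarrow> complex" and N :: complex
  assume "\<forall>i\<in>{1..r}. algebraic (\<alpha> i) \<and> \<alpha> i \<noteq> 0" "algebraic_int N" "totally_real N"
    "(\<Sum>i=1..r. \<alpha> i) = N" "(\<Sum>i=1..r. inverse (\<alpha> i)) \<noteq> N"
  hence "ln golden \<le> 2 * (\<Sum>i=1..r. ln (weil_height (\<alpha> i)))"
    by (intro sum_ln_height_ge[where N = N]) auto
  thus "(\<Sum>i=1..r. ln (weil_height (\<alpha> i))) \<ge> 1 / 2 * ln ((1 + sqrt 5) / 2)"
    by (simp add: golden_def)
next
  \<comment> \<open>The general inequality for a single summand, with golden itself as the totally
    real algebraic integer N, supplies the lower half of the equality.\<close>
  have "ln golden \<le> 2 * (\<Sum>i\<in>{0 :: nat}. ln (weil_height golden_c))"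
    using golden_algebraic_int totally_real_golden golden_c_inverse_ne golden_gt_1
    by (intro sum_ln_height_ge[where N = golden_c]) auto
  hence "ln (weil_height golden_c) = 1 / 2 * ln golden"
    using ln_height_golden_le by simp
  thus "let \<phi> = complex_of_real ((1 + sqrt 5) / 2) in
            algebraic \<phi> \<and> \<phi> \<noteq> 0 \<and> algebraic_int \<phi> \<and> totally_real \<phi> \<and> inverse \<phi> \<noteq> \<phi> \<and>
            ln (weil_height \<phi>) = 1 / 2 * ln ((1 + sqrt 5) / 2)"
    using golden_algebraic_int totally_real_golden golden_c_inverse_ne golden_gt_1
    unfolding Let_def golden_def[symmetric] by auto
qed

end
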